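(* Let $1\leq l\leq l'<n$, $r,r'\in\mathbb{Z}_n$, $\alpha,\eta\in\mathbb{P}^1(k)$ and $s,m\geq 1$. Assume that $\alpha\neq\eta$. Then, as $H_n(1,q)$-modules, $$\begin{aligned}&M_m\big(l,r,\alpha q^{1-l}(l)_q\big)\otimes M_s\big(l',r',\eta q^{1-l'}(l')_q\big)\\\cong&\Big(\bigoplus_{i=1}^{c(n+l-l')}ms\,P(l'-l-1+2i,\,r+r'+l-i)\Big)\\&\oplus\Big(\bigoplus_{c(l+l'-1)\leq i\leq l'-1}ms\,P(n+l+l'-1-2i,\,r+r'+i)\Big).\end{aligned}$$
   Context: Setting: $k$ is an algebraically closed field, $n>2$ is a fixed integer, $q\in k$ is a primitive $n$-th root of unity, $\mathbb{Z}_n=\mathbb{Z}/n\mathbb{Z}$, and $(i)_q=1+q+\cdots+q^{i-1}$. $H_n(1,q)$ is the Hopf algebra over $k$ (isomorphic to the Drinfeld double of the Taft algebra $H_n(q)$) generated as an algebra by $a,b,c,d$ with relations $ba=qab$, $db=qbd$, $ca=qac$, $dc=qcd$, $bc=cb$, $a^n=0$, $b^n=1$, $c^n=1$, $d^n=0$, $da-qad=1-bc$, with comultiplication $\Delta(a)=a\otimes b+1\otimes a$, $\Delta(b)=b\otimes b$, $\Delta(c)=c\otimes c$, $\Delta(d)=d\otimes c+1\otimes d$, counit $\varepsilon(a)=\varepsilon(d)=0$, $\varepsilon(b)=\varepsilon(c)=1$, and antipode $S(a)=-ab^{-1}$, $S(b)=b^{-1}$, $S(c)=c^{-1}$, $S(d)=-dc^{-1}$.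 All modules are finite-dimensional left $H_n(1,q)$-modules, $\otimes=\otimes_k$ with action through $\Delta$, and $sM$ is the direct sum of $s$ copies of $M$ ($sM=0$ if $s=0$). Simple modules: for $1\leq l\leq n$, $r\in\mathbb{Z}_n$, $V(l,r)$ has basis $v_1,\dots,v_l$ with $av_i=v_{i+1}$ for $i<l$, $av_l=0$, $bv_i=q^{r+i-1}v_i$, $cv_i=q^{i-r-l}v_i$, $dv_1=0$, $dv_i=\alpha_{i-1}(l)v_{i-1}$ for $1<i\leq l$, where $\alpha_i(l)=(i)_q(1-q^{i-l})$. For $1\leq l<n$, $P(l,r)$ is the projective cover of $V(l,r)$, and $P(n,r)=V(n,r)$ (which is projective). Band modules: $\mathbb{P}^1(k)$ is identified with $k\cup\{\infty\}$, with $\beta\infty=\infty\beta=\infty$ for $0\neq\beta\in k$. For $1\leq l<n$, $r\in\mathbb{Z}_n$, $\eta\in\mathbb{P}^1(k)$, the module $M_1(l,r,\eta)$ has basis $v_1,\dots,v_n$ with $bv_i=q^{r+l+i-1}v_i$, $cv_i=q^{i-r}v_i$, $dv_i=\alpha_{i-1}(n-l)v_{i-1}$ for $1<i\leq n-l$, $dv_{n-l+1}=0$, $dv_i=\alpha_{i-n+l-1}(l)v_{i-1}$ for $n-l+1<i\leq n$, and: if $\eta=\infty$, $av_i=0$ for $i\in\{n-l,n\}$, $av_i=v_{i+1}$ otherwise, and $dv_1=v_n$; if $\eta\in k$, $av_i=v_{i+1}$ for $1\leq i<n$, $av_n=0$, and $dv_1=\eta q^lv_n$. With $M_0(l,r,\eta)=0$,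 the modules $M_s(l,r,\eta)$ are determined recursively (up to isomorphism) by the almost split sequences $0\to M_s(l,r,\eta)\to M_{s-1}(l,r,\eta)\oplus M_{s+1}(l,r,\eta)\to M_s(l,r,\eta)\to 0$, $s\geq 1$. Conventions: integers in the second argument of $V$, $P$ and $M_s$ are read modulo $n$; $c(t)=\lfloor (t+1)/2\rfloor$ for $t\in\mathbb{Z}$ (the function $c(\cdot)$ is not to be confused with the generator $c$); a direct sum over an empty range of indices is zero. *)

theory Defs
  imports
    "HOL-Computational_Algebra.Polynomial"
    "Jordan_Normal_Form.Matrix"
    "Jordan_Normal_Form.Matrix_Kernel"
begin

definition primitive_root_of_unity :: "nat \<Rightarrow> 'k::field \<Rightarrow> bool" where
  "primitive_root_of_unity n q \<longleftrightarrow> n > 0 \<and> q ^ n = 1 \<and> (\<forall>j. 0 < j \<and> j < n \<longrightarrow> q ^ j \<noteq> 1)"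

definition qint :: "'k::field \<Rightarrow> nat \<Rightarrow> 'k" where
  "qint q i = (\<Sum>j<i. q ^ j)"

definition alpha :: "'k::field \<Rightarrow> nat \<Rightarrow> nat \<Rightarrow> 'k" where
  "alpha q i l = qint q i * (1 - q powi (int i - int l))"


section \<open>The Hopf algebra \<open>H\<^sub>n(1,q)\<close> and its finite-dimensional left modules\<close>

text \<open>
  \<open>H\<^sub>n(1,q)\<close> is given by generators \<open>a, b, c, d\<close> and relations. A left module structure on the space
  of column vectors \<open>k\<^sup>N\<close> is therefore a choice of one \<open>N \<times> N\<close> matrix for each generator such that the
  defining relations hold. Every finite-dimensional module is of this form after choosing a basis.
  Integer exponents are taken with \<open>powi\<close>; as \<open>q ^ n = 1\<close>, the value
  of \<open>q powi e\<close> depends only on \<open>e\<close> modulo \<open>n\<close>, so elements of the integers modulo \<open>n\<close> are represented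
  by arbitrary integers.
\<close>

datatype generator = GA | GB | GC | GD

record 'k hmodule =
  hdim :: nat
  act :: "generator \<Rightarrow> 'k mat"

definition is_module :: "nat \<Rightarrow> 'k::field \<Rightarrow> 'k hmodule \<Rightarrow> bool" where
  "is_module n q M \<longleftrightarrow>
     (let N = hdim M; a = act M GA; b = act M GB; c = act M GC; d = act M GD in
       a \<in> carrier_mat N N \<and> b \<in> carrier_mat N N \<and> c \<in> carrier_mat N N \<and> d \<in> carrier_mat N N \<and>
       b * a = q \<cdot>\<^sub>m (a * b) \<and> d * b = q \<cdot>\<^sub>m (b * d) \<and>
       c * a = q \<cdot>\<^sub>m (a * c) \<and> d * c = q \<cdot>\<^sub>m (c * d) \<and>
       b * c = c * b \<and>
       a ^\<^sub>m n = 0\<^sub>m N N \<and> b ^\<^sub>m n = 1\<^sub>m N \<and> c ^\<^sub>m n = 1\<^sub>m N \<and> d ^\<^sub>m n = 0\<^sub>m N N \<and>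
       d * a - q \<cdot>\<^sub>m (a * d) = 1\<^sub>m N - b * c)"

text \<open>A linear map \<open>M \<rightarrow> N\<close> is a matrix with \<open>hdim N\<close> rows and \<open>hdim M\<close> columns, so that composition is
  the matrix product.\<close>

definition mod_hom :: "'k::field hmodule \<Rightarrow> 'k hmodule \<Rightarrow> 'k mat set" where
  "mod_hom M N = {F \<in> carrier_mat (hdim N) (hdim M). \<forall>g. F * act M g = act N g * F}"

definition mod_iso :: "nat \<Rightarrow> 'k::field \<Rightarrow> 'k hmodule \<Rightarrow> 'k hmodule \<Rightarrow> bool" where
  "mod_iso n q M N \<longleftrightarrow> is_module n q M \<and> is_module n q N \<and>
     (\<exists>F \<in> mod_hom M N. \<exists>G \<in> mod_hom N M. G * F = 1\<^sub>m (hdim M) \<and> F * G = 1\<^sub>m (hdim N))"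

definition module_sum :: "'k::zero hmodule list \<Rightarrow> 'k hmodule" where
  "module_sum Ms = \<lparr>hdim = sum_list (map hdim Ms), act = (\<lambda>g. diag_block_mat (map (\<lambda>M. act M g) Ms))\<rparr>"

definition copies :: "nat \<Rightarrow> 'k::zero hmodule \<Rightarrow> 'k hmodule" where
  "copies s M = module_sum (replicate s M)"

text \<open>The matrix of \<open>A \<otimes> B\<close> in the basis \<open>v\<^sub>i \<otimes> w\<^sub>j\<close>, ordered lexicographically.\<close>

definition kronecker :: "'k::times mat \<Rightarrow> 'k mat \<Rightarrow> 'k mat" where
  "kronecker A B = mat (dim_row A * dim_row B) (dim_col A * dim_col B)
     (\<lambda>(i, j). A $$ (i div dim_row B, j div dim_col B) * B $$ (i mod dim_row B, j mod dim_col B))"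

text \<open>The comultiplication is \<open>\<Delta>(a) = a \<otimes> b + 1 \<otimes> a\<close>, \<open>\<Delta>(b) = b \<otimes> b\<close>, \<open>\<Delta>(c) = c \<otimes> c\<close>,
  \<open>\<Delta>(d) = d \<otimes> c + 1 \<otimes> d\<close>. The counit and the antipode do not enter into tensor products.\<close>

definition tensor :: "'k::field hmodule \<Rightarrow> 'k hmodule \<Rightarrow> 'k hmodule" where
  "tensor M N = \<lparr>hdim = hdim M * hdim N,
     act = (\<lambda>g. case g of
        GA \<Rightarrow> kronecker (act M GA) (act N GB) + kronecker (1\<^sub>m (hdim M)) (act N GA)
      | GB \<Rightarrow> kronecker (act M GB) (act N GB)
      | GC \<Rightarrow> kronecker (act M GC) (act N GC)
      | GD \<Rightarrow> kronecker (act M GD) (act N GC) + kronecker (1\<^sub>m (hdim M)) (act N GD))\<rparr>"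


section \<open>Projective covers and almost split sequences\<close>

definition mat_range :: "'k::field mat \<Rightarrow> 'k vec set" where
  "mat_range F = (\<lambda>v. F *\<^sub>v v) ` carrier_vec (dim_col F)"

definition mod_epi :: "'k::field hmodule \<Rightarrow> 'k hmodule \<Rightarrow> 'k mat \<Rightarrow> bool" where
  "mod_epi M N F \<longleftrightarrow> F \<in> mod_hom M N \<and> mat_range F = carrier_vec (hdim N)"

definition mod_mono :: "'k::field hmodule \<Rightarrow> 'k hmodule \<Rightarrow> 'k mat \<Rightarrow> bool" where
  "mod_mono M N F \<longleftrightarrow> F \<in> mod_hom M N \<and> mat_kernel F = {0\<^sub>v (hdim M)}"

definition projective :: "nat \<Rightarrow> 'k::field \<Rightarrow> 'k hmodule \<Rightarrow> bool" where
  "projective n q P \<longleftrightarrow> is_module n q P \<and>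
     (\<forall>X Y F H. is_module n q X \<and> is_module n q Y \<and> mod_epi X Y F \<and> H \<in> mod_hom P Y \<longrightarrow>
        (\<exists>K \<in> mod_hom P X. F * K = H))"

text \<open>A projective cover of \<open>V\<close> is a projective module with an essential epimorphism onto \<open>V\<close>.\<close>

definition projective_cover :: "nat \<Rightarrow> 'k::field \<Rightarrow> 'k hmodule \<Rightarrow> 'k hmodule \<Rightarrow> bool" where
  "projective_cover n q P V \<longleftrightarrow> projective n q P \<and>
     (\<exists>F. mod_epi P V F \<and>
        (\<forall>X G. is_module n q X \<and> G \<in> mod_hom X P \<and> mod_epi X V (F * G) \<longrightarrow> mod_epi X P G))"

definition split_epi :: "'k::field hmodule \<Rightarrow> 'k hmodule \<Rightarrow> 'k mat \<Rightarrow> bool" where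
  "split_epi M N F \<longleftrightarrow> F \<in> mod_hom M N \<and> (\<exists>G \<in> mod_hom N M. F * G = 1\<^sub>m (hdim N))"

definition split_mono :: "'k::field hmodule \<Rightarrow> 'k hmodule \<Rightarrow> 'k mat \<Rightarrow> bool" where
  "split_mono M N F \<longleftrightarrow> F \<in> mod_hom M N \<and> (\<exists>G \<in> mod_hom N M. G * F = 1\<^sub>m (hdim M))"

definition left_almost_split :: "nat \<Rightarrow> 'k::field \<Rightarrow> 'k hmodule \<Rightarrow> 'k hmodule \<Rightarrow> 'k mat \<Rightarrow> bool" where
  "left_almost_split n q A B F \<longleftrightarrow> F \<in> mod_hom A B \<and> \<not> split_mono A B F \<and>
     (\<forall>X H. is_module n q X \<and> H \<in> mod_hom A X \<and> \<not> split_mono A X H \<longrightarrow>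
        (\<exists>K \<in> mod_hom B X. K * F = H))"

definition right_almost_split :: "nat \<Rightarrow> 'k::field \<Rightarrow> 'k hmodule \<Rightarrow> 'k hmodule \<Rightarrow> 'k mat \<Rightarrow> bool" where
  "right_almost_split n q B C G \<longleftrightarrow> G \<in> mod_hom B C \<and> \<not> split_epi B C G \<and>
     (\<forall>X H. is_module n q X \<and> H \<in> mod_hom X C \<and> \<not> split_epi X C H \<longrightarrow>
        (\<exists>K \<in> mod_hom X B. G * K = H))"

text \<open>There is an almost split sequence \<open>0 \<rightarrow> A \<rightarrow> B \<rightarrow> C \<rightarrow> 0\<close>.\<close>

definition almost_split_sequence ::
  "nat \<Rightarrow> 'k::field \<Rightarrow> 'k hmodule \<Rightarrow> 'k hmodule \<Rightarrow> 'k hmodule \<Rightarrow> bool" where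
  "almost_split_sequence n q A B C \<longleftrightarrow>
     is_module n q A \<and> is_module n q B \<and> is_module n q C \<and>
     (\<exists>F G. mod_mono A B F \<and> mod_epi B C G \<and> mat_range F = mat_kernel G \<and>
        left_almost_split n q A B F \<and> right_almost_split n q B C G)"


section \<open>Simple, projective and band modules\<close>

text \<open>The endomorphism sending the basis vector \<open>v\<^sub>j\<close> to the sum of the \<open>f j i \<cdot> v\<^sub>i\<close>. The arguments of
  \<open>f\<close> are numbered from 1, whereas matrix entries are numbered from 0. Coefficients at \<open>i = N + 1\<close> are
  discarded, so a shift \<open>v\<^sub>j \<mapsto> v\<^bsub>j+1\<^esub>\<close> sends the last basis vector to 0.\<close>

definition basis_mat :: "nat \<Rightarrow> (nat \<Rightarrow> nat \<Rightarrow> 'k) \<Rightarrow> 'k mat" where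
  "basis_mat N f = mat N N (\<lambda>(i, j). f (Suc j) (Suc i))"

definition simple_module :: "'k::field \<Rightarrow> nat \<Rightarrow> int \<Rightarrow> 'k hmodule" where
  "simple_module q l r = \<lparr>hdim = l,
     act = (\<lambda>g. basis_mat l (case g of
        GA \<Rightarrow> (\<lambda>j i. if i = j + 1 then 1 else 0)
      | GB \<Rightarrow> (\<lambda>j i. if i = j then q powi (r + int j - 1) else 0)
      | GC \<Rightarrow> (\<lambda>j i. if i = j then q powi (int j - r - int l) else 0)
      | GD \<Rightarrow> (\<lambda>j i. if 1 < j \<and> i = j - 1 then alpha q (j - 1) l else 0)))\<rparr>"

text \<open>\<open>P l r\<close> is a choice, for all \<open>l\<close> and \<open>r\<close>, of the modules denoted \<open>P(l,r)\<close>, which are determined only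
  up to isomorphism.\<close>

definition projective_modules :: "nat \<Rightarrow> 'k::field \<Rightarrow> (nat \<Rightarrow> int \<Rightarrow> 'k hmodule) \<Rightarrow> bool" where
  "projective_modules n q P \<longleftrightarrow>
     (\<forall>l r. 1 \<le> l \<and> l < n \<longrightarrow> projective_cover n q (P l r) (simple_module q l r)) \<and>
     (\<forall>r. P n r = simple_module q n r)"

text \<open>The projective line, identified with \<open>k \<union> {\<infinity>}\<close>.\<close>

datatype 'k proj_line = Fin 'k | Infty

text \<open>Multiplication of a point by \<open>\<beta> \<in> k\<close>; only meaningful for nonzero \<open>\<beta>\<close>.\<close>

fun scale_point :: "'k::times \<Rightarrow> 'k proj_line \<Rightarrow> 'k proj_line" where
  "scale_point \<beta> (Fin x) = Fin (x * \<beta>)"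
| "scale_point \<beta> Infty = Infty"

definition band_module_1 :: "nat \<Rightarrow> 'k::field \<Rightarrow> nat \<Rightarrow> int \<Rightarrow> 'k proj_line \<Rightarrow> 'k hmodule" where
  "band_module_1 n q l r \<eta> = \<lparr>hdim = n,
     act = (\<lambda>g. basis_mat n (case g of
        GA \<Rightarrow> (\<lambda>j i. if i = j + 1 \<and> \<not> (\<eta> = Infty \<and> j = n - l) then 1 else 0)
      | GB \<Rightarrow> (\<lambda>j i. if i = j then q powi (r + int l + int j - 1) else 0)
      | GC \<Rightarrow> (\<lambda>j i. if i = j then q powi (int j - r) else 0)
      | GD \<Rightarrow> (\<lambda>j i.
          if j = 1 then
            (if i = n then (case \<eta> of Infty \<Rightarrow> 1 | Fin x \<Rightarrow> x * q ^ l) else 0)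
          else if i = j - 1 \<and> j \<le> n - l then alpha q (j - 1) (n - l)
          else if i = j - 1 \<and> n - l + 1 < j then alpha q (j - (n - l) - 1) l
          else 0)))\<rparr>"

text \<open>\<open>X\<close> is (isomorphic to) the module \<open>M\<^sub>s(l,r,\<eta>)\<close>. These modules are determined up to isomorphism by
  the almost split sequences \<open>0 \<rightarrow> M\<^sub>t \<rightarrow> M\<^bsub>t-1\<^esub> \<oplus> M\<^bsub>t+1\<^esub> \<rightarrow> M\<^sub>t \<rightarrow> 0\<close> for \<open>t \<ge> 1\<close>, starting from \<open>M\<^sub>0 = 0\<close>
  and the explicit module \<open>M\<^sub>1\<close>.\<close>

definition is_band_module ::
  "nat \<Rightarrow> 'k::field \<Rightarrow> nat \<Rightarrow> nat \<Rightarrow> int \<Rightarrow> 'k proj_line \<Rightarrow> 'k hmodule \<Rightarrow> bool" where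
  "is_band_module n q s l r \<eta> X \<longleftrightarrow>
     (\<exists>M. hdim (M 0) = 0 \<and> M 1 = band_module_1 n q l r \<eta> \<and>
        (\<forall>t. is_module n q (M t)) \<and>
        (\<forall>t \<ge> 1. almost_split_sequence n q (M t) (module_sum [M (t - 1), M (t + 1)]) (M t)) \<and>
        mod_iso n q X (M s))"

definition cfun :: "int \<Rightarrow> int" where
  "cfun t = (t + 1) div 2"

end

theory Submission
  imports Defs "Jordan_Normal_Form.Determinant" "HOL-Combinatorics.Permutations" "HOL-Library.Multiset"
begin

text \<open>
  If a weight vector \<open>w\<close> generates a module \<open>T\<close> of dimension \<open>n\<^sup>2\<close>, then the vectors \<open>a\<^sup>x d\<^sup>y w\<close> form a
  basis, and \<open>w\<close> can be mapped to any weight vector of the same weight in any module. Hence the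
  projective covers of the simple modules having a vector of that weight are summands of \<open>T\<close>; the
  operator \<open>a d\<close> has different eigenvalues on these vectors, and every vector of \<open>T\<close> of the weight of
  \<open>w\<close> is a polynomial in \<open>a d\<close> applied to \<open>w\<close>, so that there are no further summands.

  The product of the two quasi-simple band modules has such a generator. If the first parameter is
  \<open>\<infinity>\<close>, then it is \<open>v\<^bsub>n-l\<^esub> \<otimes> v\<^sub>1\<close>. Otherwise conjugate by \<open>1 - W\<close>, where \<open>W\<close> is a multiple of the
  divided power \<open>a\<^sup>n / (n)!\<close>, which makes sense on a tensor product because the vanishing factor \<open>(n)\<close>
  cancels from the Gaussian binomials. It commutes with \<open>a\<close> and changes \<open>d\<close> by terms in \<open>a\<^sup>n\<^sup>-\<^sup>1\<close>,
  and the multiple can be chosen such that the first parameter becomes \<open>0\<close> and the second one the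
  difference of the two. This is nonzero, so the new \<open>d\<close> moves cyclically through the vectors \<open>v\<^sub>1 \<otimes> v\<^sub>j\<close>.

  Finally, the tensor product of an almost split sequence with a fixed module splits as soon as its
  end terms are projective, and projective summands can be cancelled. Climbing both tubes in this
  way multiplies the decomposition by \<open>m\<close> and by \<open>s\<close>.
\<close>

text \<open>Such a \<open>T\<close> is induced from the character of \<open>b\<close> and
  \<open>c\<close> given by the weight of \<open>w\<close>, so homomorphisms out of it correspond to
  the vectors of that weight in the target, and its endomorphisms commute. The values of a d are
  paired: position x of a simple module of dimension u, counted from 0, has the same value as
  position x + n - u. This is why about n/2 covers account for all n powers of a d, and why a
  self-paired position occurs exactly for u = n, where the cover is simple. The normalisation of the
  parameters by q^(1-l) (l) is what lets a single twist serve both factors. It gives d v_1 = x q (l)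
  v_n = t (1 - q^l) v_n with t = x q / (1 - q), and 1 - q^l is the scalar by which 1 - q^(-1) b c
  acts on v_1. With this t the twist removes t (1 - q^l) in the first factor and t (1 - q^l') in the
  second, so x becomes 0 and y becomes y - x.\<close>

section \<open>Linear operators on sequences\<close>

text \<open>Matrices of all sizes are treated as elements of a single ring, so that products carry no dimension
  side conditions. The identity matrix of size \<open>N\<close> becomes the idempotent \<open>E N\<close>, an \<open>N \<times> M\<close> matrix an
  element \<open>F\<close> with \<open>E N * F * E M = F\<close>, and a vector a matrix with the single column \<open>0\<close>.\<close>

typedef (overloaded) 'k lop =
  "{f :: (nat \<Rightarrow> 'k::field) \<Rightarrow> nat \<Rightarrow> 'k.
     (\<forall>u v. f (\<lambda>i. u i + v i) = (\<lambda>i. f u i + f v i)) \<and> (\<forall>c u. f (\<lambda>i. c * u i) = (\<lambda>i. c * f u i))}"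
  morphisms app Abs_lop
  by (rule exI[of _ "\<lambda>v. v"]) auto

setup_lifting type_definition_lop

instantiation lop :: (field) ring_1
begin

lift_definition zero_lop :: "'a lop" is "\<lambda>v i. 0" by auto
lift_definition one_lop :: "'a lop" is "\<lambda>v. v" by auto
lift_definition plus_lop :: "'a lop \<Rightarrow> 'a lop \<Rightarrow> 'a lop" is "\<lambda>f g v i. f v i + g v i"
  by (auto simp: algebra_simps fun_eq_iff)
lift_definition minus_lop :: "'a lop \<Rightarrow> 'a lop \<Rightarrow> 'a lop" is "\<lambda>f g v i. f v i - g v i"
  by (auto simp: algebra_simps fun_eq_iff)
lift_definition uminus_lop :: "'a lop \<Rightarrow> 'a lop" is "\<lambda>f v i. - f v i"
  by (auto simp: algebra_simps fun_eq_iff)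
lift_definition times_lop :: "'a lop \<Rightarrow> 'a lop \<Rightarrow> 'a lop" is "\<lambda>f g v. f (g v)"
  by auto

instance
proof
  show "(0::'a lop) \<noteq> 1"
  proof (transfer, rule notI)
    assume "(\<lambda>(v::nat \<Rightarrow> 'a) i::nat. 0::'a) = (\<lambda>v. v)"
    from fun_cong[OF fun_cong[OF this, of "\<lambda>_. 1"]] show False by auto
  qed
qed (transfer; auto simp: fun_eq_iff algebra_simps)+

end

lift_definition scl :: "'k::field \<Rightarrow> 'k lop \<Rightarrow> 'k lop" (infixr \<open>*o\<close> 75) is "\<lambda>c f v i. c * f v i"
  by (auto simp: algebra_simps fun_eq_iff)

lemma scl_mult_left [simp]: "(c *o F) * G = c *o (F * G)"
  by transfer auto

lemma scl_mult_right [simp]: "F * (c *o G) = c *o (F * G)"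
  by transfer auto

lemma scl_scl [simp]: "c *o d *o F = (c * d) *o F"
  by transfer (auto simp: fun_eq_iff)

lemma scl_add: "c *o (F + G) = c *o F + c *o G"
  and scl_diff: "c *o (F - G) = c *o F - c *o G"
  and scl_add_left: "(c + d) *o F = c *o F + d *o F"
  and scl_diff_left: "(c - d) *o F = c *o F - d *o F"
  by (transfer; auto simp: fun_eq_iff algebra_simps)+

lemma scl_simps [simp]: "0 *o F = 0" "1 *o F = F" "c *o 0 = 0" "(- c) *o F = - (c *o F)" "c *o (- F) = - (c *o F)"
  by (transfer; auto simp: fun_eq_iff)+

lemma scl_sum: "c *o (\<Sum>i\<in>I. f i) = (\<Sum>i\<in>I. c *o f i)"
  by (induction I rule: infinite_finite_induct) (auto simp: scl_add)

lemma scl_sum_left: "(\<Sum>i\<in>I. f i) *o F = (\<Sum>i\<in>I. f i *o F)"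
  by (induction I rule: infinite_finite_induct) (auto simp: scl_add_left)

lemma scl_cancel [simp]: "c *o F = c *o G \<longleftrightarrow> c = 0 \<or> F = G"
proof
  assume "c *o F = c *o G"
  then have "inverse c *o c *o F = inverse c *o c *o G" by simp
  then show "c = 0 \<or> F = G" by (cases "c = 0") auto
qed auto

lemma scl_eq_0 [simp]: "c *o F = 0 \<longleftrightarrow> c = 0 \<or> F = 0"
  using scl_cancel[of c F 0] by simp

lift_definition un :: "nat \<Rightarrow> nat \<Rightarrow> 'k::field lop" is "\<lambda>i j v k. if k = i then v j else 0"
  by (auto simp: fun_eq_iff)

lift_definition E :: "nat \<Rightarrow> 'k::field lop" is "\<lambda>N v k. if k < N then v k else 0"
  by (auto simp: fun_eq_iff)

definition entry :: "'k::field lop \<Rightarrow> nat \<Rightarrow> nat \<Rightarrow> 'k" where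
  "entry F i j = app F (\<lambda>k. if k = j then 1 else 0) i"

lemma app_simps: "app 0 v = (\<lambda>i. 0)" "app 1 v = v" "app (F + G) v i = app F v i + app G v i"
  "app (F - G) v i = app F v i - app G v i" "app (- F) v i = - app F v i"
  "app (F * G) v = app F (app G v)" "app (c *o F) v i = c * app F v i"
  "app (un i j) v k = (if k = i then v j else 0)" "app (E N) v k = (if k < N then v k else 0)"
  by (transfer; auto)+

lemma app_linear: "app F (\<lambda>i. u i + v i) = (\<lambda>i. app F u i + app F v i)"
  "app F (\<lambda>i. c * u i) = (\<lambda>i. c * app F u i)"
  by (transfer; auto)+

lemma app_sum_op: "app (\<Sum>j\<in>I. f j) v i = (\<Sum>j\<in>I. app (f j) v i)"
  by (induction I rule: infinite_finite_induct) (auto simp: app_simps)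

lemma lop_eqI: "(\<And>v i. app F v i = app G v i) \<Longrightarrow> F = G"
  by transfer (auto simp: fun_eq_iff)

lemma un_sandwich: "un i k * F * un j l = entry F k j *o un i l"
proof (rule lop_eqI)
  fix v m
  have "app F (\<lambda>k. if k = j then v l else 0) = app F (\<lambda>k. v l * (if k = j then 1 else 0))"
    by (rule arg_cong[of _ _ "app F"]) auto
  also have "\<dots> = (\<lambda>i. v l * entry F i j)" unfolding app_linear entry_def ..
  finally have "app F (\<lambda>k. if k = j then v l else 0) = (\<lambda>i. v l * entry F i j)" .
  moreover have "app (un j l) v = (\<lambda>k. if k = j then v l else 0)"
    by (auto simp: app_simps)
  ultimately show "app (un i k * F * un j l) v m = app (entry F k j *o un i l) v m"
    by (simp add: app_simps)
qed

lemma un_mult [simp]: "un i j * un k l = (if j = k then un i l else 0)"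
  by (rule lop_eqI) (auto simp: app_simps)

lemma un_neq_0 [simp]: "un i j \<noteq> 0"
proof
  assume "un i j = (0 :: 'a lop)"
  then have "app (un i j) (\<lambda>_. 1) i = app 0 (\<lambda>_. 1::'a) i" by simp
  then show False by (simp add: app_simps)
qed

lemma E_sum: "E N = (\<Sum>i<N. un i i)"
  by (rule lop_eqI) (auto simp: app_simps app_sum_op)

lemma E_mult: "E N * E M = E (min N M)"
  by (rule lop_eqI) (auto simp: app_simps)

lemma E_idem [simp]: "E N * E N = E N"
  by (simp add: E_mult)

lemma E_un [simp]: "E N * un i j = (if i < N then un i j else 0)"
  by (rule lop_eqI) (auto simp: app_simps)

lemma un_E [simp]: "un i j * E N = (if j < N then un i j else 0)"
  by (rule lop_eqI) (auto simp: app_simps)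

lemma E_0 [simp]: "E 0 = 0"
  by (rule lop_eqI) (auto simp: app_simps)

lemma entry_simps: "entry 0 i j = 0" "entry (F + G) i j = entry F i j + entry G i j"
  "entry (F - G) i j = entry F i j - entry G i j" "entry (c *o F) i j = c * entry F i j"
  "entry (E N) i j = (if i = j \<and> i < N then 1 else 0)"
  "entry (un i' j') i j = (if i = i' \<and> j = j' then 1 else 0)"
  by (auto simp: entry_def app_simps)

lemma sandwich_expand: "E N * F * E M = (\<Sum>i<N. \<Sum>j<M. entry F i j *o un i j)"
proof -
  have "E N * F * E M = (\<Sum>i<N. \<Sum>j<M. un i i * F * un j j)"
    unfolding E_sum sum_distrib_right sum_distrib_left by (rule sum.swap)
  then show ?thesis by (simp only: un_sandwich)
qed

subsection \<open>Matrices as operators\<close>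

lift_definition opm :: "'k::field mat \<Rightarrow> 'k lop" is
  "\<lambda>A v i. if i < dim_row A then \<Sum>j<dim_col A. A $$ (i, j) * v j else 0"
  by (auto simp: fun_eq_iff distrib_left sum.distrib sum_distrib_left intro!: sum.cong)

definition mt :: "nat \<Rightarrow> nat \<Rightarrow> 'k::field lop \<Rightarrow> 'k mat" where
  "mt N M F = mat N M (\<lambda>(i, j). entry F i j)"

lemma mt_carrier [simp]: "mt N M F \<in> carrier_mat N M" "dim_row (mt N M F) = N" "dim_col (mt N M F) = M"
  by (auto simp: mt_def)

lemma app_opm: "app (opm A) v i = (if i < dim_row A then \<Sum>j<dim_col A. A $$ (i, j) * v j else 0)"
  by (simp only: opm.rep_eq)

lemma entry_opm: "entry (opm A) i j = (if i < dim_row A \<and> j < dim_col A then A $$ (i, j) else 0)"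
proof -
  have "(\<Sum>k<dim_col A. A $$ (i, k) * (if k = j then 1 else 0)) = (\<Sum>k<dim_col A. if k = j then A $$ (i, k) else 0)"
    by (intro sum.cong refl) auto
  also have "\<dots> = (if j < dim_col A then A $$ (i, j) else 0)"
    by (simp only: sum.delta finite_lessThan lessThan_iff)
  finally have *: "(\<Sum>k<dim_col A. A $$ (i, k) * (if k = j then 1 else 0)) =
    (if j < dim_col A then A $$ (i, j) else 0)" .
  have "entry (opm A) i j = (if i < dim_row A then \<Sum>k<dim_col A. A $$ (i, k) * (if k = j then 1 else 0) else 0)"
    by (simp only: entry_def app_opm)
  then show ?thesis unfolding * by argo
qed

lemma opm_mult:
  assumes "dim_col A = dim_row B"
  shows "opm (A * B) = opm A * opm B"
proof (rule lop_eqI)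
  fix v i
  have "(\<Sum>j<dim_col B. (A * B) $$ (i, j) * v j) =
      (\<Sum>k<dim_col A. A $$ (i, k) * (\<Sum>j<dim_col B. B $$ (k, j) * v j))" if "i < dim_row A"
  proof -
    have "(\<Sum>j<dim_col B. (A * B) $$ (i, j) * v j) =
        (\<Sum>j<dim_col B. \<Sum>k<dim_col A. A $$ (i, k) * B $$ (k, j) * v j)"
      using that assms
      by (intro sum.cong refl) (auto simp: scalar_prod_def sum_distrib_right atLeast0LessThan)
    also have "\<dots> = (\<Sum>k<dim_col A. \<Sum>j<dim_col B. A $$ (i, k) * B $$ (k, j) * v j)"
      by (rule sum.swap)
    finally show ?thesis by (simp add: sum_distrib_left mult.assoc)
  qed
  moreover have "(\<Sum>k<dim_col A. A $$ (i, k) * app (opm B) v k) =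
      (\<Sum>k<dim_col A. A $$ (i, k) * (\<Sum>j<dim_col B. B $$ (k, j) * v j))"
    using assms by (intro sum.cong refl) (simp add: app_opm)
  ultimately show "app (opm (A * B)) v i = app (opm A * opm B) v i"
    by (cases "i < dim_row A")
      (simp_all only: app_opm[of "A * B"] app_opm[of A] app_simps index_mult_mat if_True if_False)
qed

lemma
  assumes "dim_row A = dim_row B" "dim_col A = dim_col B"
  shows opm_add: "opm (A + B) = opm A + opm B"
    and opm_minus: "opm (A - B) = opm A - opm B"
proof -
  have "(\<Sum>j<dim_col B. (A + B) $$ (i, j) * v j) = (\<Sum>j<dim_col B. A $$ (i, j) * v j + B $$ (i, j) * v j)"
    "(\<Sum>j<dim_col B. (A - B) $$ (i, j) * v j) = (\<Sum>j<dim_col B. A $$ (i, j) * v j - B $$ (i, j) * v j)"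
    if "i < dim_row B" for i v
    using that assms by (auto intro!: sum.cong simp: algebra_simps)
  then show "opm (A + B) = opm A + opm B" "opm (A - B) = opm A - opm B"
    using assms by (auto intro!: lop_eqI simp: app_simps app_opm sum.distrib sum_subtractf)
qed

lemma opm_smult: "opm (c \<cdot>\<^sub>m A) = c *o opm A"
proof -
  have "(\<Sum>j<dim_col A. (c \<cdot>\<^sub>m A) $$ (i, j) * v j) = c * (\<Sum>j<dim_col A. A $$ (i, j) * v j)"
    if "i < dim_row A" for i v
    unfolding sum_distrib_left using that by (intro sum.cong refl) (simp add: mult.assoc)
  then show ?thesis by (auto intro!: lop_eqI simp: app_simps app_opm)
qed

lemma opm_zero [simp]: "opm (0\<^sub>m N M) = 0"
  by (rule lop_eqI) (auto simp: app_simps app_opm)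

lemma opm_one [simp]: "opm (1\<^sub>m N) = E N"
proof -
  have "(\<Sum>j<N. 1\<^sub>m N $$ (i, j) * v j) = (\<Sum>j<N. if j = i then v i else 0)" if "i < N" for i and v :: "nat \<Rightarrow> 'a"
    using that by (intro sum.cong) auto
  then show ?thesis by (auto intro!: lop_eqI simp: app_simps app_opm)
qed

lemma E_opm [simp]: "A \<in> carrier_mat N M \<Longrightarrow> E N * opm A = opm A"
  by (rule lop_eqI) (auto simp: app_simps app_opm)

lemma opm_E [simp]: "A \<in> carrier_mat N M \<Longrightarrow> opm A * E M = opm A"
  by (rule lop_eqI) (auto simp: app_simps app_opm)

lemma opm_sum: "opm A = (\<Sum>i<dim_row A. \<Sum>j<dim_col A. A $$ (i, j) *o un i j)"
proof -
  have "opm A = E (dim_row A) * opm A * E (dim_col A)"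
    by (simp add: E_opm[of _ _ "dim_col A"] opm_E[of _ "dim_row A"])
  also have "\<dots> = (\<Sum>i<dim_row A. \<Sum>j<dim_col A. A $$ (i, j) *o un i j)"
    unfolding sandwich_expand by (intro sum.cong refl) (auto simp: entry_opm)
  finally show ?thesis .
qed

lemma opm_mt [simp]: "opm (mt N M F) = E N * F * E M"
  unfolding opm_sum sandwich_expand by (auto simp: mt_def intro!: sum.cong)

lemma mt_opm: "A \<in> carrier_mat N M \<Longrightarrow> mt N M (opm A) = A"
  by (intro eq_matI) (auto simp: mt_def entry_opm)

lemma opm_inj: "A \<in> carrier_mat N M \<Longrightarrow> B \<in> carrier_mat N M \<Longrightarrow> opm A = opm B \<longleftrightarrow> A = B"
  by (metis (no_types) mt_opm[of A N M] mt_opm[of B N M])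

text \<open>The exponent is positive because zeroth powers disagree: \<open>A ^\<^sub>m 0\<close>
  becomes \<open>E N\<close>, while \<open>opm A ^ 0\<close> is the unit of the whole ring.\<close>

lemma opm_pow:
  assumes "A \<in> carrier_mat N N"
  shows "opm (A ^\<^sub>m Suc k) = opm A ^ Suc k"
proof (induction k)
  case 0
  have "opm (A ^\<^sub>m Suc 0) = opm (1\<^sub>m N) * opm A"
    using assms by (subst opm_mult[symmetric]) auto
  then show ?case using E_opm[OF assms] by simp
next
  case (Suc k)
  have "opm (A ^\<^sub>m Suc (Suc k)) = opm (A ^\<^sub>m Suc k) * opm A"
    unfolding pow_mat.simps(2)[of A "Suc k"] using assms by (intro opm_mult) auto
  then show ?case unfolding Suc power_Suc2[of "opm A" "Suc k"] .
qed

lemma opm_pow': "A \<in> carrier_mat N N \<Longrightarrow> k > 0 \<Longrightarrow> opm (A ^\<^sub>m k) = opm A ^ k"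
  using opm_pow[of A N] gr0_implies_Suc by metis

lemma E_pow: "F * E N = F \<Longrightarrow> k > 0 \<Longrightarrow> F ^ k * E N = F ^ k"
  by (cases k) (simp_all only: power_Suc2 mult.assoc)

text \<open>Finite dimension enters here. In the ring of all operators a right inverse need not be a
  left inverse, so \<open>S\<close> is cut down to an N by N block and the fact about square
  matrices is used.\<close>

lemma left_right_inverse:
  assumes "F * E N = F" "E N * F = F" "F * S = E N"
  shows "E N * S * E N * F = E N" "F * (E N * S * E N) = E N"
proof -
  let ?A = "mt N N F" and ?B = "mt N N S"
  have F: "opm ?A = F" by (simp add: assms(1,2))
  have S: "opm ?B = E N * S * E N" by simp
  have "opm (?A * ?B) = F * (E N * S * E N)" by (simp only: opm_mult[of ?A ?B] mt_carrier F S)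
  also have "\<dots> = F * E N * S * E N" by (simp only: mult.assoc)
  also have "\<dots> = F * S * E N" by (simp only: assms(1))
  also have "\<dots> = opm (1\<^sub>m N)" by (simp add: assms(3))
  finally have e: "opm (?A * ?B) = opm (1\<^sub>m N)" .
  then have "?A * ?B = 1\<^sub>m N"
    using opm_inj[OF mult_carrier_mat[OF mt_carrier(1) mt_carrier(1)] one_carrier_mat] by blast
  then have "?B * ?A = 1\<^sub>m N"
    by (rule mat_mult_left_right_inverse[OF mt_carrier(1) mt_carrier(1)])
  then have "opm (?B * ?A) = E N" by (simp only: opm_one)
  then show "E N * S * E N * F = E N" by (simp only: opm_mult[of ?B ?A] mt_carrier F S)
  show "F * (E N * S * E N) = E N" using e by (simp only: opm_mult[of ?A ?B] mt_carrier F S opm_one)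
qed

section \<open>Modules and homomorphisms as operators\<close>

lemma assoc_ext: "A * B = C \<Longrightarrow> A * (B * X) = C * (X :: 'a :: semigroup_mult)"
  by (simp add: mult.assoc[symmetric])

definition ac :: "'k::field hmodule \<Rightarrow> generator \<Rightarrow> 'k lop" where
  "ac M g = opm (act M g)"

definition ops_module :: "nat \<Rightarrow> 'k::field \<Rightarrow> nat \<Rightarrow> 'k lop \<Rightarrow> 'k lop \<Rightarrow> 'k lop \<Rightarrow> 'k lop \<Rightarrow> bool" where
  "ops_module n q N a b c d \<longleftrightarrow>
     b * a = q *o (a * b) \<and> d * b = q *o (b * d) \<and> c * a = q *o (a * c) \<and> d * c = q *o (c * d) \<and>
     b * c = c * b \<and> a ^ n = 0 \<and> b ^ n = E N \<and> c ^ n = E N \<and> d ^ n = 0 \<and>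
     d * a - q *o (a * d) = E N - b * c"

definition wf_act :: "'k::field hmodule \<Rightarrow> bool" where
  "wf_act M \<longleftrightarrow> (\<forall>g. act M g \<in> carrier_mat (hdim M) (hdim M))"

lemma ac_E:
  assumes "wf_act M"
  shows "E (hdim M) * ac M g = ac M g" "ac M g * E (hdim M) = ac M g"
proof -
  have "act M g \<in> carrier_mat (hdim M) (hdim M)" using assms by (auto simp: wf_act_def)
  from E_opm[OF this] opm_E[OF this] show "E (hdim M) * ac M g = ac M g" "ac M g * E (hdim M) = ac M g"
    by (simp_all only: ac_def)
qed

lemma all_generator: "(\<forall>g. Q g) \<longleftrightarrow> Q GA \<and> Q GB \<and> Q GC \<and> Q GD"
  by (metis generator.exhaust)

lemma is_module_iff:
  assumes "n > 0"
  shows "is_module n q M \<longleftrightarrow> wf_act M \<and> ops_module n q (hdim M) (ac M GA) (ac M GB) (ac M GC) (ac M GD)"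
proof (cases "wf_act M")
  case True
  define N where "N = hdim M"
  define a where "a = act M GA"
  define b where "b = act M GB"
  define c where "c = act M GC"
  define d where "d = act M GD"
  have C: "a \<in> carrier_mat N N" "b \<in> carrier_mat N N" "c \<in> carrier_mat N N" "d \<in> carrier_mat N N"
    using True by (simp_all add: wf_act_def N_def a_def b_def c_def d_def)
  have mult: "opm (x * y) = opm x * opm y" if "x \<in> carrier_mat N N" "y \<in> carrier_mat N N" for x y :: "'a mat"
    using that by (intro opm_mult) (simp add: carrier_matD)
  have inj: "opm x = opm y \<longleftrightarrow> x = y" if "x \<in> carrier_mat N N" "y \<in> carrier_mat N N" for x y :: "'a mat"
    using that by (rule opm_inj)
  have mc: "x * y \<in> carrier_mat N N" if "x \<in> carrier_mat N N" "y \<in> carrier_mat N N" for x y :: "'a mat"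
    using that by (rule mult_carrier_mat)
  have 1: "b * a = q \<cdot>\<^sub>m (a * b) \<longleftrightarrow> opm b * opm a = q *o (opm a * opm b)"
    using C by (subst inj[symmetric]) (simp_all add: mc mult opm_smult)
  have 2: "d * b = q \<cdot>\<^sub>m (b * d) \<longleftrightarrow> opm d * opm b = q *o (opm b * opm d)"
    using C by (subst inj[symmetric]) (simp_all add: mc mult opm_smult)
  have 3: "c * a = q \<cdot>\<^sub>m (a * c) \<longleftrightarrow> opm c * opm a = q *o (opm a * opm c)"
    using C by (subst inj[symmetric]) (simp_all add: mc mult opm_smult)
  have 4: "d * c = q \<cdot>\<^sub>m (c * d) \<longleftrightarrow> opm d * opm c = q *o (opm c * opm d)"
    using C by (subst inj[symmetric]) (simp_all add: mc mult opm_smult)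
  have 5: "b * c = c * b \<longleftrightarrow> opm b * opm c = opm c * opm b"
    using C by (subst inj[symmetric]) (simp_all add: mc mult opm_smult)
  have pow: "x ^\<^sub>m n = y \<longleftrightarrow> opm x ^ n = opm y" if "x \<in> carrier_mat N N" "y \<in> carrier_mat N N" for x y :: "'a mat"
    using inj[OF pow_carrier_mat[OF that(1)] that(2)] opm_pow'[OF that(1) assms] by metis
  have 6: "d * a - q \<cdot>\<^sub>m (a * d) = 1\<^sub>m N - b * c \<longleftrightarrow>
      opm d * opm a - q *o (opm a * opm d) = E N - opm b * opm c"
  proof -
    have dims: "x \<in> carrier_mat N N \<Longrightarrow> dim_row x = N" "x \<in> carrier_mat N N \<Longrightarrow> dim_col x = N" for x :: "'a mat"
      by auto
    have "opm (d * a - q \<cdot>\<^sub>m (a * d)) = opm d * opm a - q *o (opm a * opm d)"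
      using C mc[OF C(4) C(1)] mc[OF C(1) C(4)] by (subst opm_minus) (simp_all add: mult opm_smult)
    moreover have "opm (1\<^sub>m N - b * c) = E N - opm b * opm c"
      using C mc[OF C(2) C(3)] by (subst opm_minus) (simp_all add: mult)
    moreover have "d * a - q \<cdot>\<^sub>m (a * d) \<in> carrier_mat N N" "1\<^sub>m N - b * c \<in> carrier_mat N N"
      using mc[OF C(1) C(4)] mc[OF C(2) C(3)] by (auto intro!: minus_carrier_mat smult_carrier_mat)
    ultimately show ?thesis using inj by metis
  qed
  have "is_module n q M \<longleftrightarrow> b * a = q \<cdot>\<^sub>m (a * b) \<and> d * b = q \<cdot>\<^sub>m (b * d) \<and>
       c * a = q \<cdot>\<^sub>m (a * c) \<and> d * c = q \<cdot>\<^sub>m (c * d) \<and>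
       b * c = c * b \<and>
       a ^\<^sub>m n = 0\<^sub>m N N \<and> b ^\<^sub>m n = 1\<^sub>m N \<and> c ^\<^sub>m n = 1\<^sub>m N \<and> d ^\<^sub>m n = 0\<^sub>m N N \<and>
       d * a - q \<cdot>\<^sub>m (a * d) = 1\<^sub>m N - b * c"
    using C unfolding is_module_def N_def[symmetric] a_def[symmetric] b_def[symmetric] c_def[symmetric]
      d_def[symmetric] Let_def by blast
  also have "\<dots> \<longleftrightarrow> ops_module n q N (opm a) (opm b) (opm c) (opm d)"
    unfolding 1 2 3 4 5 6 ops_module_def pow[OF C(1) zero_carrier_mat] pow[OF C(2) one_carrier_mat]
      pow[OF C(3) one_carrier_mat] pow[OF C(4) zero_carrier_mat] opm_zero opm_one ..
  finally show ?thesis using True by (simp add: ac_def a_def b_def c_def d_def N_def)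
next
  case False
  then show ?thesis unfolding is_module_def wf_act_def all_generator Let_def by blast
qed

definition hom :: "'k::field hmodule \<Rightarrow> 'k hmodule \<Rightarrow> 'k lop set" where
  "hom M N = {F. E (hdim N) * F = F \<and> F * E (hdim M) = F \<and> (\<forall>g. F * ac M g = ac N g * F)}"

lemma homD: "F \<in> hom M N \<Longrightarrow> E (hdim N) * F = F" "F \<in> hom M N \<Longrightarrow> F * E (hdim M) = F"
  "F \<in> hom M N \<Longrightarrow> F * ac M g = ac N g * F"
  by (auto simp: hom_def)

lemma homI: "E (hdim N) * F = F \<Longrightarrow> F * E (hdim M) = F \<Longrightarrow> (\<And>g. F * ac M g = ac N g * F) \<Longrightarrow> F \<in> hom M N"
  by (auto simp: hom_def)

lemma hom_comp: "F \<in> hom M N \<Longrightarrow> G \<in> hom N L \<Longrightarrow> G * F \<in> hom M L"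
  unfolding hom_def mem_Collect_eq by (metis mult.assoc)

lemma hom_id: "wf_act M \<Longrightarrow> E (hdim M) \<in> hom M M"
  by (rule homI) (simp_all add: ac_E)

lemma hom_add: "F \<in> hom M N \<Longrightarrow> G \<in> hom M N \<Longrightarrow> F + G \<in> hom M N"
  and hom_diff: "F \<in> hom M N \<Longrightarrow> G \<in> hom M N \<Longrightarrow> F - G \<in> hom M N"
  and hom_scl: "F \<in> hom M N \<Longrightarrow> c *o F \<in> hom M N"
  and hom_0: "0 \<in> hom M N"
  by (simp_all add: hom_def algebra_simps)

lemma hom_sum: "(\<And>i. i \<in> I \<Longrightarrow> f i \<in> hom M N) \<Longrightarrow> sum f I \<in> hom M N"
  by (induction I rule: infinite_finite_induct) (auto simp: hom_0 hom_add)

lemma hom_opm: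
  assumes "wf_act M" "wf_act N" "F \<in> mod_hom M N"
  shows "opm F \<in> hom M N"
proof (rule homI)
  have F: "F \<in> carrier_mat (hdim N) (hdim M)" "\<And>g. F * act M g = act N g * F"
    using assms(3) by (auto simp: mod_hom_def)
  show "E (hdim N) * opm F = opm F" "opm F * E (hdim M) = opm F"
    using F by (auto intro: E_opm opm_E)
  fix g
  have "act M g \<in> carrier_mat (hdim M) (hdim M)" "act N g \<in> carrier_mat (hdim N) (hdim N)"
    using assms by (auto simp: wf_act_def)
  then show "opm F * ac M g = ac N g * opm F"
    using F(1) F(2)[of g] opm_mult[of F "act M g"] opm_mult[of "act N g" F] by (simp add: ac_def)
qed

lemma mod_hom_mt:
  assumes "wf_act M" "wf_act N" "F \<in> hom M N"
  shows "mt (hdim N) (hdim M) F \<in> mod_hom M N" "opm (mt (hdim N) (hdim M) F) = F"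
proof -
  show o: "opm (mt (hdim N) (hdim M) F) = F" by (simp add: homD(1,2)[OF assms(3)])
  let ?F = "mt (hdim N) (hdim M) F"
  have "?F * act M g = act N g * ?F" for g
  proof -
    have M: "act M g \<in> carrier_mat (hdim M) (hdim M)" "act N g \<in> carrier_mat (hdim N) (hdim N)"
      using assms by (auto simp: wf_act_def)
    have "opm (?F * act M g) = F * ac M g" "opm (act N g * ?F) = ac N g * F"
      using M by (subst opm_mult; simp only: o ac_def mt_carrier carrier_matD)+
    then have "opm (?F * act M g) = opm (act N g * ?F)" by (simp only: homD(3)[OF assms(3)])
    moreover have "?F * act M g \<in> carrier_mat (hdim N) (hdim M)" "act N g * ?F \<in> carrier_mat (hdim N) (hdim M)"
      using M mult_carrier_mat[OF mt_carrier(1) M(1)] mult_carrier_mat[OF M(2) mt_carrier(1)] by blast+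
    ultimately show ?thesis using opm_inj by blast
  qed
  then show "?F \<in> mod_hom M N" by (simp add: mod_hom_def)
qed

lemma is_module_wf: "is_module n q M \<Longrightarrow> wf_act M"
  unfolding is_module_def wf_act_def all_generator Let_def by blast

lemma mod_iso_iff:
  "mod_iso n q M N \<longleftrightarrow> is_module n q M \<and> is_module n q N \<and>
     (\<exists>F \<in> hom M N. \<exists>G \<in> hom N M. G * F = E (hdim M) \<and> F * G = E (hdim N))"
proof (cases "is_module n q M \<and> is_module n q N")
  case True
  then have w: "wf_act M" "wf_act N" by (auto intro: is_module_wf)
  show ?thesis
  proof
    assume "mod_iso n q M N"
    then obtain F G where FG: "F \<in> mod_hom M N" "G \<in> mod_hom N M"
      "G * F = 1\<^sub>m (hdim M)" "F * G = 1\<^sub>m (hdim N)"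
      unfolding mod_iso_def by blast
    have "F \<in> carrier_mat (hdim N) (hdim M)" "G \<in> carrier_mat (hdim M) (hdim N)"
      using FG by (auto simp: mod_hom_def)
    then have "opm G * opm F = E (hdim M)" "opm F * opm G = E (hdim N)"
      using FG(3,4) opm_mult[of G F] opm_mult[of F G] by auto
    then show "is_module n q M \<and> is_module n q N \<and>
       (\<exists>F \<in> hom M N. \<exists>G \<in> hom N M. G * F = E (hdim M) \<and> F * G = E (hdim N))"
      using True hom_opm[OF w FG(1)] hom_opm[OF w(2) w(1) FG(2)] by blast
  next
    assume "is_module n q M \<and> is_module n q N \<and>
       (\<exists>F \<in> hom M N. \<exists>G \<in> hom N M. G * F = E (hdim M) \<and> F * G = E (hdim N))"
    then obtain F G where FG: "F \<in> hom M N" "G \<in> hom N M"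
      "G * F = E (hdim M)" "F * G = E (hdim N)" by blast
    let ?F = "mt (hdim N) (hdim M) F" and ?G = "mt (hdim M) (hdim N) G"
    note f = mod_hom_mt[OF w FG(1)] and g = mod_hom_mt[OF w(2) w(1) FG(2)]
    have "opm (?G * ?F) = opm (1\<^sub>m (hdim M))" "opm (?F * ?G) = opm (1\<^sub>m (hdim N))"
      by (subst opm_mult; simp only: f g FG mt_carrier opm_one)+
    then have "?G * ?F = 1\<^sub>m (hdim M)" "?F * ?G = 1\<^sub>m (hdim N)"
      using opm_inj[OF mult_carrier_mat[OF mt_carrier(1) mt_carrier(1)] one_carrier_mat] by blast+
    then show "mod_iso n q M N" unfolding mod_iso_def using True f(1) g(1) by blast
  qed
next
  case False
  then show ?thesis unfolding mod_iso_def by blast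
qed

lemma mod_iso_refl: "is_module n q M \<Longrightarrow> mod_iso n q M M"
  unfolding mod_iso_iff using hom_id[OF is_module_wf[of n q M]] E_idem by blast

lemma mod_iso_sym: "mod_iso n q M N \<Longrightarrow> mod_iso n q N M"
  unfolding mod_iso_iff by blast

lemma mod_iso_trans:
  assumes "mod_iso n q M N" "mod_iso n q N L"
  shows "mod_iso n q M L"
proof -
  from assms obtain F G F' G' where *: "F \<in> hom M N" "G \<in> hom N M"
    "G * F = E (hdim M)" "F * G = E (hdim N)" "F' \<in> hom N L" "G' \<in> hom L N"
    "G' * F' = E (hdim N)" "F' * G' = E (hdim L)" unfolding mod_iso_iff by blast
  have "(G * G') * (F' * F) = E (hdim M)"
    using *(3,7) homD(1)[OF *(1)] by (metis mult.assoc)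
  moreover have "(F' * F) * (G * G') = E (hdim L)"
    using *(4,8) homD(1)[OF *(6)] by (metis mult.assoc)
  ultimately show ?thesis
    using assms hom_comp[OF *(1) *(5)] hom_comp[OF *(6) *(2)] unfolding mod_iso_iff by blast
qed

subsection \<open>Epimorphisms, monomorphisms and exact sequences\<close>

text \<open>Surjectivity as a linear section, which need neither be a homomorphism nor be confined
  to the coordinates of a module. A condition on ranges becomes an equation.\<close>

definition epi :: "nat \<Rightarrow> 'k::field lop \<Rightarrow> bool" where
  "epi N F \<longleftrightarrow> (\<exists>S. F * S = E N)"

text \<open>Solving a matrix equation column by column is how the conditions on
  \<open>mat_range\<close> and \<open>mat_kernel\<close> become equations between operators.\<close>

lemma columns_lift:
  fixes F :: "'k::field mat"
  assumes F: "F \<in> carrier_mat N M" and L: "L \<in> carrier_mat N K"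
    and "\<And>j. j < K \<Longrightarrow> col L j \<in> mat_range F"
  shows "\<exists>S \<in> carrier_mat M K. F * S = L"
proof -
  have "\<forall>j. \<exists>v. j < K \<longrightarrow> v \<in> carrier_vec M \<and> F *\<^sub>v v = col L j"
    using assms by (force simp: mat_range_def)
  then obtain v where v: "\<And>j. j < K \<Longrightarrow> v j \<in> carrier_vec M" "\<And>j. j < K \<Longrightarrow> F *\<^sub>v v j = col L j"
    by metis
  define S where "S = mat M K (\<lambda>(i, j). v j $ i)"
  have S: "S \<in> carrier_mat M K" by (simp add: S_def)
  have c: "col S j = v j" if "j < K" for j
    using v(1)[OF that] that by (intro eq_vecI) (auto simp: S_def)
  have "F * S = L"
  proof (rule eq_matI)
    fix i j assume ij: "i < dim_row L" "j < dim_col L"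
    then have "(F * S) $$ (i, j) = row F i \<bullet> v j" using F L S c by simp
    also have "\<dots> = (F *\<^sub>v v j) $ i" using ij F L by simp
    also have "\<dots> = L $$ (i, j)" using v(2)[of j] ij L by simp
    finally show "(F * S) $$ (i, j) = L $$ (i, j)" .
  qed (use F S L in auto)
  with S show ?thesis by blast
qed

lemma mod_epi_section:
  assumes "mod_epi M N F"
  shows "epi (hdim N) (opm F)"
proof -
  have F: "F \<in> carrier_mat (hdim N) (hdim M)" "mat_range F = carrier_vec (hdim N)"
    using assms by (auto simp: mod_epi_def mod_hom_def)
  obtain S where S: "S \<in> carrier_mat (hdim M) (hdim N)" "F * S = 1\<^sub>m (hdim N)"
    using columns_lift[OF F(1) one_carrier_mat[of "hdim N"]] F(2) by auto
  have "opm F * opm S = opm (F * S)" using S F(1) by (subst opm_mult) auto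
  then show ?thesis unfolding epi_def S(2) opm_one by blast
qed

lemma section_mod_epi:
  assumes "wf_act M" "wf_act N" "F \<in> hom M N" "epi (hdim N) F"
  shows "mod_epi M N (mt (hdim N) (hdim M) F)"
proof -
  let ?F = "mt (hdim N) (hdim M) F"
  note f = mod_hom_mt[OF assms(1-3)]
  obtain S where S: "F * S = E (hdim N)" using assms(4) by (auto simp: epi_def)
  let ?S = "mt (hdim M) (hdim N) S"
  have "F * (E (hdim M) * S * E (hdim N)) = F * E (hdim M) * S * E (hdim N)" by (simp only: mult.assoc)
  also have "\<dots> = E (hdim N)" by (simp only: homD(2)[OF assms(3)] S E_idem)
  finally have "opm (?F * ?S) = opm (1\<^sub>m (hdim N))"
    by (subst opm_mult) (simp_all only: f(2) mt_carrier opm_one opm_mt[of "hdim M" "hdim N" S])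
  then have FS: "?F * ?S = 1\<^sub>m (hdim N)"
    using opm_inj[OF mult_carrier_mat[OF mt_carrier(1) mt_carrier(1)] one_carrier_mat] by blast
  have "w \<in> mat_range ?F" if "w \<in> carrier_vec (hdim N)" for w
  proof -
    have "?F *\<^sub>v (?S *\<^sub>v w) = (?F * ?S) *\<^sub>v w"
      using that by (intro assoc_mult_mat_vec[symmetric]) auto
    then have "w = ?F *\<^sub>v (?S *\<^sub>v w)" unfolding FS using that by simp
    moreover have "?S *\<^sub>v w \<in> carrier_vec (hdim M)" using that by (intro mult_mat_vec_carrier) auto
    ultimately show ?thesis unfolding mat_range_def by auto
  qed
  moreover have "mat_range ?F \<subseteq> carrier_vec (hdim N)"
    unfolding mat_range_def by (auto intro!: mult_mat_vec_carrier)
  ultimately show ?thesis unfolding mod_epi_def using f(1) by blast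
qed

definition projm :: "nat \<Rightarrow> 'k::field \<Rightarrow> 'k hmodule \<Rightarrow> bool" where
  "projm n q P \<longleftrightarrow> is_module n q P \<and> (\<forall>X Y F H. is_module n q X \<longrightarrow> is_module n q Y \<longrightarrow>
     F \<in> hom X Y \<longrightarrow> epi (hdim Y) F \<longrightarrow> H \<in> hom P Y \<longrightarrow> (\<exists>K \<in> hom P X. F * K = H))"

definition cover :: "nat \<Rightarrow> 'k::field \<Rightarrow> 'k hmodule \<Rightarrow> 'k hmodule \<Rightarrow> 'k lop \<Rightarrow> bool" where
  "cover n q P V \<pi> \<longleftrightarrow> projm n q P \<and> is_module n q V \<and> \<pi> \<in> hom P V \<and> epi (hdim V) \<pi> \<and>
     (\<forall>X G. is_module n q X \<longrightarrow> G \<in> hom X P \<longrightarrow> epi (hdim V) (\<pi> * G) \<longrightarrow> epi (hdim P) G)"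

lemma projective_projm:
  assumes "projective n q P"
  shows "projm n q P"
  unfolding projm_def
proof (intro conjI allI impI)
  show P: "is_module n q P" using assms by (simp add: projective_def)
  fix X Y F H assume *: "is_module n q X" "is_module n q Y" "F \<in> hom X Y" "epi (hdim Y) F" "H \<in> hom P Y"
  note w = P[THEN is_module_wf] *(1,2)[THEN is_module_wf]
  let ?F = "mt (hdim Y) (hdim X) F" and ?H = "mt (hdim Y) (hdim P) H"
  obtain K where K: "K \<in> mod_hom P X" "?F * K = ?H"
    using assms *(1,2) section_mod_epi[OF w(2,3) *(3,4)] mod_hom_mt(1)[OF w(1,3) *(5)]
    unfolding projective_def by blast
  have "opm (?F * K) = F * opm K"
    using K(1) by (subst opm_mult) (auto simp: mod_hom_mt(2)[OF w(2,3) *(3)] mod_hom_def simp del: opm_mt)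
  then have "F * opm K = H" using K(2) mod_hom_mt(2)[OF w(1,3) *(5)] by simp
  then show "\<exists>K \<in> hom P X. F * K = H" using hom_opm[OF w(1,2) K(1)] by blast
qed

lemma projective_cover_cover:
  assumes "projective_cover n q P V" "is_module n q V"
  shows "\<exists>\<pi>. cover n q P V \<pi>"
proof -
  have P: "projm n q P" using assms by (simp add: projective_cover_def projective_projm)
  then have "is_module n q P" by (simp add: projm_def)
  note w = this[THEN is_module_wf] assms(2)[THEN is_module_wf]
  obtain F where F: "mod_epi P V F"
    "\<And>X G. is_module n q X \<Longrightarrow> G \<in> mod_hom X P \<Longrightarrow> mod_epi X V (F * G) \<Longrightarrow> mod_epi X P G"
    using assms(1) unfolding projective_cover_def by blast
  have F1: "F \<in> mod_hom P V" "F \<in> carrier_mat (hdim V) (hdim P)"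
    using F(1) by (auto simp: mod_epi_def mod_hom_def)
  have "epi (hdim P) G" if *: "is_module n q X" "G \<in> hom X P" "epi (hdim V) (opm F * G)" for X G
  proof -
    have wX: "wf_act X" using * by (simp add: is_module_wf)
    let ?G = "mt (hdim P) (hdim X) G"
    note g = mod_hom_mt[OF wX w(1) *(2)]
    have "opm F * G \<in> hom X V" using hom_comp[OF *(2) hom_opm[OF w F1(1)]] .
    from section_mod_epi[OF wX w(2) this *(3)]
    have e: "mod_epi X V (mt (hdim V) (hdim X) (opm F * G))" .
    have "opm (F * ?G) = opm F * G" using F1(2) by (subst opm_mult) (simp_all add: g(2) del: opm_mt)
    moreover have "F * ?G \<in> carrier_mat (hdim V) (hdim X)" using F1(2) by (rule mult_carrier_mat) simp
    ultimately have "mt (hdim V) (hdim X) (opm F * G) = F * ?G" using mt_opm by metis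
    with e have "mod_epi X P ?G" using F(2)[OF *(1) g(1)] by simp
    from mod_epi_section[OF this] show ?thesis unfolding g(2) .
  qed
  then have "cover n q P V (opm F)"
    unfolding cover_def using P assms(2) hom_opm[OF w F1(1)] mod_epi_section[OF F(1)] by blast
  then show ?thesis by blast
qed

text \<open>Exactness is witnessed by a linear splitting \<open>R\<close>, \<open>S\<close>, in
  general not by homomorphisms. Being equational, it survives tensoring with a fixed module; G F = 0
  follows from the three identities.\<close>

definition ses :: "'k::field hmodule \<Rightarrow> 'k hmodule \<Rightarrow> 'k hmodule \<Rightarrow> bool" where
  "ses A B C \<longleftrightarrow> (\<exists>F \<in> hom A B. \<exists>G \<in> hom B C. \<exists>R S. R * F = E (hdim A) \<and> G * S = E (hdim C) \<and>
     F * R + S * G = E (hdim B) \<and> E (hdim A) * R * E (hdim B) = R \<and> E (hdim B) * S * E (hdim C) = S)"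

text \<open>\<open>S\<close> lifts the columns of the identity along \<open>G\<close>. The columns
  of 1 - S G then lie in the kernel of \<open>G\<close>, which is the range of \<open>F\<close>, and
  lifting them along \<open>F\<close> gives \<open>R\<close>. Finally F (R F - 1) = 0 and
  \<open>F\<close> is injective.\<close>

lemma almost_split_ses:
  fixes A B C :: "'k::field hmodule"
  assumes "almost_split_sequence n q A B C"
  shows "is_module n q A" "is_module n q B" "is_module n q C" "ses A B C"
proof -
  show m: "is_module n q A" "is_module n q B" "is_module n q C"
    using assms by (auto simp: almost_split_sequence_def)
  obtain F G where FG: "mod_mono A B F" "mod_epi B C G" "mat_range F = mat_kernel G"
    using assms unfolding almost_split_sequence_def by blast
  note w = m[THEN is_module_wf]
  have F: "F \<in> mod_hom A B" "F \<in> carrier_mat (hdim B) (hdim A)" "mat_kernel F = {0\<^sub>v (hdim A)}"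
    using FG(1) by (auto simp: mod_mono_def mod_hom_def)
  have G: "G \<in> mod_hom B C" "G \<in> carrier_mat (hdim C) (hdim B)" "mat_range G = carrier_vec (hdim C)"
    using FG(2) by (auto simp: mod_epi_def mod_hom_def)
  obtain S where S: "S \<in> carrier_mat (hdim B) (hdim C)" "G * S = 1\<^sub>m (hdim C)"
    using columns_lift[OF G(2) one_carrier_mat[of "hdim C"]] G(3) by auto
  have SG: "S * G \<in> carrier_mat (hdim B) (hdim B)" using S(1) G(2) by (rule mult_carrier_mat)
  define D where "D = 1\<^sub>m (hdim B) - S * G"
  have D: "D \<in> carrier_mat (hdim B) (hdim B)" unfolding D_def using SG by (rule minus_carrier_mat)
  have oD: "opm D = E (hdim B) - opm S * opm G"
    unfolding D_def using SG S(1) G(2) by (subst opm_minus) (auto simp: opm_mult)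
  have oGS: "opm G * opm S = E (hdim C)"
  proof -
    have "opm G * opm S = opm (G * S)" using S(1) G(2) by (subst opm_mult) auto
    then show ?thesis using S(2) by simp
  qed
  have GE: "opm G * E (hdim B) = opm G" "E (hdim C) * opm G = opm G" using G(2) opm_E E_opm by blast+
  have "opm (G * D) = opm G * opm D" using G(2) D by (intro opm_mult) auto
  also have "\<dots> = opm G * E (hdim B) - opm G * opm S * opm G" unfolding oD by (simp add: algebra_simps)
  also have "\<dots> = opm (0\<^sub>m (hdim C) (hdim B))" unfolding oGS GE by simp
  finally have GD: "G * D = 0\<^sub>m (hdim C) (hdim B)"
    using opm_inj[OF mult_carrier_mat[OF G(2) D] zero_carrier_mat] by blast
  have "col D j \<in> mat_range F" if "j < hdim B" for j
  proof -
    have "G *\<^sub>v col D j = col (G * D) j" using G(2) D that by (intro col_mult2[symmetric]) auto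
    also have "\<dots> = 0\<^sub>v (hdim C)" unfolding GD using that by simp
    finally have "G *\<^sub>v col D j = 0\<^sub>v (hdim C)" .
    then show ?thesis unfolding FG(3) mat_kernel_def using G(2) D that by auto
  qed
  from columns_lift[OF F(2) D this] obtain R where R: "R \<in> carrier_mat (hdim A) (hdim B)" "F * R = D" by blast
  have oFR: "opm F * opm R = E (hdim B) - opm S * opm G"
  proof -
    have "opm F * opm R = opm (F * R)" using F(2) R(1) by (subst opm_mult) auto
    then show ?thesis by (simp add: R(2) oD)
  qed
  have FE: "opm F * E (hdim A) = opm F" "E (hdim B) * opm F = opm F" using F(2) opm_E E_opm by blast+
  have GF: "opm G * opm F = 0"
  proof -
    have "col (G * F) j = 0\<^sub>v (hdim C)" if "j < hdim A" for j
    proof -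
      have "col (G * F) j = G *\<^sub>v col F j" using G(2) F(2) that by (intro col_mult2) auto
      moreover have "col F j = F *\<^sub>v unit_vec (hdim A) j"
        using F(2) that by (metis col_mult2 col_one one_carrier_mat right_mult_one_mat)
      then have "col F j \<in> mat_range F" using F(2) by (auto simp: mat_range_def)
      then have "G *\<^sub>v col F j = 0\<^sub>v (hdim C)" unfolding FG(3) mat_kernel_def using G(2) by auto
      ultimately show ?thesis by simp
    qed
    then have "(G * F) $$ (i, j) = 0" if "i < hdim C" "j < hdim A" for i j
    proof -
      have "(G * F) $$ (i, j) = col (G * F) j $ i" using that G(2) F(2) by simp
      then show ?thesis using \<open>\<And>j. j < hdim A \<Longrightarrow> col (G * F) j = 0\<^sub>v (hdim C)\<close> that by simp
    qed
    then have "G * F = 0\<^sub>m (hdim C) (hdim A)" using G(2) F(2) by (intro eq_matI) auto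
    then show ?thesis using opm_mult[of G F] G(2) F(2) by simp
  qed
  have RF: "opm R * opm F = E (hdim A)"
  proof -
    have rf: "R * F \<in> carrier_mat (hdim A) (hdim A)" using R(1) F(2) by (rule mult_carrier_mat)
    define K where "K = R * F - 1\<^sub>m (hdim A)"
    have K: "K \<in> carrier_mat (hdim A) (hdim A)" unfolding K_def by (rule minus_carrier_mat) simp
    have oK: "opm K = opm R * opm F - E (hdim A)"
      unfolding K_def using rf R(1) F(2) by (subst opm_minus) (auto simp: opm_mult)
    have "opm (F * K) = opm F * opm K" using F(2) K by (intro opm_mult) auto
    also have "\<dots> = (opm F * opm R) * opm F - opm F" unfolding oK by (simp add: algebra_simps FE)
    also have "\<dots> = E (hdim B) * opm F - opm S * (opm G * opm F) - opm F"
      unfolding oFR by (simp add: algebra_simps)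
    also have "\<dots> = opm (0\<^sub>m (hdim B) (hdim A))" unfolding GF FE by simp
    finally have FK: "F * K = 0\<^sub>m (hdim B) (hdim A)"
      using opm_inj[OF mult_carrier_mat[OF F(2) K] zero_carrier_mat] by blast
    have "col K j = 0\<^sub>v (hdim A)" if "j < hdim A" for j
    proof -
      have "F *\<^sub>v col K j = col (F * K) j" using F(2) K that by (intro col_mult2[symmetric]) auto
      also have "\<dots> = 0\<^sub>v (hdim B)" unfolding FK using that by simp
      finally have "col K j \<in> mat_kernel F" unfolding mat_kernel_def using F(2) K that by auto
      then show ?thesis using F(3) by simp
    qed
    then have "K $$ (i, j) = 0" if "i < hdim A" "j < hdim A" for i j
    proof -
      have "K $$ (i, j) = col K j $ i" using that K by simp
      then show ?thesis using \<open>\<And>j. j < hdim A \<Longrightarrow> col K j = 0\<^sub>v (hdim A)\<close> that by simp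
    qed
    then have "K = 0\<^sub>m (hdim A) (hdim A)" using K by (intro eq_matI) auto
    then have "opm K = 0" by simp
    then show ?thesis unfolding oK by simp
  qed
  have "E (hdim A) * opm R = opm R" "opm R * E (hdim B) = opm R"
    "E (hdim B) * opm S = opm S" "opm S * E (hdim C) = opm S"
    using R(1) S(1) opm_E E_opm by blast+
  moreover have "opm F * opm R + opm S * opm G = E (hdim B)" unfolding oFR by simp
  ultimately show "ses A B C"
    unfolding ses_def using hom_opm[OF w(1,2) F(1)] hom_opm[OF w(2,3) G(1)] RF oGS by metis
qed

section \<open>Direct sums\<close>

text \<open>Injection and projection for a block placed behind the first N coordinates; cutting to
  the size of that block is left to factors \<open>E\<close>.\<close>

lift_definition sh :: "nat \<Rightarrow> 'k::field lop" is "\<lambda>N v k. if N \<le> k then v (k - N) else 0"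
  by (auto simp: fun_eq_iff)

lift_definition sht :: "nat \<Rightarrow> 'k::field lop" is "\<lambda>N v k. v (k + N)"
  by (auto simp: fun_eq_iff)

lemma app_sh: "app (sh N) v k = (if N \<le> k then v (k - N) else 0)" "app (sht N) v k = v (k + N)"
  by (simp_all only: sh.rep_eq sht.rep_eq)

lemma sh_simps: "sht N * sh N = 1" "E N * sh N = 0" "sht N * E N = 0"
  "sht N * E (N + M) = E M * sht N" "E (N + M) * sh N = sh N * E M" "sh N * sht N = 1 - E N"
  by (auto intro!: lop_eqI simp: app_simps app_sh)

lemma entry_sh: "entry (sh N * F * sht N) i j = (if N \<le> i \<and> N \<le> j then entry F (i - N) (j - N) else 0)"
proof (cases "N \<le> j")
  case True
  then have "app (sht N) (\<lambda>k. if k = j then 1 else 0) = (\<lambda>k. if k = j - N then 1 else (0::'a))"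
    by (auto simp: app_sh fun_eq_iff)
  with True show ?thesis by (simp add: entry_def app_simps app_sh)
next
  case False
  then have "app (sht N) (\<lambda>k. if k = j then 1 else 0) = (\<lambda>i. 0 * (0::'a))"
    by (auto simp: app_sh fun_eq_iff)
  with False show ?thesis by (simp only: entry_def app_simps app_sh app_linear) auto
qed

lemma lop_entryI:
  assumes "E N * F * E M = F" "E N * G * E M = G" "\<And>i j. i < N \<Longrightarrow> j < M \<Longrightarrow> entry F i j = entry G i j"
  shows "F = G"
proof -
  have "E N * F * E M = E N * G * E M"
    unfolding sandwich_expand using assms(3) by (intro sum.cong refl) simp
  then show ?thesis using assms by simp
qed

lemma opm_block:
  assumes "A \<in> carrier_mat N N" "B \<in> carrier_mat M M"
  shows "opm (four_block_mat A (0\<^sub>m N M) (0\<^sub>m M N) B) = opm A + sh N * opm B * sht N"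
proof (rule lop_entryI)
  let ?C = "four_block_mat A (0\<^sub>m N M) (0\<^sub>m M N) B"
  have C: "?C \<in> carrier_mat (N + M) (N + M)" using assms by auto
  show "E (N + M) * opm ?C * E (N + M) = opm ?C" by (simp only: E_opm[OF C] opm_E[OF C])
  have A: "E (N + M) * opm A = opm A" "opm A * E (N + M) = opm A"
    using E_opm[OF assms(1)] opm_E[OF assms(1)] by (metis E_mult mult.assoc min_def le_add1 min.commute)+
  have "E (N + M) * (sh N * opm B * sht N) * E (N + M) = sh N * (E M * opm B * E M) * sht N"
    by (simp only: mult.assoc sh_simps(4) assoc_ext[OF sh_simps(5)])
  also have "\<dots> = sh N * opm B * sht N" by (simp only: E_opm[OF assms(2)] opm_E[OF assms(2)])
  finally have B: "E (N + M) * (sh N * opm B * sht N) * E (N + M) = sh N * opm B * sht N" .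
  show "E (N + M) * (opm A + sh N * opm B * sht N) * E (N + M) = opm A + sh N * opm B * sht N"
    by (simp only: distrib_left distrib_right A B)
  fix i j assume "i < N + M" "j < N + M"
  then show "entry (opm ?C) i j = entry (opm A + sh N * opm B * sht N) i j"
    using assms by (auto simp: entry_simps entry_sh entry_opm)
qed

definition biprod ::
  "'k::field hmodule \<Rightarrow> 'k hmodule \<Rightarrow> 'k hmodule \<Rightarrow> 'k lop \<Rightarrow> 'k lop \<Rightarrow> 'k lop \<Rightarrow> 'k lop \<Rightarrow> bool" where
  "biprod T A B p1 q1 p2 q2 \<longleftrightarrow> p1 \<in> hom A T \<and> q1 \<in> hom T A \<and> p2 \<in> hom B T \<and> q2 \<in> hom T B \<and>
     q1 * p1 = E (hdim A) \<and> q2 * p2 = E (hdim B) \<and> q1 * p2 = 0 \<and> q2 * p1 = 0 \<and>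
     p1 * q1 + p2 * q2 = E (hdim T)"

lemma biprod_eqI:
  assumes "biprod T A B p1 q1 p2 q2" "E (hdim T) * x = x" "E (hdim T) * y = y" "q1 * x = q1 * y" "q2 * x = q2 * y"
  shows "x = y"
proof -
  have "E (hdim T) * z = p1 * (q1 * z) + p2 * (q2 * z)" for z
    using assms(1) by (simp add: biprod_def mult.assoc[symmetric] distrib_right[symmetric])
  from this[of x] this[of y] show ?thesis unfolding assms(2-5) by simp
qed

lemma hom_pow: "F \<in> hom M N \<Longrightarrow> F * ac M g ^ k = ac N g ^ k * F"
proof (induction k)
  case (Suc k)
  have "F * ac M g ^ Suc k = (F * ac M g) * ac M g ^ k" by (simp add: mult.assoc)
  also have "\<dots> = ac N g * (F * ac M g ^ k)" by (simp only: homD(3)[OF Suc.prems] mult.assoc)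
  also have "\<dots> = ac N g ^ Suc k * F" by (simp only: Suc power_Suc mult.assoc)
  finally show ?case .
qed simp

text \<open>The relations of \<open>A\<close>, pulled back along \<open>q1\<close>. On a direct sum
  the two projections are jointly injective (\<open>biprod_eqI\<close>), so the relations of both
  summands together give those of \<open>T\<close>.\<close>

lemma hom_ops:
  assumes "q1 \<in> hom T A" "n > 0" "wf_act T" "is_module n q A"
  shows "q1 * (ac T GB * ac T GA) = q1 * (q *o (ac T GA * ac T GB))"
    "q1 * (ac T GD * ac T GB) = q1 * (q *o (ac T GB * ac T GD))"
    "q1 * (ac T GC * ac T GA) = q1 * (q *o (ac T GA * ac T GC))"
    "q1 * (ac T GD * ac T GC) = q1 * (q *o (ac T GC * ac T GD))"
    "q1 * (ac T GB * ac T GC) = q1 * (ac T GC * ac T GB)"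
    "q1 * ac T GA ^ n = 0" "q1 * ac T GD ^ n = 0"
    "q1 * ac T GB ^ n = q1" "q1 * ac T GC ^ n = q1"
    "q1 * (ac T GD * ac T GA - q *o (ac T GA * ac T GD)) = q1 * (E (hdim T) - ac T GB * ac T GC)"
proof -
  have r: "ops_module n q (hdim A) (ac A GA) (ac A GB) (ac A GC) (ac A GD)"
    using is_module_iff[OF assms(2)] assms(4) by blast
  have h: "q1 * (ac T g * x) = ac A g * (q1 * x)" for g x
    using homD(3)[OF assms(1)] by (simp add: mult.assoc[symmetric])
  have h2: "q1 * (ac T g * ac T g') = ac A g * ac A g' * q1" for g g'
    unfolding h homD(3)[OF assms(1)] by (simp add: mult.assoc)
  show "q1 * (ac T GB * ac T GA) = q1 * (q *o (ac T GA * ac T GB))"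
    "q1 * (ac T GD * ac T GB) = q1 * (q *o (ac T GB * ac T GD))"
    "q1 * (ac T GC * ac T GA) = q1 * (q *o (ac T GA * ac T GC))"
    "q1 * (ac T GD * ac T GC) = q1 * (q *o (ac T GC * ac T GD))"
    "q1 * (ac T GB * ac T GC) = q1 * (ac T GC * ac T GB)"
    using r unfolding scl_mult_right h2 ops_module_def by simp_all
  show "q1 * ac T GA ^ n = 0" "q1 * ac T GD ^ n = 0" "q1 * ac T GB ^ n = q1" "q1 * ac T GC ^ n = q1"
    using r unfolding hom_pow[OF assms(1)] ops_module_def by (simp_all add: homD(1)[OF assms(1)])
  have "q1 * (ac T GD * ac T GA - q *o (ac T GA * ac T GD)) =
      (ac A GD * ac A GA - q *o (ac A GA * ac A GD)) * q1"
    unfolding right_diff_distrib left_diff_distrib scl_mult_right scl_mult_left h2 ..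
  also have "\<dots> = (E (hdim A) - ac A GB * ac A GC) * q1" using r unfolding ops_module_def by simp
  also have "\<dots> = q1 * (E (hdim T) - ac T GB * ac T GC)"
    unfolding right_diff_distrib left_diff_distrib h2 homD(1,2)[OF assms(1)] ..
  finally show "q1 * (ac T GD * ac T GA - q *o (ac T GA * ac T GD)) = q1 * (E (hdim T) - ac T GB * ac T GC)" .
qed

lemma biprod_module:
  assumes "n > 0" "wf_act T" "biprod T A B p1 q1 p2 q2" "is_module n q A" "is_module n q B"
  shows "is_module n q T"
proof -
  have q: "q1 \<in> hom T A" "q2 \<in> hom T B" using assms(3) by (auto simp: biprod_def)
  note h1 = hom_ops[OF q(1) assms(1,2,4)] and h2 = hom_ops[OF q(2) assms(1,2,5)]
  have e: "E (hdim T) * (ac T g * x) = ac T g * x" for g x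
    using assoc_ext[OF ac_E(1)[OF assms(2)]] .
  have ep: "E (hdim T) * ac T g ^ n = ac T g ^ n" for g
    using e[of g "ac T g ^ (n - 1)"] assms(1) by (metis power_minus_mult power_commutes)
  note eq = biprod_eqI[OF assms(3)]
  have "ac T GD * ac T GA - q *o (ac T GA * ac T GD) = E (hdim T) - ac T GB * ac T GC"
    by (rule eq[OF _ _ h1(10) h2(10)]) (simp_all only: right_diff_distrib scl_mult_right e E_idem)
  note L = this
  have "ops_module n q (hdim T) (ac T GA) (ac T GB) (ac T GC) (ac T GD)"
    unfolding ops_module_def
    by (intro conjI; (rule L | rule eq))
      (simp_all only: h1 h2 e ep scl_mult_right E_idem homD(2)[OF q(1)] homD(2)[OF q(2)] mult_zero_right)
  then show ?thesis using is_module_iff[OF assms(1)] assms(2) by blast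
qed

lemma hdim_module_sum: "hdim (module_sum Ms) = sum_list (map hdim Ms)"
  and act_module_sum: "act (module_sum Ms) g = diag_block_mat (map (\<lambda>M. act M g) Ms)"
  by (simp_all add: module_sum_def)

lemma wf_module_sum: "(\<And>M. M \<in> set Ms \<Longrightarrow> wf_act M) \<Longrightarrow> wf_act (module_sum Ms)"
proof (induction Ms)
  case Nil
  then show ?case by (simp add: wf_act_def act_module_sum hdim_module_sum)
next
  case (Cons M Ms)
  then have "wf_act M" "wf_act (module_sum Ms)" by auto
  then show ?case by (auto simp: wf_act_def act_module_sum Let_def hdim_module_sum)
qed

lemma ac_module_sum_Cons:
  assumes "wf_act M" "wf_act (module_sum Ms)"
  shows "ac (module_sum (M # Ms)) g =
    ac M g + sh (hdim M) * ac (module_sum Ms) g * sht (hdim M)"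
proof -
  have C: "act M g \<in> carrier_mat (hdim M) (hdim M)"
    "act (module_sum Ms) g \<in> carrier_mat (hdim (module_sum Ms)) (hdim (module_sum Ms))"
    using assms by (auto simp: wf_act_def)
  have "act (module_sum (M # Ms)) g = four_block_mat (act M g) (0\<^sub>m (hdim M) (hdim (module_sum Ms)))
     (0\<^sub>m (hdim (module_sum Ms)) (hdim M)) (act (module_sum Ms) g)"
    using carrier_matD[OF C(1)] carrier_matD[OF C(2)]
    by (simp add: act_module_sum Let_def)
  then show ?thesis unfolding ac_def using opm_block[OF C] by simp
qed

lemma biprod_module_sum:
  assumes "wf_act M" "wf_act (module_sum Ms)"
  shows "biprod (module_sum (M # Ms)) M (module_sum Ms) (E (hdim M)) (E (hdim M))
    (sh (hdim M) * E (hdim (module_sum Ms))) (E (hdim (module_sum Ms)) * sht (hdim M))"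
proof -
  define N where "N = hdim M"
  define K where "K = hdim (module_sum Ms)"
  define S where "S = module_sum (M # Ms)"
  have S: "hdim S = N + K" by (simp add: S_def N_def K_def hdim_module_sum)
  have a: "ac S g = ac M g + sh N * ac (module_sum Ms) g * sht N" for g
    unfolding S_def N_def by (rule ac_module_sum_Cons[OF assms])
  have M: "E N * ac M g = ac M g" "ac M g * E N = ac M g" for g
    unfolding N_def using ac_E[OF assms(1)] by simp_all
  have R: "E K * ac (module_sum Ms) g = ac (module_sum Ms) g" "ac (module_sum Ms) g * E K = ac (module_sum Ms) g" for g
    unfolding K_def using ac_E[OF assms(2)] by simp_all
  have MN: "sht N * ac M g = 0" "ac M g * sh N = 0" for g
    using M sh_simps by (metis mult.assoc mult_zero_left mult_zero_right)+
  note s = sh_simps[of N] sh_simps(4,5)[of N K]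
  note sx = s[THEN assoc_ext] M[THEN assoc_ext] R[THEN assoc_ext] MN[THEN assoc_ext]
  have E1: "E (N + K) * E N = E N" "E N * E (N + K) = E N" by (simp_all add: E_mult)
  have "E N \<in> hom M S"
    by (rule homI) (simp_all add: S a N_def[symmetric] distrib_left distrib_right mult.assoc M s sx E1 MN)
  moreover have "E N \<in> hom S M"
    by (rule homI) (simp_all add: S a N_def[symmetric] distrib_left distrib_right mult.assoc M s sx E1 MN)
  moreover have "sh N * E K \<in> hom (module_sum Ms) S"
    by (rule homI) (simp_all add: S a K_def[symmetric] distrib_left distrib_right mult.assoc M R MN s(1-5) sx E1 assoc_ext[OF E_idem])
  moreover have "E K * sht N \<in> hom S (module_sum Ms)"
    by (rule homI) (simp_all add: S a K_def[symmetric] distrib_left distrib_right mult.assoc M R MN s(1-5) sx E1 assoc_ext[OF E_idem])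
  moreover have "E K * sht N * (sh N * E K) = E K" by (simp add: mult.assoc s sx)
  moreover have "E N * (sh N * E K) = 0" "E K * sht N * E N = 0" by (simp_all add: mult.assoc s sx)
  moreover have "E N + sh N * E K * (E K * sht N) = E (N + K)"
  proof -
    have "sh N * E K * (E K * sht N) = sh N * (sht N * E (N + K))"
      by (simp add: mult.assoc s assoc_ext[OF E_idem])
    also have "\<dots> = (sh N * sht N) * E (N + K)" by (simp only: mult.assoc)
    also have "\<dots> = (1 - E N) * E (N + K)" by (simp only: s(6))
    finally have "sh N * E K * (E K * sht N) = (1 - E N) * E (N + K)" .
    then show ?thesis unfolding left_diff_distrib E1 mult_1_left eq_diff_eq by (simp only: add.commute)
  qed
  ultimately show ?thesis unfolding biprod_def S_def[symmetric] N_def[symmetric] K_def[symmetric] S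
    by (simp only: E_idem simp_thms)
qed

lemma zero_module: "n > 0 \<Longrightarrow> wf_act M \<Longrightarrow> hdim M = 0 \<Longrightarrow> is_module n q M"
proof -
  assume a: "n > 0" "wf_act M" "hdim M = 0"
  then have "ac M g = 0" for g using ac_E(1)[OF a(2), of g] by simp
  then show ?thesis using is_module_iff[OF a(1), of q M] a by (simp add: ops_module_def zero_power)
qed

lemma is_module_sum:
  assumes "n > 0" "\<And>M. M \<in> set Ms \<Longrightarrow> is_module n q M"
  shows "is_module n q (module_sum Ms)"
  using assms(2)
proof (induction Ms)
  case Nil
  then show ?case by (intro zero_module assms wf_module_sum) (auto simp: hdim_module_sum)
next
  case (Cons M Ms)
  then have "is_module n q M" "is_module n q (module_sum Ms)" by auto
  then show ?case
    using biprod_module[OF assms(1) wf_module_sum biprod_module_sum] Cons.prems is_module_wf by metis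
qed

lemma is_module_sum2:
  "n > 0 \<Longrightarrow> is_module n q A \<Longrightarrow> is_module n q B \<Longrightarrow> is_module n q (module_sum [A, B])"
  by (rule is_module_sum) auto

lemma hmodule_eqI: "hdim M = hdim N \<Longrightarrow> (\<And>g. act M g = act N g) \<Longrightarrow> M = (N :: 'k hmodule)"
  by (cases M, cases N) auto

lemma module_sum_single [simp]: "module_sum [M] = M"
  by (rule hmodule_eqI) (simp_all only: act_module_sum hdim_module_sum list.map diag_block_mat_singleton
      sum_list.Cons sum_list.Nil add_0_right)

lemma biprod_module_sum2:
  assumes "wf_act X" "wf_act Y"
  shows "biprod (module_sum [X, Y]) X Y (E (hdim X)) (E (hdim X)) (sh (hdim X) * E (hdim Y)) (E (hdim Y) * sht (hdim X))"
  using biprod_module_sum[of X "[Y]"] assms by simp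

lemma module_sum_append: "module_sum (xs @ ys) = module_sum [module_sum xs, module_sum ys]"
proof (rule hmodule_eqI)
  fix g
  have "act (module_sum [module_sum xs, module_sum ys]) g =
      diag_block_mat ([act (module_sum xs) g] @ [act (module_sum ys) g])"
    by (simp only: act_module_sum list.map append.simps)
  also have "\<dots> = act (module_sum (xs @ ys)) g"
    unfolding act_module_sum map_append diag_block_mat_append diag_block_mat_singleton ..
  finally show "act (module_sum (xs @ ys)) g = act (module_sum [module_sum xs, module_sum ys]) g" ..
qed (simp add: hdim_module_sum)

lemma module_sum_Cons: "module_sum (x # xs) = module_sum [x, module_sum xs]"
  using module_sum_append[of "[x]" xs] by simp

lemma module_sum_concat: "module_sum (concat xss) = module_sum (map module_sum xss)"
proof (induction xss)
  case (Cons xs xss)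
  then show ?case using module_sum_append[of xs "concat xss"] module_sum_Cons[of "module_sum xs" "map module_sum xss"]
    by simp
qed simp

lemma biprod_iso:
  assumes b: "biprod T A B p1 q1 p2 q2" and b': "biprod T' A' B' p1' q1' p2' q2'"
    and m: "is_module n q T" "is_module n q T'" and iso: "mod_iso n q A A'" "mod_iso n q B B'"
  shows "mod_iso n q T T'"
proof -
  obtain f f' where f: "f \<in> hom A A'" "f' \<in> hom A' A" "f' * f = E (hdim A)" "f * f' = E (hdim A')"
    using iso(1) unfolding mod_iso_iff by blast
  obtain g g' where g: "g \<in> hom B B'" "g' \<in> hom B' B" "g' * g = E (hdim B)" "g * g' = E (hdim B')"
    using iso(2) unfolding mod_iso_iff by blast
  note d = b[unfolded biprod_def] and d' = b'[unfolded biprod_def]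
  have E: "q1 * p1 = E (hdim A)" "q2 * p2 = E (hdim B)" "q1 * p2 = 0" "q2 * p1 = 0"
    "q1' * p1' = E (hdim A')" "q2' * p2' = E (hdim B')" "q1' * p2' = 0" "q2' * p1' = 0"
    using d d' by auto
  have H: "E (hdim A) * q1 = q1" "E (hdim B) * q2 = q2" "E (hdim A') * q1' = q1'" "E (hdim B') * q2' = q2'"
    "E (hdim A') * f = f" "E (hdim B') * g = g" "E (hdim A) * f' = f'" "E (hdim B) * g' = g'"
    using d d' f g homD(1) by blast+
  define F where "F = p1' * f * q1 + p2' * g * q2"
  define G where "G = p1 * f' * q1' + p2 * g' * q2'"
  have "F \<in> hom T T'" "G \<in> hom T' T"
    unfolding F_def G_def using d d' f g by (auto intro!: hom_add intro: hom_comp)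
  moreover have "G * F = p1 * q1 + p2 * q2" "F * G = p1' * q1' + p2' * q2'"
    unfolding F_def G_def
    by (simp_all add: distrib_left distrib_right mult.assoc E[THEN assoc_ext] f(3,4)[THEN assoc_ext]
      g(3,4)[THEN assoc_ext] H H[THEN assoc_ext])
  ultimately show ?thesis unfolding mod_iso_iff using m d d' by metis
qed

lemma module_sum_cong2:
  assumes "n > 0" "mod_iso n q A A'" "mod_iso n q B B'"
  shows "mod_iso n q (module_sum [A, B]) (module_sum [A', B'])"
proof -
  have m: "is_module n q A" "is_module n q B" "is_module n q A'" "is_module n q B'"
    using assms(2,3) by (auto simp: mod_iso_iff)
  show ?thesis
    by (rule biprod_iso[OF biprod_module_sum2 biprod_module_sum2 is_module_sum2[OF assms(1)] is_module_sum2[OF assms(1)]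
        assms(2,3)]) (use m is_module_wf in blast)+
qed

lemma biprod_sum_iso:
  assumes "n > 0" "biprod T A B p1 q1 p2 q2" "is_module n q T" "is_module n q A" "is_module n q B"
  shows "mod_iso n q T (module_sum [A, B])"
  using biprod_iso[OF assms(2) biprod_module_sum2 assms(3) is_module_sum2[OF assms(1)] mod_iso_refl mod_iso_refl]
    assms(4,5) is_module_wf by blast

section \<open>Finite direct sums with summands indexed by position\<close>

definition fam :: "'k::field hmodule \<Rightarrow> 'k hmodule list \<Rightarrow> (nat \<Rightarrow> 'k lop) \<Rightarrow> (nat \<Rightarrow> 'k lop) \<Rightarrow> bool" where
  "fam T Ms p q \<longleftrightarrow> (\<forall>i<length Ms. p i \<in> hom (Ms ! i) T \<and> q i \<in> hom T (Ms ! i)) \<and>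
     (\<forall>i<length Ms. \<forall>j<length Ms. q i * p j = (if i = j then E (hdim (Ms ! i)) else 0)) \<and>
     (\<Sum>i<length Ms. p i * q i) = E (hdim T)"

lemma fam_module_sum:
  assumes "\<And>M. M \<in> set Ms \<Longrightarrow> wf_act M"
  shows "\<exists>p q. fam (module_sum Ms) Ms p q"
  using assms
proof (induction Ms)
  case Nil
  then show ?case by (simp add: fam_def hdim_module_sum)
next
  case (Cons M Ms)
  then obtain p q where pq: "fam (module_sum Ms) Ms p q" by auto
  have "wf_act M" "wf_act (module_sum Ms)" using Cons.prems wf_module_sum by auto
  from biprod_module_sum[OF this] obtain p1 q1 p2 q2
    where b: "biprod (module_sum (M # Ms)) M (module_sum Ms) p1 q1 p2 q2" by blast
  note b' = b[unfolded biprod_def]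
  note pq' = pq[unfolded fam_def]
  define P where "P = (\<lambda>i. case i of 0 \<Rightarrow> p1 | Suc i \<Rightarrow> p2 * p i)"
  define Q where "Q = (\<lambda>i. case i of 0 \<Rightarrow> q1 | Suc i \<Rightarrow> q i * q2)"
  have 1: "P i \<in> hom ((M # Ms) ! i) (module_sum (M # Ms)) \<and> Q i \<in> hom (module_sum (M # Ms)) ((M # Ms) ! i)"
    if "i < length (M # Ms)" for i
  proof (cases i)
    case 0
    then show ?thesis using b' by (simp add: P_def Q_def)
  next
    case (Suc j)
    then have "p j \<in> hom (Ms ! j) (module_sum Ms)" "q j \<in> hom (module_sum Ms) (Ms ! j)"
      using pq' that by auto
    then show ?thesis using Suc b' hom_comp by (auto simp: P_def Q_def)
  qed
  have e: "q j * E (hdim (module_sum Ms)) = q j" "E (hdim (module_sum Ms)) * p j = p j" if "j < length Ms" for j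
    using pq' that homD by blast+
  have z: "q1 * (p2 * x) = 0" "q2 * p1 = 0" "q2 * (p2 * x) = E (hdim (module_sum Ms)) * x" for x
    using b' assoc_ext by (metis mult_zero_left)+
  have 2: "Q i * P j = (if i = j then E (hdim ((M # Ms) ! i)) else 0)"
    if "i < length (M # Ms)" "j < length (M # Ms)" for i j
    using that pq' b' e z
    by (cases i; cases j) (auto simp: P_def Q_def mult.assoc)
  have "(\<Sum>i<length (M # Ms). P i * Q i) = p1 * q1 + (\<Sum>i<length Ms. p2 * p i * (q i * q2))"
    by (simp add: P_def Q_def sum.lessThan_Suc_shift del: sum.lessThan_Suc)
  also have "(\<Sum>i<length Ms. p2 * p i * (q i * q2)) = p2 * (\<Sum>i<length Ms. p i * q i) * q2"
    by (simp only: sum_distrib_left sum_distrib_right mult.assoc)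
  also have "(\<Sum>i<length Ms. p i * q i) = E (hdim (module_sum Ms))" using pq' by blast
  also have "p2 * E (hdim (module_sum Ms)) * q2 = p2 * q2" using b' homD(2) by metis
  also have "p1 * q1 + p2 * q2 = E (hdim (module_sum (M # Ms)))" using b' by simp
  finally have 3: "(\<Sum>i<length (M # Ms). P i * Q i) = E (hdim (module_sum (M # Ms)))" .
  have "fam (module_sum (M # Ms)) (M # Ms) P Q"
    unfolding fam_def
  proof (intro conjI 3)
    show "\<forall>i<length (M # Ms). P i \<in> hom ((M # Ms) ! i) (module_sum (M # Ms)) \<and>
      Q i \<in> hom (module_sum (M # Ms)) ((M # Ms) ! i)" by (intro allI impI 1)
    show "\<forall>i<length (M # Ms). \<forall>j<length (M # Ms). Q i * P j = (if i = j then E (hdim ((M # Ms) ! i)) else 0)"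
      by (intro allI impI 2)
  qed
  then show ?case by (intro exI)
qed

text \<open>Injections and projections are matched along the bijection. This serves both to permute
  summands and to identify a module split by explicit idempotents with a
  \<open>module_sum\<close>.\<close>

lemma fam_iso:
  assumes f: "fam T Ms p q" and f': "fam T' Ms' p' q'" and m: "is_module n z T" "is_module n z T'"
    and bij: "bij_betw \<pi> {..<length Ms} {..<length Ms'}" "\<And>i. i < length Ms \<Longrightarrow> Ms' ! \<pi> i = Ms ! i"
  shows "mod_iso n z T T'"
proof -
  note F = f[unfolded fam_def] and F' = f'[unfolded fam_def]
  let ?k = "length Ms"
  have pi: "\<pi> i < length Ms'" if "i < ?k" for i using bij(1) that by (auto simp: bij_betw_def)
  have inj: "\<pi> i = \<pi> j \<longleftrightarrow> i = j" if "i < ?k" "j < ?k" for i j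
    using bij(1) that by (auto simp: bij_betw_def inj_on_def)
  define A where "A = (\<Sum>i<?k. p' (\<pi> i) * q i)"
  define B where "B = (\<Sum>i<?k. p i * q' (\<pi> i))"
  have "p' (\<pi> i) \<in> hom (Ms ! i) T'" "q' (\<pi> i) \<in> hom T' (Ms ! i)" if "i < ?k" for i
    using F' pi[OF that] bij(2)[OF that] by metis+
  then have "A \<in> hom T T'" "B \<in> hom T' T"
    unfolding A_def B_def using F by (auto intro!: hom_sum intro: hom_comp)
  moreover have "B * A = E (hdim T)"
  proof -
    have "B * A = (\<Sum>i<?k. \<Sum>j<?k. p i * (q' (\<pi> i) * p' (\<pi> j)) * q j)"
      unfolding A_def B_def by (simp add: sum_product mult.assoc)
    also have "\<dots> = (\<Sum>i<?k. \<Sum>j<?k. if i = j then p i * q i else 0)"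
    proof (intro sum.cong refl)
      fix i j assume ij: "i \<in> {..<?k}" "j \<in> {..<?k}"
      then have "q' (\<pi> i) * p' (\<pi> j) = (if i = j then E (hdim (Ms ! i)) else 0)"
        using F' pi inj bij(2) by (metis lessThan_iff)
      moreover have "p i * E (hdim (Ms ! i)) = p i" using F ij homD(2) by blast
      ultimately show "p i * (q' (\<pi> i) * p' (\<pi> j)) * q j = (if i = j then p i * q i else 0)" by auto
    qed
    also have "\<dots> = (\<Sum>i<?k. p i * q i)" by simp
    finally show ?thesis using F by simp
  qed
  moreover have "A * B = E (hdim T')"
  proof -
    have "A * B = (\<Sum>i<?k. \<Sum>j<?k. p' (\<pi> i) * (q i * p j) * q' (\<pi> j))"
      unfolding A_def B_def by (simp add: sum_product mult.assoc)
    also have "\<dots> = (\<Sum>i<?k. \<Sum>j<?k. if i = j then p' (\<pi> i) * q' (\<pi> i) else 0)"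
    proof (intro sum.cong refl)
      fix i j assume ij: "i \<in> {..<?k}" "j \<in> {..<?k}"
      then have "q i * p j = (if i = j then E (hdim (Ms ! i)) else 0)" using F by auto
      moreover have "p' (\<pi> i) * E (hdim (Ms ! i)) = p' (\<pi> i)"
        using F' ij homD(2) pi bij(2) by (metis lessThan_iff)
      ultimately show "p' (\<pi> i) * (q i * p j) * q' (\<pi> j) = (if i = j then p' (\<pi> i) * q' (\<pi> i) else 0)" by auto
    qed
    also have "\<dots> = (\<Sum>i<?k. p' (\<pi> i) * q' (\<pi> i))" by simp
    also have "\<dots> = (\<Sum>i<length Ms'. p' i * q' i)"
      by (rule sum.reindex_bij_betw[OF bij(1), of "\<lambda>i. p' i * q' i"])
    finally show ?thesis using F' by simp
  qed
  ultimately show ?thesis unfolding mod_iso_iff using m by blast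
qed

lemma module_sum_perm:
  assumes "n > 0" "mset Ms = mset Ms'" "\<And>M. M \<in> set Ms \<Longrightarrow> is_module n q M"
  shows "mod_iso n q (module_sum Ms) (module_sum Ms')"
proof -
  obtain \<pi> where pi: "\<pi> permutes {..<length Ms'}" "permute_list \<pi> Ms' = Ms"
    using mset_eq_permutation[OF assms(2)] by metis
  have len: "length Ms = length Ms'" using assms(2) by (metis size_mset)
  have s: "set Ms = set Ms'" using assms(2) by (metis set_mset_mset)
  have "\<And>i. i < length Ms \<Longrightarrow> Ms' ! \<pi> i = Ms ! i"
    using pi len permute_list_nth by metis
  moreover have "bij_betw \<pi> {..<length Ms} {..<length Ms'}"
    unfolding len using permutes_imp_bij[OF pi(1)] .
  moreover obtain p r where "fam (module_sum Ms) Ms p r" using fam_module_sum assms(3) is_module_wf by blast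
  moreover obtain p' r' where "fam (module_sum Ms') Ms' p' r'"
    using fam_module_sum[of Ms'] assms(3) s is_module_wf by blast
  moreover have "is_module n q (module_sum Ms)" "is_module n q (module_sum Ms')"
    using is_module_sum[OF assms(1)] assms(3) s by blast+
  ultimately show ?thesis using fam_iso by blast
qed

subsection \<open>Cancellation and splitting\<close>

text \<open>Simplicity in the form in which it is applied. The zero module satisfies it as well, so
  a cover of such a \<open>V\<close> may itself be zero.\<close>

definition simp_mod :: "nat \<Rightarrow> 'k::field \<Rightarrow> 'k hmodule \<Rightarrow> bool" where
  "simp_mod n q V \<longleftrightarrow> is_module n q V \<and>
     (\<forall>X F. is_module n q X \<longrightarrow> F \<in> hom X V \<longrightarrow> F \<noteq> 0 \<longrightarrow> epi (hdim V) F)"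

lemma hom_inverse:
  assumes "F \<in> hom P P" "epi (hdim P) F" "wf_act P"
  shows "\<exists>G \<in> hom P P. F * G = E (hdim P) \<and> G * F = E (hdim P)"
proof -
  obtain S where S: "F * S = E (hdim P)" using assms(2) by (auto simp: epi_def)
  define G where "G = E (hdim P) * S * E (hdim P)"
  have G: "F * G = E (hdim P)" "G * F = E (hdim P)"
    using left_right_inverse[OF homD(2)[OF assms(1)] homD(1)[OF assms(1)] S] unfolding G_def by blast+
  have e: "E (hdim P) * G = G" "G * E (hdim P) = G" unfolding G_def by (simp_all add: mult.assoc assoc_ext[OF E_idem])
  have "G * ac P g = ac P g * G" for g
  proof -
    have "G * ac P g = G * (ac P g * (F * G))" by (simp only: G ac_E(2)[OF assms(3)])
    also have "\<dots> = G * (ac P g * F * G)" by (simp only: mult.assoc)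
    also have "\<dots> = G * F * (ac P g * G)" by (simp only: homD(3)[OF assms(1), symmetric] mult.assoc)
    also have "\<dots> = ac P g * G" by (simp only: G mult.assoc[symmetric] ac_E(1)[OF assms(3)])
    finally show ?thesis .
  qed
  then have "G \<in> hom P P" using e by (intro homI)
  with G show ?thesis by blast
qed

text \<open>The endomorphism ring of \<open>P\<close> is local: \<open>\<pi> * F\<close> is
  surjective because \<open>V\<close> is simple, hence \<open>F\<close> is surjective because
  \<open>\<pi>\<close> is essential, hence \<open>F\<close> is invertible by dimension.\<close>

lemma cover_endo:
  assumes "cover n q P V \<pi>" "simp_mod n q V" "F \<in> hom P P" "\<pi> * F \<noteq> 0"
  shows "\<exists>G \<in> hom P P. F * G = E (hdim P) \<and> G * F = E (hdim P)"
proof -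
  have P: "is_module n q P" "\<pi> \<in> hom P V" using assms(1) by (auto simp: cover_def projm_def)
  have "epi (hdim V) (\<pi> * F)" using assms(2,4) P hom_comp[OF assms(3) P(2)] unfolding simp_mod_def by blast
  then have "epi (hdim P) F" using assms(1,3) P unfolding cover_def by blast
  then show ?thesis using hom_inverse assms(3) is_module_wf[OF P(1)] by blast
qed

text \<open>Gaussian elimination: \<open>f\<close>, \<open>g\<close>, \<open>h\<close>,
  \<open>k\<close> are the blocks of an isomorphism from P + A to P + B, the primed letters those of
  its inverse. When the corner \<open>f\<close> is invertible, the Schur complement k - h f^(-1) g
  is an isomorphism with inverse \<open>k'\<close>.\<close>

lemma cancel_unit:
  assumes m: "is_module n q A" "is_module n q B"
    and h: "f \<in> hom P P" "g \<in> hom A P" "h \<in> hom P B" "k \<in> hom A B" "k' \<in> hom B A"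
    and i: "fi \<in> hom P P" "f * fi = E (hdim P)" "fi * f = E (hdim P)"
    and 1: "h' * f + k' * h = 0" "h' * g + k' * k = E (hdim A)"
      "f * g' + g * k' = 0" "h * g' + k * k' = E (hdim B)"
    and e: "h' * E (hdim P) = h'" "E (hdim P) * g' = g'"
  shows "mod_iso n q A B"
proof -
  define u where "u = k - h * fi * g"
  have "h * fi * g \<in> hom A B" using hom_comp[OF h(2) hom_comp[OF i(1) h(3)]] .
  then have u: "u \<in> hom A B" unfolding u_def using h by (intro hom_diff)
  have "k' * h = - (h' * f)" using 1(1) by (simp add: eq_neg_iff_add_eq_0 add.commute)
  then have "k' * h * fi = - (h' * (f * fi))" by (simp add: mult.assoc)
  then have "k' * h * fi = - h'" by (simp add: i e)
  then have "k' * u = k' * k + h' * g"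
    unfolding u_def right_diff_distrib by (simp add: mult.assoc[symmetric])
  then have 2: "k' * u = E (hdim A)" using 1(2) by (simp add: add.commute)
  have "g * k' = - (f * g')" using 1(3) by (simp add: eq_neg_iff_add_eq_0 add.commute)
  then have "fi * (g * k') = - (fi * f * g')" by (simp add: mult.assoc)
  then have "fi * (g * k') = - g'" by (simp add: i e)
  then have "u * k' = k * k' + h * g'"
    unfolding u_def left_diff_distrib by (simp add: mult.assoc)
  then have "u * k' = E (hdim B)" using 1(4) by (simp add: add.commute)
  with 2 u h m show ?thesis unfolding mod_iso_iff by blast
qed

text \<open>Exchange argument for a local endomorphism ring, based on f' f + g' h = 1. If the corner
  \<open>f\<close> is a unit, it is eliminated; otherwise a row operation by \<open>g'\<close> first
  turns the corner into a unit.\<close>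

lemma cover_cancel:
  assumes n: "n > 0" and cov: "cover n q P V \<pi>" and V: "simp_mod n q V"
    and m: "is_module n q A" "is_module n q B"
    and iso: "mod_iso n q (module_sum [P, A]) (module_sum [P, B])"
  shows "mod_iso n q A B"
proof -
  have P: "is_module n q P" "\<pi> \<in> hom P V" using cov by (auto simp: cover_def projm_def)
  define S where "S = module_sum [P, A]"
  define T where "T = module_sum [P, B]"
  obtain p1 q1 p2 q2 where b: "biprod S P A p1 q1 p2 q2"
    unfolding S_def using biprod_module_sum[of P "[A]"] m P by (auto simp: is_module_wf)
  obtain p1' q1' p2' q2' where b': "biprod T P B p1' q1' p2' q2'"
    unfolding T_def using biprod_module_sum[of P "[B]"] m P by (auto simp: is_module_wf)
  note b = b[unfolded biprod_def] and b' = b'[unfolded biprod_def]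
  obtain \<Phi> \<Psi> where i: "\<Phi> \<in> hom S T" "\<Psi> \<in> hom T S" "\<Psi> * \<Phi> = E (hdim S)" "\<Phi> * \<Psi> = E (hdim T)"
    using iso unfolding mod_iso_iff S_def[symmetric] T_def[symmetric] by blast
  have S: "x * \<Psi> * p1' * (q1' * \<Phi> * y) + x * \<Psi> * p2' * (q2' * \<Phi> * y) = x * E (hdim S) * y" for x y
  proof -
    have "x * \<Psi> * p1' * (q1' * \<Phi> * y) + x * \<Psi> * p2' * (q2' * \<Phi> * y) = x * (\<Psi> * (p1' * q1' + p2' * q2')) * \<Phi> * y"
      by (simp add: distrib_left distrib_right mult.assoc)
    also have "\<dots> = x * (\<Psi> * E (hdim T)) * \<Phi> * y" using b' by simp
    also have "\<dots> = x * (\<Psi> * \<Phi>) * y" by (simp only: homD(2)[OF i(2)] mult.assoc)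
    finally show ?thesis by (simp only: i(3))
  qed
  have T: "x * \<Phi> * p1 * (q1 * \<Psi> * y) + x * \<Phi> * p2 * (q2 * \<Psi> * y) = x * E (hdim T) * y" for x y
  proof -
    have "x * \<Phi> * p1 * (q1 * \<Psi> * y) + x * \<Phi> * p2 * (q2 * \<Psi> * y) = x * (\<Phi> * (p1 * q1 + p2 * q2)) * \<Psi> * y"
      by (simp add: distrib_left distrib_right mult.assoc)
    also have "\<dots> = x * (\<Phi> * E (hdim S)) * \<Psi> * y" using b by simp
    also have "\<dots> = x * (\<Phi> * \<Psi>) * y" by (simp only: homD(2)[OF i(1)] mult.assoc)
    finally show ?thesis by (simp only: i(4))
  qed
  have q: "q1 * E (hdim S) = q1" "q2 * E (hdim S) = q2" "q1' * E (hdim T) = q1'" "q2' * E (hdim T) = q2'"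
    using b b' homD(2) by blast+
  define f where "f = q1' * \<Phi> * p1"
  define g where "g = q1' * \<Phi> * p2"
  define h where "h = q2' * \<Phi> * p1"
  define k where "k = q2' * \<Phi> * p2"
  define f' where "f' = q1 * \<Psi> * p1'"
  define g' where "g' = q1 * \<Psi> * p2'"
  define h' where "h' = q2 * \<Psi> * p1'"
  define k' where "k' = q2 * \<Psi> * p2'"
  have hm: "f \<in> hom P P" "g \<in> hom A P" "h \<in> hom P B" "k \<in> hom A B"
    "f' \<in> hom P P" "g' \<in> hom B P" "h' \<in> hom P A" "k' \<in> hom B A"
    unfolding f_def g_def h_def k_def f'_def g'_def h'_def k'_def
    using b b' i hom_comp by blast+
  have r: "f' * f + g' * h = E (hdim P)" "f' * g + g' * k = 0" "h' * f + k' * h = 0" "h' * g + k' * k = E (hdim A)"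
    using S[of q1 p1] S[of q1 p2] S[of q2 p1] S[of q2 p2] b q
    unfolding f_def g_def h_def k_def f'_def g'_def h'_def k'_def by simp_all
  have r': "f * f' + g * h' = E (hdim P)" "f * g' + g * k' = 0" "h * f' + k * h' = 0" "h * g' + k * k' = E (hdim B)"
    using T[of q1' p1'] T[of q1' p2'] T[of q2' p1'] T[of q2' p2'] b' q
    unfolding f_def g_def h_def k_def f'_def g'_def h'_def k'_def by simp_all
  have eh: "h' * E (hdim P) = h'" "E (hdim P) * g' = g'" "\<pi> * E (hdim P) = \<pi>"
    using hm P homD by blast+
  show ?thesis
  proof (cases "\<pi> * f = 0")
    case False
    then obtain fi where "fi \<in> hom P P" "f * fi = E (hdim P)" "fi * f = E (hdim P)"
      using cover_endo[OF cov V hm(1)] by blast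
    from cancel_unit[OF m hm(1-4) hm(8) this r(3,4) r'(2,4) eh(1,2)] show ?thesis .
  next
    case True
    show ?thesis
    proof (cases "\<pi> = 0")
      \<comment> \<open>Then V = 0, and essentiality applied to the zero map shows P = 0, where the
        only map is its own inverse.\<close>
      case True
      have ess: "epi (hdim V) (\<pi> * 0) \<longrightarrow> epi (hdim P) (0 :: 'a lop)" "epi (hdim V) \<pi>"
        using cov P(1) hom_0[of P P] unfolding cover_def by metis+
      have "epi (hdim P) (0 :: 'a lop)" using ess(2) ess(1)[unfolded mult_zero_right] unfolding True by blast
      then have E0: "E (hdim P) = (0::'a lop)" unfolding epi_def by force
      then have "f = 0" using homD(1)[OF hm(1)] by simp
      then have "f * f = E (hdim P)" using E0 by simp
      from cancel_unit[OF m hm(1-4) hm(8) hm(1) this this r(3,4) r'(2,4) eh(1,2)] show ?thesis .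
    next
      case pi: False
      \<comment> \<open>Otherwise f' f would be invertible, so \<open>f\<close> would have a left
        inverse and, by dimension, an inverse; then \<open>\<pi> * f = 0\<close> would force
        \<open>\<pi> = 0\<close>.\<close>
      have "\<pi> * (f' * f) = 0"
      proof (rule ccontr)
        assume "\<pi> * (f' * f) \<noteq> 0"
        from cover_endo[OF cov V hom_comp[OF hm(1) hm(5)] this]
        obtain z where z: "z * (f' * f) = E (hdim P)" by blast
        define y where "y = z * f'"
        have y: "y * f = E (hdim P)" using z by (simp add: y_def mult.assoc)
        define y0 where "y0 = E (hdim P) * y * E (hdim P)"
        have y0: "y0 * E (hdim P) = y0" "E (hdim P) * y0 = y0"
          by (simp_all add: y0_def mult.assoc assoc_ext[OF E_idem])
        have y0f: "y0 * f = E (hdim P)"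
        proof -
          have "y0 * f = E (hdim P) * (y * (E (hdim P) * f))" by (simp add: y0_def mult.assoc)
          then show ?thesis by (simp add: homD(1)[OF hm(1)] y)
        qed
        have "E (hdim P) * f * E (hdim P) = f" by (simp only: homD(1,2)[OF hm(1)])
        then have "f * y0 = E (hdim P)" using left_right_inverse(1)[OF y0 y0f] by (simp only:)
        then have "\<pi> * E (hdim P) = \<pi> * f * y0" by (simp add: mult.assoc)
        then show False using True pi eh(3) by simp
      qed
      moreover have "\<pi> * (f' * f) + \<pi> * (g' * h) = \<pi>"
        unfolding distrib_left[symmetric] r(1) by (rule eh(3))
      ultimately have pg: "\<pi> * (g' * h) = \<pi>" by simp
      \<comment> \<open>Row operation: \<open>g'\<close> times the second row is added to the first,
        and the inverse is corrected by the matching column operation (\<open>g2'\<close>,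
        \<open>k2'\<close>).\<close>
      define F where "F = f + g' * h"
      have F: "F \<in> hom P P" unfolding F_def by (rule hom_add[OF hm(1) hom_comp[OF hm(3) hm(6)]])
      have "\<pi> * F = \<pi>" unfolding F_def distrib_left pg True by simp
      then obtain fi where fi: "fi \<in> hom P P" "F * fi = E (hdim P)" "fi * F = E (hdim P)"
        using cover_endo[OF cov V F] pi by metis
      define g2 where "g2 = g + g' * k"
      define g2' where "g2' = g' - f' * g'"
      define k2' where "k2' = k' - h' * g'"
      have hm2: "g2 \<in> hom A P" "k2' \<in> hom B A"
        unfolding g2_def k2'_def
        by (rule hom_add[OF hm(2) hom_comp[OF hm(4) hm(6)]], rule hom_diff[OF hm(8) hom_comp[OF hm(6) hm(7)]])
      have "h' * F + k2' * h = h' * f + k' * h" "h' * g2 + k2' * k = h' * g + k' * k"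
        unfolding F_def k2'_def g2_def by (simp_all add: algebra_simps)
      then have 1: "h' * F + k2' * h = 0" "h' * g2 + k2' * k = E (hdim A)" using r by simp_all
      have "F * g2' + g2 * k2' = (f * g' + g * k') + g' * (h * g' + k * k') - (f * f' + g * h') * g' - g' * ((h * f' + k * h') * g')"
        unfolding F_def g2'_def g2_def k2'_def by (simp add: algebra_simps)
      also have "\<dots> = 0" unfolding r' using homD[OF hm(6)] by simp
      finally have 2: "F * g2' + g2 * k2' = 0" .
      have "h * g2' + k * k2' = (h * g' + k * k') - (h * f' + k * h') * g'"
        unfolding g2'_def k2'_def by (simp add: algebra_simps)
      then have 3: "h * g2' + k * k2' = E (hdim B)" unfolding r' by simp
      have "E (hdim P) * g2' = g2'" unfolding g2'_def right_diff_distrib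
        by (simp only: eh(2) assoc_ext[OF homD(1)[OF hm(5)]])
      from cancel_unit[OF m F hm2(1) hm(3,4) hm2(2) fi 1 2 3 eh(1) this] show ?thesis .
    qed
  qed
qed

lemma module_sum_cancel:
  assumes n: "n > 0" and cov: "\<And>P. P \<in> set Ps \<Longrightarrow> \<exists>V \<pi>. cover n q P V \<pi> \<and> simp_mod n q V"
    and m: "is_module n q A" "is_module n q B"
    and iso: "mod_iso n q (module_sum [module_sum Ps, A]) (module_sum [module_sum Ps, B])"
  shows "mod_iso n q A B"
  using cov iso
proof (induction Ps)
  case Nil
  have "module_sum [module_sum [], X] = X" for X :: "'a hmodule"
    using module_sum_append[of "[]" "[X]"] by simp
  then show ?case using Nil by simp
next
  case (Cons P Ps)
  have e: "module_sum [module_sum (P # Ps), X] = module_sum [P, module_sum [module_sum Ps, X]]" for X :: "'a hmodule"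
    using module_sum_append[of "P # Ps" "[X]"] module_sum_append[of "Ps" "[X]"] module_sum_Cons[of P "Ps @ [X]"] by simp
  obtain V \<pi> where V: "cover n q P V \<pi>" "simp_mod n q V" using Cons.prems(1)[of P] by auto
  have "is_module n q M" if "M \<in> set Ps" for M
    using Cons.prems(1)[of M] that by (auto simp: cover_def projm_def)
  then have mp: "is_module n q (module_sum Ps)" using is_module_sum[OF n] by blast
  have "is_module n q (module_sum [module_sum Ps, A])" "is_module n q (module_sum [module_sum Ps, B])"
    using mp m by (intro is_module_sum[OF n]; auto)+
  then have "mod_iso n q (module_sum [module_sum Ps, A]) (module_sum [module_sum Ps, B])"
    using cover_cancel[OF n V] Cons.prems(2) unfolding e by blast
  then show ?case using Cons.IH Cons.prems(1) by auto
qed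

section \<open>Projectivity of sums and splitting of exact sequences\<close>

lemma projm_biprod:
  assumes "biprod T A B p1 q1 p2 q2" "is_module n q T" "projm n q A" "projm n q B"
  shows "projm n q T"
  unfolding projm_def
proof (intro conjI allI impI)
  fix X Y F H assume *: "is_module n q X" "is_module n q Y" "F \<in> hom X Y" "epi (hdim Y) F" "H \<in> hom T Y"
  note b = assms(1)[unfolded biprod_def]
  obtain K1 where K1: "K1 \<in> hom A X" "F * K1 = H * p1"
    using assms(3) * hom_comp[OF conjunct1[OF b] *(5)] unfolding projm_def by blast
  have "H * p2 \<in> hom B Y" using b *(5) hom_comp by blast
  then obtain K2 where K2: "K2 \<in> hom B X" "F * K2 = H * p2"
    using assms(4) * unfolding projm_def by blast
  have "K1 * q1 + K2 * q2 \<in> hom T X" using b K1 K2 hom_comp hom_add by blast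
  moreover have "F * (K1 * q1 + K2 * q2) = H * (p1 * q1 + p2 * q2)"
    by (simp add: distrib_left mult.assoc[symmetric] K1(2) K2(2))
  then have "F * (K1 * q1 + K2 * q2) = H" using b homD(2)[OF *(5)] by simp
  ultimately show "\<exists>K \<in> hom T X. F * K = H" by blast
qed (use assms in auto)

lemma projm_sum:
  assumes "n > 0" "\<And>P. P \<in> set Ps \<Longrightarrow> projm n q P"
  shows "projm n q (module_sum Ps)"
  using assms(2)
proof (induction Ps)
  case Nil
  have "H = 0" if "H \<in> hom (module_sum []) Y" for H and Y :: "'a hmodule"
    using homD(2)[OF that] by (simp add: hdim_module_sum)
  then have "\<exists>K \<in> hom (module_sum []) X. F * K = H" if "H \<in> hom (module_sum []) Y" for X Y :: "'a hmodule" and F H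
    using that hom_0 by (intro bexI[of _ 0]) auto
  then show ?case using is_module_sum[OF assms(1), of "[]"] unfolding projm_def by auto
next
  case (Cons P Ps)
  then have P: "projm n q P" "projm n q (module_sum Ps)" by auto
  then have "is_module n q P" "is_module n q (module_sum Ps)" by (auto simp: projm_def)
  then have "is_module n q (module_sum (P # Ps))" "wf_act P" "wf_act (module_sum Ps)"
    using is_module_sum2[OF assms(1)] module_sum_Cons[of P Ps] is_module_wf by metis+
  then show ?case using projm_biprod[OF biprod_module_sum] P by blast
qed

lemma projm_iso:
  assumes "mod_iso n q P Q" "projm n q Q"
  shows "projm n q P"
  unfolding projm_def
proof (intro conjI allI impI)
  fix X Y F H assume *: "is_module n q X" "is_module n q Y" "F \<in> hom X Y" "epi (hdim Y) F" "H \<in> hom P Y"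
  obtain f g where fg: "f \<in> hom P Q" "g \<in> hom Q P" "g * f = E (hdim P)"
    using assms(1) unfolding mod_iso_iff by blast
  obtain K where K: "K \<in> hom Q X" "F * K = H * g"
    using assms(2) * hom_comp[OF fg(2) *(5)] unfolding projm_def by blast
  have "F * (K * f) = H * (g * f)" by (simp only: mult.assoc[symmetric] K(2))
  then have "F * (K * f) = H" by (simp only: fg(3) homD(2)[OF *(5)])
  then show "\<exists>K \<in> hom P X. F * K = H" using hom_comp[OF fg(1) K(1)] by blast
qed (use assms in \<open>auto simp: mod_iso_iff\<close>)

text \<open>Projectivity of \<open>C\<close> replaces the linear section \<open>S\<close> by a
  homomorphism \<open>S'\<close>. The corrected retraction R' = R (1 - S' G) satisfies F R' = 1 - S'
  G; the right side is a homomorphism and \<open>F\<close> is injective, so \<open>R'\<close> is a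
  homomorphism too.\<close>

lemma ses_split:
  assumes n: "n > 0" and s: "ses A B C" and m: "is_module n q A" "is_module n q B" and C: "projm n q C"
  shows "mod_iso n q B (module_sum [A, C])"
proof -
  obtain F G R S where FG: "F \<in> hom A B" "G \<in> hom B C" "R * F = E (hdim A)" "G * S = E (hdim C)"
     "F * R + S * G = E (hdim B)" "E (hdim A) * R * E (hdim B) = R" "E (hdim B) * S * E (hdim C) = S"
    using s unfolding ses_def by blast
  have mC: "is_module n q C" using C by (simp add: projm_def)
  have "epi (hdim C) G" using FG(4) by (auto simp: epi_def)
  then obtain S' where S': "S' \<in> hom C B" "G * S' = E (hdim C)"
    using C m(2) mC FG(2) hom_id[OF is_module_wf[OF mC]] unfolding projm_def by blast
  have RE: "E (hdim A) * R = R" "R * E (hdim B) = R"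
    using FG(6) by (metis mult.assoc E_idem)+
  define R' where "R' = R * (E (hdim B) - S' * G)"
  have sr: "F * R = E (hdim B) - S * G" using FG(5) by (simp add: eq_diff_eq)
  have SE: "S * E (hdim C) = S" using FG(7) by (metis mult.assoc E_idem)
  have "F * R' = (E (hdim B) - S * G) * (E (hdim B) - S' * G)" unfolding R'_def sr[symmetric] by (simp add: mult.assoc)
  also have "\<dots> = E (hdim B) - S' * G"
    using assoc_ext[OF S'(2)] by (simp add: algebra_simps homD[OF FG(2)] homD[OF S'(1)] assoc_ext[OF homD(1)[OF S'(1)]] assoc_ext[OF SE] mult.assoc)
  finally have FR': "F * R' = E (hdim B) - S' * G" .
  have hFR: "F * R' \<in> hom B B" unfolding FR'
    using hom_diff[OF hom_id[OF is_module_wf[OF m(2)]] hom_comp[OF FG(2) S'(1)]] .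
  have R'E: "E (hdim A) * R' = R'" "R' * E (hdim B) = R'"
    unfolding R'_def using assoc_ext[OF RE(1)]
    by (simp_all add: algebra_simps homD[OF FG(2)] mult.assoc RE)
  have "R' \<in> hom B A"
  proof (rule homI[OF R'E])
    fix g
    have "R * (F * (R' * ac B g)) = R * (F * (ac A g * R'))"
      using homD(3)[OF hFR] homD(3)[OF FG(1)] by (metis mult.assoc)
    then have "E (hdim A) * (R' * ac B g) = E (hdim A) * (ac A g * R')"
      using FG(3) by (metis mult.assoc)
    then show "R' * ac B g = ac A g * R'"
      using R'E ac_E(1)[OF is_module_wf[OF m(1)]] by (metis mult.assoc)
  qed
  moreover have "G * F = 0"
  proof -
    have "G * (F * R + S * G) * F = G * F + G * F"
    proof -
      have "G * (F * R + S * G) * F = G * F * (R * F) + (G * S) * G * F"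
        by (simp add: distrib_left distrib_right mult.assoc)
      then show ?thesis using FG(3,4) homD(2)[OF FG(1)] homD(1)[OF FG(2)] by (simp add: mult.assoc)
    qed
    moreover have "G * (F * R + S * G) * F = G * F" using FG(5) homD(2)[OF FG(2)] by simp
    ultimately show ?thesis by simp
  qed
  then have "R' * F = E (hdim A)" unfolding R'_def
    using FG(3) homD(1)[OF FG(1)] by (simp add: algebra_simps mult.assoc)
  moreover have "R' * S' = 0"
    unfolding R'_def using S'(2) homD[OF S'(1)] by (simp add: algebra_simps mult.assoc)
  ultimately have "biprod B A C F R' S' G"
    unfolding biprod_def using FG(1,2) S' \<open>G * F = 0\<close> FR' by simp
  then show ?thesis using biprod_sum_iso[OF n] m mC by blast
qed

text \<open>At rung t + 1 the middle term is both M_t + M_(t+2) and, by splitting, twice M_(t+1).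
  Cancelling t copies of \<open>Rs\<close> from 2 (t + 1) leaves t + 2. \<open>B\<close> is kept
  apart from the sum since tensoring distributes over sums only up to isomorphism.\<close>

lemma tube_ladder:
  fixes M :: "nat \<Rightarrow> 'k::field hmodule"
  assumes n: "n > 0" and cov: "\<And>P. P \<in> set Rs \<Longrightarrow> \<exists>V \<pi>. cover n q P V \<pi> \<and> simp_mod n q V"
    and m: "\<And>t. is_module n q (M t)" and M0: "hdim (M 0) = 0" and M1: "mod_iso n q (M 1) (module_sum Rs)"
    and ex: "\<And>t. t \<ge> 1 \<Longrightarrow> \<exists>B. is_module n q B \<and> ses (M t) B (M t) \<and>
        mod_iso n q B (module_sum [M (t - 1), M (t + 1)])"
  shows "mod_iso n q (M t) (module_sum (concat (replicate t Rs)))"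
proof -
  define S where "S t = concat (replicate t Rs)" for t
  have sS: "set (S t) \<subseteq> set Rs" for t by (auto simp: S_def)
  have proj: "projm n q P" if "P \<in> set Rs" for P using cov[OF that] by (auto simp: cover_def)
  then have pS: "projm n q (module_sum (S t))" for t using projm_sum[OF n] sS by blast
  have mR: "is_module n q P" if "P \<in> set Rs" for P using proj[OF that] by (simp add: projm_def)
  have mS: "is_module n q (module_sum (S t))" for t using pS by (simp add: projm_def)
  \<comment> \<open>Two neighbouring rungs are carried along, as each sequence ties three rungs
    together.\<close>
  have "mod_iso n q (M t) (module_sum (S t)) \<and> mod_iso n q (M (Suc t)) (module_sum (S (Suc t)))" for t
  proof (induction t)
    case 0
    have "mod_iso n q (M 0) (module_sum (S 0))"
      unfolding mod_iso_iff
      by (intro conjI m mS bexI[OF _ hom_0]) (simp_all add: M0 S_def hdim_module_sum)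
    then show ?case using M1 by (simp add: S_def)
  next
    case (Suc t)
    obtain B where B: "is_module n q B" "ses (M (Suc t)) B (M (Suc t))"
        "mod_iso n q B (module_sum [M t, M (Suc (Suc t))])" using ex[of "Suc t"] by auto
    have "projm n q (M (Suc t))" using Suc pS projm_iso by blast
    from ses_split[OF n B(2) m B(1) this]
    have 1: "mod_iso n q B (module_sum [M (Suc t), M (Suc t)])" .
    have "mod_iso n q (module_sum [module_sum (S t), M (Suc (Suc t))]) (module_sum [M t, M (Suc (Suc t))])"
      using module_sum_cong2[OF n mod_iso_sym mod_iso_refl] Suc m by blast
    from mod_iso_trans[OF mod_iso_trans[OF mod_iso_trans[OF this mod_iso_sym[OF B(3)]] 1]
        module_sum_cong2[OF n conjunct2[OF Suc] conjunct2[OF Suc]]]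
    have "mod_iso n q (module_sum [module_sum (S t), M (Suc (Suc t))])
      (module_sum [module_sum (S (Suc t)), module_sum (S (Suc t))])" .
    moreover have "module_sum [module_sum (S (Suc t)), module_sum (S (Suc t))] =
        module_sum [module_sum (S t), module_sum (S (Suc (Suc t)))]"
    proof -
      \<comment> \<open>Both sides are 2 (t + 1) copies of \<open>Rs\<close> in a row, so the lists
        agree literally.\<close>
      have "S (Suc t) @ S (Suc t) = S t @ S (Suc (Suc t))"
        unfolding S_def concat_append[symmetric] replicate_add[symmetric] by simp
      then show ?thesis unfolding module_sum_append[symmetric] by simp
    qed
    ultimately have "mod_iso n q (module_sum [module_sum (S t), M (Suc (Suc t))])
      (module_sum [module_sum (S t), module_sum (S (Suc (Suc t)))])" by simp
    then have "mod_iso n q (M (Suc (Suc t))) (module_sum (S (Suc (Suc t))))"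
      using module_sum_cancel[OF n _ m mS] cov sS by blast
    with Suc show ?case by blast
  qed
  then show ?thesis by (simp add: S_def)
qed

section \<open>Weight vectors\<close>

locale prim_root =
  fixes n :: nat and q :: "'k::field"
  assumes n2: "n > 2" and prim: "primitive_root_of_unity n q"
begin

lemma n0 [simp]: "n > 0" using n2 by simp

lemma qn [simp]: "q ^ n = 1" using prim by (simp add: primitive_root_of_unity_def)

lemma q0 [simp]: "q \<noteq> 0"
proof
  assume "q = 0"
  then show False using qn n0 by (simp add: zero_power)
qed

lemma q_pow_mod: "q ^ i = q ^ (i mod n)"
proof -
  have "q ^ i = q ^ (n * (i div n) + i mod n)" by simp
  also have "\<dots> = q ^ (i mod n)" unfolding power_add power_mult by simp
  finally show ?thesis .
qed

lemma q_pow_eq_1: "q ^ i = 1 \<longleftrightarrow> n dvd i"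
proof
  assume "q ^ i = 1"
  then have "q ^ (i mod n) = 1" using q_pow_mod by metis
  then show "n dvd i" using prim n0 unfolding primitive_root_of_unity_def
    by (metis mod_less_divisor gr0I mod_eq_0_iff_dvd)
qed (auto simp: power_mult)

lemma q_powi_eq_1: "q powi i = 1 \<longleftrightarrow> int n dvd i"
proof (cases "i \<ge> 0")
  case True
  then obtain k where k: "i = int k" using nonneg_int_cases by blast
  show ?thesis unfolding k power_int_of_nat q_pow_eq_1 by simp
next
  case False
  then obtain k where k: "i = - int k" by (metis int_cases2 of_nat_0_le_iff)
  show ?thesis unfolding k power_int_minus power_int_of_nat using q_pow_eq_1 by simp
qed

lemma q_powi_eq: "q powi i = q powi j \<longleftrightarrow> int n dvd i - j"
proof -
  have "q powi (i - j) = q powi i / q powi j" by (simp add: power_int_diff)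
  then show ?thesis using q_powi_eq_1[of "i - j"] by (auto simp: power_int_eq_0_iff)
qed

lemma q_powi_n: "(q powi i) ^ n = 1"
  by (metis power_int_1_left power_int_mult power_int_of_nat qn mult.commute)

lemma q_ne_1: "q \<noteq> 1" using q_pow_eq_1[of 1] n2 by auto

lemma qint_simps [simp]: "qint q 0 = 0" "qint q (Suc i) = qint q i + q ^ i"
  by (simp_all add: qint_def)

lemma qint_geom: "qint q i * (1 - q) = 1 - q ^ i"
proof (induction i)
  case (Suc i)
  have "qint q (Suc i) * (1 - q) = qint q i * (1 - q) + q ^ i * (1 - q)" by (simp add: distrib_right)
  also have "\<dots> = 1 - q ^ Suc i" unfolding Suc by (simp add: algebra_simps)
  finally show ?case .
qed simp

lemma qint_eq_0: "qint q i = 0 \<longleftrightarrow> n dvd i"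
proof -
  have "qint q i = 0 \<longleftrightarrow> qint q i * (1 - q) = 0" using q_ne_1 by simp
  then show ?thesis unfolding qint_geom using q_pow_eq_1[of i] by auto
qed

lemma qint_Suc: "qint q (Suc i) = 1 + q * qint q i"
proof (induction i)
  case (Suc i)
  have "qint q (Suc (Suc i)) = 1 + q * qint q i + q ^ Suc i"
    unfolding qint_simps(2)[of "Suc i"] Suc ..
  also have "\<dots> = 1 + q * (qint q i + q ^ i)" by (simp add: distrib_left)
  finally show ?case unfolding qint_simps(2)[of i] .
qed simp

lemma sum2_pick:
  fixes x y k :: nat
  shows "x < k \<Longrightarrow> y < k \<Longrightarrow> (\<Sum>x'<k. \<Sum>y'<k. if x' = x \<and> y' = y then f x' y' else 0) = (f x y :: 'a :: comm_monoid_add)"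
proof -
  assume k: "x < k" "y < (k :: nat)"
  have "(\<Sum>y'<k. if x' = x \<and> y' = y then f x' y' else 0) = (if x' = x then f x' y else 0)" for x'
    using k by (cases "x' = x") simp_all
  then show ?thesis using k by simp
qed

text \<open>If n were 0 in k, then 1 would be a root of 1 + x + ... + x^(n-1) along with the other
  powers of \<open>q\<close>, too many for degree n - 1. The result allows averaging over the powers
  of \<open>b\<close> and of \<open>c\<close>.\<close>

lemma of_nat_n [simp]: "(of_nat n :: 'k) \<noteq> 0"
proof
  assume 0: "(of_nat n :: 'k) = 0"
  define p :: "'k poly" where "p = (\<Sum>i<n. monom 1 i)"
  have ev: "poly p x = (\<Sum>i<n. x ^ i)" for x by (simp add: p_def poly_sum poly_monom)
  have "coeff p (n - 1) = 1" using n0 by (simp add: p_def coeff_sum)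
  then have p0: "p \<noteq> 0" by auto
  have "degree p \<le> n - 1" unfolding p_def by (intro degree_sum_le) (auto intro: degree_monom_le[THEN order_trans])
  moreover have "(\<lambda>i. q ^ i) ` {..<n} \<subseteq> {x. poly p x = 0}"
  proof
    fix x assume "x \<in> (\<lambda>i. q ^ i) ` {..<n}"
    then obtain i where i: "x = q ^ i" by auto
    have "(1 - x) * (\<Sum>j<n. x ^ j) = 1 - x ^ n" by (simp add: sum_gp_strict)
    moreover have "x ^ n = 1" unfolding i power_mult[symmetric] by (simp add: q_pow_eq_1)
    ultimately show "x \<in> {x. poly p x = 0}" using 0 by (cases "x = 1") (auto simp: ev)
  qed
  moreover have "inj_on (\<lambda>i. q ^ i) {..<n}"
  proof (rule linorder_inj_onI)
    fix i j assume "i < j" "i \<in> {..<n}" "j \<in> {..<n}"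
    then have "q ^ j = q ^ i * q ^ (j - i)" "\<not> n dvd j - i"
      by (auto simp: power_add[symmetric] dest: dvd_imp_le)
    then show "q ^ i \<noteq> q ^ j" using q_pow_eq_1[of "j - i"] by auto
  qed auto
  ultimately have "n \<le> degree p"
    using card_mono[OF poly_roots_finite[OF p0]] card_image card_poly_roots_bound[OF p0] by (metis card_lessThan le_trans)
  with \<open>degree p \<le> n - 1\<close> show False using n0 by linarith
qed

lemma root_sum: "\<rho> ^ n = 1 \<Longrightarrow> \<rho> \<noteq> 1 \<Longrightarrow> (\<Sum>i<n. \<rho> ^ i) = (0 :: 'k)"
  by (simp add: sum_gp_strict)

text \<open>\<open>v\<close> may have any number of columns; it is a single weight vector if also \<open>v * un 0 0 = v\<close>.\<close>

definition wt :: "'k hmodule \<Rightarrow> 'k \<Rightarrow> 'k \<Rightarrow> 'k lop \<Rightarrow> bool" where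
  "wt M \<beta> \<gamma> v \<longleftrightarrow> E (hdim M) * v = v \<and> ac M GB * v = \<beta> *o v \<and> ac M GC * v = \<gamma> *o v"

lemma rels:
  assumes "is_module n q M"
  shows "ac M GB * (ac M GA * v) = q *o (ac M GA * (ac M GB * v))"
    "ac M GC * (ac M GA * v) = q *o (ac M GA * (ac M GC * v))"
    "ac M GB * (ac M GD * v) = inverse q *o (ac M GD * (ac M GB * v))"
    "ac M GC * (ac M GD * v) = inverse q *o (ac M GD * (ac M GC * v))"
    "ac M GB * (ac M GC * v) = ac M GC * (ac M GB * v)"
    "ac M GD * (ac M GA * v) = q *o (ac M GA * (ac M GD * v)) + E (hdim M) * v - ac M GB * (ac M GC * v)"
    "ac M GA ^ n * v = 0" "ac M GD ^ n * v = 0" "ac M GB ^ n * v = E (hdim M) * v" "ac M GC ^ n * v = E (hdim M) * v"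
    "E (hdim M) * (ac M g * v) = ac M g * v"
proof -
  have r: "ops_module n q (hdim M) (ac M GA) (ac M GB) (ac M GC) (ac M GD)" and wf: "wf_act M"
    using is_module_iff[of n q M] assms n0 by blast+
  note r = r[unfolded ops_module_def]
  have m: "x * y * v = x * (y * v)" for x y :: "'k lop" by (rule mult.assoc)
  show "ac M GB * (ac M GA * v) = q *o (ac M GA * (ac M GB * v))"
    "ac M GC * (ac M GA * v) = q *o (ac M GA * (ac M GC * v))"
    "ac M GB * (ac M GC * v) = ac M GC * (ac M GB * v)"
    using r m by (metis scl_mult_left)+
  have "ac M GD * (ac M GB * v) = q *o (ac M GB * (ac M GD * v))"
    "ac M GD * (ac M GC * v) = q *o (ac M GC * (ac M GD * v))"
    using r m by (metis scl_mult_left)+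
  then show "ac M GB * (ac M GD * v) = inverse q *o (ac M GD * (ac M GB * v))"
    "ac M GC * (ac M GD * v) = inverse q *o (ac M GD * (ac M GC * v))" by simp_all
  have "ac M GD * ac M GA = q *o (ac M GA * ac M GD) + (E (hdim M) - ac M GB * ac M GC)"
    using r by (simp add: diff_eq_eq add.commute)
  then have "ac M GD * ac M GA * v = (q *o (ac M GA * ac M GD) + (E (hdim M) - ac M GB * ac M GC)) * v" by simp
  then show "ac M GD * (ac M GA * v) = q *o (ac M GA * (ac M GD * v)) + E (hdim M) * v - ac M GB * (ac M GC * v)"
    by (simp only: m distrib_right left_diff_distrib scl_mult_left add_diff_eq)
  show "ac M GA ^ n * v = 0" "ac M GD ^ n * v = 0" "ac M GB ^ n * v = E (hdim M) * v" "ac M GC ^ n * v = E (hdim M) * v"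
    using r by simp_all
  show "E (hdim M) * (ac M g * v) = ac M g * v" using assoc_ext[OF ac_E(1)[OF wf]] .
qed

lemma wtD: "wt M \<beta> \<gamma> v \<Longrightarrow> E (hdim M) * v = v" "wt M \<beta> \<gamma> v \<Longrightarrow> ac M GB * v = \<beta> *o v" "wt M \<beta> \<gamma> v \<Longrightarrow> ac M GC * v = \<gamma> *o v"
  by (simp_all add: wt_def)

lemma wt_a: "is_module n q M \<Longrightarrow> wt M \<beta> \<gamma> v \<Longrightarrow> wt M (\<beta> * q) (\<gamma> * q) (ac M GA * v)"
  unfolding wt_def by (simp add: rels mult.commute)

lemma wt_d: "is_module n q M \<Longrightarrow> wt M \<beta> \<gamma> v \<Longrightarrow> wt M (\<beta> / q) (\<gamma> / q) (ac M GD * v)"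
  unfolding wt_def by (simp add: rels divide_inverse mult.commute)

lemma wt_ax: "is_module n q M \<Longrightarrow> wt M \<beta> \<gamma> v \<Longrightarrow> wt M (\<beta> * q ^ x) (\<gamma> * q ^ x) (ac M GA ^ x * v)"
proof (induction x)
  case (Suc x)
  then show ?case using wt_a[of M "\<beta> * q ^ x" "\<gamma> * q ^ x" "ac M GA ^ x * v"] by (simp add: ac_simps)
qed simp

lemma wt_dx: "is_module n q M \<Longrightarrow> wt M \<beta> \<gamma> v \<Longrightarrow> wt M (\<beta> / q ^ x) (\<gamma> / q ^ x) (ac M GD ^ x * v)"
proof (induction x)
  case (Suc x)
  then show ?case using wt_d[of M "\<beta> / q ^ x" "\<gamma> / q ^ x" "ac M GD ^ x * v"] by (simp add: ac_simps)
qed simp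

text \<open>The coefficient of the lower term a^(x-1) v when \<open>d\<close> is moved past a^x,
  where \<kappa> is the eigenvalue of b c on \<open>v\<close> (see \<open>d_ax\<close>).\<close>

definition cf :: "nat \<Rightarrow> 'k \<Rightarrow> 'k" where
  "cf x \<kappa> = qint q x * (1 - q ^ x / q * \<kappa>)"

lemma cf_Suc: "cf (Suc x) \<kappa> = q * cf x \<kappa> + (1 - q ^ x * q ^ x * \<kappa>)"
proof -
  have "(1 + q * qint q x) * (1 - q ^ x * \<kappa>) - (qint q x * (q - q ^ x * \<kappa>) + (1 - q ^ x * q ^ x * \<kappa>))
    = q ^ x * \<kappa> * (qint q x * (1 - q) - (1 - q ^ x))"
    by (simp add: algebra_simps)
  also have "\<dots> = 0" unfolding qint_geom by simp
  finally have "(1 + q * qint q x) * (1 - q ^ x * \<kappa>) = qint q x * (q - q ^ x * \<kappa>) + (1 - q ^ x * q ^ x * \<kappa>)"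
    by simp
  moreover have "q * cf x \<kappa> = qint q x * (q - q ^ x * \<kappa>)" unfolding cf_def by (simp add: field_simps)
  moreover have "cf (Suc x) \<kappa> = (1 + q * qint q x) * (1 - q ^ x * \<kappa>)" unfolding cf_def qint_Suc by simp
  ultimately show ?thesis by simp
qed

lemma d_ax:
  assumes M: "is_module n q M" and v: "wt M \<beta> \<gamma> v"
  shows "ac M GD * (ac M GA ^ x * v) = q ^ x *o (ac M GA ^ x * (ac M GD * v)) + cf x (\<beta> * \<gamma>) *o (ac M GA ^ (x - 1) * v)"
proof (induction x)
  case 0
  then show ?case using wtD(1)[OF v] by (simp add: cf_def)
next
  case (Suc x)
  note w = wt_ax[OF M v, of x]
  have bc: "ac M GB * (ac M GC * (ac M GA ^ x * v)) = (q ^ x * q ^ x * (\<beta> * \<gamma>)) *o (ac M GA ^ x * v)"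
    by (simp add: wtD[OF w] algebra_simps)
  have "ac M GD * (ac M GA ^ Suc x * v) = ac M GD * (ac M GA * (ac M GA ^ x * v))" by (simp add: mult.assoc)
  also have "\<dots> = q *o (ac M GA * (ac M GD * (ac M GA ^ x * v))) + ac M GA ^ x * v
       - (q ^ x * q ^ x * (\<beta> * \<gamma>)) *o (ac M GA ^ x * v)"
    unfolding rels(6)[OF M, of "ac M GA ^ x * v"] bc wtD(1)[OF w] ..
  also have "q *o (ac M GA * (ac M GD * (ac M GA ^ x * v))) =
      q ^ Suc x *o (ac M GA ^ Suc x * (ac M GD * v)) + (q * cf x (\<beta> * \<gamma>)) *o (ac M GA ^ x * v)"
  proof (cases x)
    case 0
    then show ?thesis by (simp add: cf_def)
  next
    case (Suc y)
    then show ?thesis unfolding \<open>ac M GD * (ac M GA ^ x * v) = _\<close>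
      by (simp add: distrib_left scl_add mult.assoc mult.left_commute)
  qed
  finally show ?case unfolding cf_Suc by (simp add: scl_add_left scl_diff_left algebra_simps)
qed

subsection \<open>Submodules generated by a weight vector\<close>

text \<open>\<open>G\<close> is a parameter since the closure is taken both for the action of a
  module and, in the twisted situation, for a modified pair of operators.\<close>

inductive_set gen :: "'k lop set \<Rightarrow> 'k lop \<Rightarrow> 'k lop set" for G w where
  gen_base: "w \<in> gen G w"
| gen_mult: "g \<in> G \<Longrightarrow> u \<in> gen G w \<Longrightarrow> g * u \<in> gen G w"
| gen_add: "u \<in> gen G w \<Longrightarrow> u' \<in> gen G w \<Longrightarrow> u + u' \<in> gen G w"
| gen_scl: "u \<in> gen G w \<Longrightarrow> c *o u \<in> gen G w"

lemma gen_diff: "u \<in> gen G w \<Longrightarrow> u' \<in> gen G w \<Longrightarrow> u - u' \<in> gen G w"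
  using gen_add[OF _ gen_scl, of u G w u' "-1"] by simp

lemma gen_0: "0 \<in> gen G w" using gen_scl[OF gen_base, of 0] by simp

lemma gen_sum: "(\<And>i. i \<in> I \<Longrightarrow> f i \<in> gen G w) \<Longrightarrow> sum f I \<in> gen G w"
  by (induction I rule: infinite_finite_induct) (auto simp: gen_0 gen_add)

lemma gen_scl_iff: "c \<noteq> 0 \<Longrightarrow> c *o u \<in> gen G w \<longleftrightarrow> u \<in> gen G w"
  using gen_scl[of "c *o u" G w "inverse c"] by (auto simp: gen_scl)

abbreviation "generates T w \<equiv> \<forall>k < hdim T. un k 0 \<in> gen (range (ac T)) w"

definition uu :: "'k hmodule \<Rightarrow> 'k lop \<Rightarrow> nat \<Rightarrow> nat \<Rightarrow> 'k lop" where
  "uu M w x y = ac M GA ^ x * (ac M GD ^ y * w)"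

lemma pow_ge_n: assumes "is_module n q M" "x \<ge> n" shows "ac M GA ^ x * v = 0" "ac M GD ^ x * v = 0"
proof -
  have "ac M g ^ x * v = ac M g ^ (x - n) * (ac M g ^ n * v)" for g
    using assms(2) by (simp add: mult.assoc[symmetric] power_add[symmetric])
  then show "ac M GA ^ x * v = 0" "ac M GD ^ x * v = 0" using rels(7,8)[OF assms(1)] by simp_all
qed

lemma uu_act:
  assumes M: "is_module n q M" and v: "wt M \<beta> \<gamma> w"
  shows "ac M GA * uu M w x y = (if x + 1 < n then uu M w (x + 1) y else 0)"
    "ac M GB * uu M w x y = (\<beta> / q ^ y * q ^ x) *o uu M w x y"
    "ac M GC * uu M w x y = (\<gamma> / q ^ y * q ^ x) *o uu M w x y"
    "ac M GD * uu M w x y = q ^ x *o (if y + 1 < n then uu M w x (y + 1) else 0) +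
        cf x (\<beta> / q ^ y * (\<gamma> / q ^ y)) *o uu M w (x - 1) y"
    "E (hdim M) * uu M w x y = uu M w x y"
proof -
  note wy = wt_dx[OF M v, of y]
  note wxy = wt_ax[OF M wy, of x]
  have 1: "ac M GA * uu M w x y = uu M w (x + 1) y" by (simp add: uu_def mult.assoc)
  then show "ac M GA * uu M w x y = (if x + 1 < n then uu M w (x + 1) y else 0)"
    using pow_ge_n[OF M, of "x + 1"] by (auto simp: uu_def)
  show "ac M GB * uu M w x y = (\<beta> / q ^ y * q ^ x) *o uu M w x y"
    "ac M GC * uu M w x y = (\<gamma> / q ^ y * q ^ x) *o uu M w x y"
    "E (hdim M) * uu M w x y = uu M w x y"
    using wtD[OF wxy] by (simp_all add: uu_def)
  have 2: "ac M GD * (ac M GD ^ y * w) = (if y + 1 < n then ac M GD ^ (y + 1) * w else 0)"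
    using pow_ge_n(2)[OF M, of "y + 1" w] by (simp add: mult.assoc)
  show "ac M GD * uu M w x y = q ^ x *o (if y + 1 < n then uu M w x (y + 1) else 0) +
        cf x (\<beta> / q ^ y * (\<gamma> / q ^ y)) *o uu M w (x - 1) y"
    using d_ax[OF M wy, of x] unfolding uu_def 2
    by (cases "y + 1 < n") (simp_all only: if_True if_False mult_zero_right)
qed

definition spanu :: "'k hmodule \<Rightarrow> 'k lop \<Rightarrow> 'k lop set" where
  "spanu M w = {u. \<exists>c. u = (\<Sum>x<n. \<Sum>y<n. c x y *o uu M w x y)}"

lemma spanu_scl: "u \<in> spanu M w \<Longrightarrow> c *o u \<in> spanu M w"
proof -
  assume "u \<in> spanu M w"
  then obtain e where "u = (\<Sum>x<n. \<Sum>y<n. e x y *o uu M w x y)" by (auto simp: spanu_def)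
  then have "c *o u = (\<Sum>x<n. \<Sum>y<n. (c * e x y) *o uu M w x y)" by (simp add: scl_sum)
  then show ?thesis unfolding spanu_def by (auto intro!: exI[of _ "\<lambda>x y. c * e x y"])
qed

lemma spanu_add: "u \<in> spanu M w \<Longrightarrow> u' \<in> spanu M w \<Longrightarrow> u + u' \<in> spanu M w"
proof -
  assume "u \<in> spanu M w" "u' \<in> spanu M w"
  then obtain e e' where "u = (\<Sum>x<n. \<Sum>y<n. e x y *o uu M w x y)" "u' = (\<Sum>x<n. \<Sum>y<n. e' x y *o uu M w x y)"
    by (auto simp: spanu_def)
  then have "u + u' = (\<Sum>x<n. \<Sum>y<n. (e x y + e' x y) *o uu M w x y)" by (simp add: scl_add_left sum.distrib)
  then show ?thesis unfolding spanu_def by (auto intro!: exI[of _ "\<lambda>x y. e x y + e' x y"])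
qed

lemma spanu_0: "0 \<in> spanu M w"
  unfolding spanu_def by (auto intro!: exI[of _ "\<lambda>x y. 0"])

lemma spanu_sum: "(\<And>i. i \<in> I \<Longrightarrow> f i \<in> spanu M w) \<Longrightarrow> sum f I \<in> spanu M w"
  by (induction I rule: infinite_finite_induct) (auto simp: spanu_0 spanu_add)

lemma spanu_uu: "x < n \<Longrightarrow> y < n \<Longrightarrow> uu M w x y \<in> spanu M w"
proof -
  assume xy: "x < n" "y < n"
  have "(\<Sum>x'<n. \<Sum>y'<n. (if x' = x \<and> y' = y then 1 else 0) *o uu M w x' y') =
      (\<Sum>x'<n. \<Sum>y'<n. if x' = x \<and> y' = y then uu M w x' y' else 0)"
    by (intro sum.cong refl) auto
  also have "\<dots> = uu M w x y" using xy by (rule sum2_pick)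
  finally show ?thesis unfolding spanu_def mem_Collect_eq
    by (intro exI[of _ "\<lambda>x' y'. if x' = x \<and> y' = y then 1 else 0"]) (rule sym)
qed

text \<open>\<open>b\<close> and \<open>c\<close> act on a^x d^y w by scalars, and moving
  \<open>d\<close> past a^x costs only the lower monomial a^(x-1) d^y w; so the span is closed under
  all generators.\<close>

lemma gen_spanu:
  assumes M: "is_module n q M" and v: "wt M \<beta> \<gamma> w" and u: "u \<in> gen (range (ac M)) w"
  shows "u \<in> spanu M w"
  using u
proof induction
  case gen_base
  have "w = uu M w 0 0" by (simp add: uu_def)
  then show ?case using spanu_uu[of 0 0 M w] n0 by metis
next
  case (gen_mult g u)
  then obtain c h where c: "u = (\<Sum>x<n. \<Sum>y<n. c x y *o uu M w x y)" and g: "g = ac M h" by (auto simp: spanu_def)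
  have "ac M h * uu M w x y \<in> spanu M w" if "x < n" "y < n" for x y
    using that by (cases h) (auto simp: uu_act[OF M v] intro!: spanu_scl spanu_add spanu_uu spanu_0)
  then show ?case unfolding c g sum_distrib_left scl_mult_right by (intro spanu_sum spanu_scl) auto
qed (auto intro: spanu_add spanu_scl)

lemma hom_gen_eq:
  assumes "F \<in> hom T X" "G \<in> hom T X" "F * w = G * w" "u \<in> gen (range (ac T)) w"
  shows "F * u = G * u"
  using assms(4)
proof induction
  case (gen_mult g u)
  then obtain h where "g = ac T h" by auto
  then show ?case using gen_mult assoc_ext[OF homD(3)[OF assms(1)], of h u] assoc_ext[OF homD(3)[OF assms(2)], of h u]
    by (simp add: mult.assoc)
qed (auto simp: assms distrib_left)

lemma hom_eqI:
  assumes "F \<in> hom T X" "G \<in> hom T X" "F * w = G * w" "generates T w"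
  shows "F = G"
proof -
  have e: "F * E (hdim T) = (\<Sum>k<hdim T. F * un k 0 * un 0 k)" for F :: "'k lop"
    unfolding E_sum sum_distrib_left by (intro sum.cong refl) (simp add: mult.assoc)
  have "F * E (hdim T) = G * E (hdim T)"
    unfolding e using hom_gen_eq[OF assms(1-3)] assms(4) by (intro sum.cong refl) simp
  then show ?thesis using homD(2)[OF assms(1)] homD(2)[OF assms(2)] by simp
qed

text \<open>Column number x n + y is a^x d^y w: the candidate change of basis from k^(n^2) to the
  module.\<close>

definition bas :: "'k hmodule \<Rightarrow> 'k lop \<Rightarrow> 'k lop" where
  "bas M w = (\<Sum>x<n. \<Sum>y<n. uu M w x y * un 0 (x * n + y))"

lemma pair_less: "x < n \<Longrightarrow> y < n \<Longrightarrow> x * n + y < n * n"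
proof -
  assume "x < n" "y < n"
  then have "x * n + y < Suc x * n" by simp
  also have "\<dots> \<le> n * n" using \<open>x < n\<close> by (intro mult_le_mono1) simp
  finally show ?thesis .
qed

lemma pair_eq: "y < n \<Longrightarrow> y' < n \<Longrightarrow> x * n + y = x' * n + y' \<longleftrightarrow> x = x' \<and> y = y'"
proof
  assume y: "y < n" "y' < n" and "x * n + y = x' * n + y'"
  then have "(x * n + y) div n = (x' * n + y') div n" "(x * n + y) mod n = (x' * n + y') mod n" by auto
  then show "x = x' \<and> y = y'" using y by simp
qed auto

lemma bas_un:
  assumes "w * un 0 0 = w" "x < n" "y < n"
  shows "bas M w * un (x * n + y) 0 = uu M w x y"
proof -
  have w: "uu M w x' y' * un 0 0 = uu M w x' y'" for x' y' by (simp add: uu_def mult.assoc assms(1))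
  have "bas M w * un (x * n + y) 0 = (\<Sum>x'<n. \<Sum>y'<n. uu M w x' y' * (un 0 (x' * n + y') * un (x * n + y) 0))"
    unfolding bas_def sum_distrib_right mult.assoc ..
  also have "\<dots> = (\<Sum>x'<n. \<Sum>y'<n. if x' = x \<and> y' = y then uu M w x' y' else 0)"
    using assms(2,3) by (intro sum.cong refl) (auto simp: pair_eq w)
  also have "\<dots> = uu M w x y" using assms(2,3) by (rule sum2_pick)
  finally show ?thesis .
qed

text \<open>By \<open>uu_act\<close> the generators act on a^x d^y w with constants that depend on
  the weight alone. Sending this basis to the corresponding vectors of \<open>X\<close> therefore
  respects the action, even where the latter are dependent or zero.\<close>

theorem free_hom:
  assumes T: "is_module n q T" "wt T \<beta> \<gamma> w" "w * un 0 0 = w" "generates T w" "hdim T = n * n"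
    and X: "is_module n q X" "wt X \<beta> \<gamma> x" "x * un 0 0 = x"
  shows "\<exists>K \<in> hom T X. K * w = x"
proof -
  let ?B = "bas T w"
  have BE: "?B * E (n * n) = ?B"
    unfolding bas_def sum_distrib_right by (intro sum.cong refl) (simp add: mult.assoc pair_less)
  have e: "E (n * n) * uu T w i j = uu T w i j" for i j using uu_act(5)[OF T(1,2), of i j] unfolding T(5) .
  have EB: "E (n * n) * ?B = ?B"
    unfolding bas_def sum_distrib_left by (simp only: assoc_ext[OF e])
  have "\<exists>c. \<forall>k<n*n. un k 0 = (\<Sum>x<n. \<Sum>y<n. c k x y *o uu T w x y)"
  proof (rule choice_iff'[THEN iffD1], intro allI impI)
    fix k assume "k < n * n"
    then have "un k 0 \<in> spanu T w" using gen_spanu[OF T(1,2)] T(4,5) by simp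
    then show "\<exists>c. un k 0 = (\<Sum>x<n. \<Sum>y<n. c x y *o uu T w x y)" unfolding spanu_def by simp
  qed
  then obtain c where c: "\<And>k. k < n * n \<Longrightarrow> un k 0 = (\<Sum>x<n. \<Sum>y<n. c k x y *o uu T w x y)" by blast
  \<comment> \<open>A right inverse of \<open>?B\<close>: it writes each standard basis vector
    through the spanning family.\<close>
  define S0 where "S0 = (\<Sum>k<n*n. (\<Sum>x<n. \<Sum>y<n. c k x y *o un (x * n + y) 0) * un 0 k)"
  have "?B * S0 = (\<Sum>k<n*n. (\<Sum>x<n. \<Sum>y<n. c k x y *o (?B * un (x * n + y) 0)) * un 0 k)"
    unfolding S0_def by (simp add: sum_distrib_left mult.assoc[symmetric])
  also have "\<dots> = (\<Sum>k<n*n. un k 0 * un 0 k)"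
  proof (intro sum.cong refl)
    fix k assume k: "k \<in> {..<n*n}"
    have "(\<Sum>x<n. \<Sum>y<n. c k x y *o (?B * un (x * n + y) 0)) = (\<Sum>x<n. \<Sum>y<n. c k x y *o uu T w x y)"
      by (intro sum.cong refl) (simp add: bas_un[OF T(3)])
    then show "(\<Sum>x<n. \<Sum>y<n. c k x y *o (?B * un (x * n + y) 0)) * un 0 k = un k 0 * un 0 k"
      using c[of k] k by (simp only: lessThan_iff)
  qed
  also have "\<dots> = E (n * n)" by (simp add: E_sum)
  finally have BS0: "?B * S0 = E (n * n)" .
  define S where "S = E (n * n) * S0 * E (n * n)"
  have SB: "S * ?B = E (n * n)" and BS: "?B * S = E (n * n)"
    unfolding S_def using left_right_inverse[OF BE EB BS0] by (simp_all only:)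
  \<comment> \<open>Coordinates are taken in \<open>T\<close> and recombined in
    \<open>X\<close>.\<close>
  define K where "K = bas X x * S"
  have K: "K * uu T w i j = uu X x i j" if "i < n" "j < n" for i j
  proof -
    have "K * uu T w i j = bas X x * (S * ?B) * un (i * n + j) 0"
      unfolding K_def bas_un[OF T(3) that, symmetric] by (simp only: mult.assoc)
    also have "\<dots> = bas X x * un (i * n + j) 0" unfolding SB using pair_less[OF that] by (simp add: mult.assoc)
    finally show ?thesis unfolding bas_un[OF X(3) that] .
  qed
  have Kg: "K * (ac T g * uu T w i j) = ac X g * uu X x i j" if "i < n" "j < n" for i j g
    using that by (cases g) (simp_all add: uu_act[OF T(1,2)] uu_act[OF X(1,2)] K distrib_left)
  have "K * w = x" using K[of 0 0] by (simp add: uu_def)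
  moreover have "K \<in> hom T X"
  proof (rule homI)
    show "E (hdim X) * K = K"
      unfolding K_def bas_def sum_distrib_left sum_distrib_right
      by (simp only: mult.assoc assoc_ext[OF uu_act(5)[OF X(1,2)]])
    show KE: "K * E (hdim T) = K" unfolding K_def S_def T(5) by (simp add: mult.assoc)
    fix g
    have aE: "ac T g * E (n * n) = ac T g" using ac_E(2)[OF is_module_wf[OF T(1)], of g] T(5) by simp
    have "K * ac T g = K * ac T g * (?B * S)" unfolding BS by (simp only: mult.assoc aE)
    also have "\<dots> = (K * ac T g * ?B) * S" by (simp only: mult.assoc)
    also have "K * ac T g * ?B = (\<Sum>i<n. \<Sum>j<n. K * (ac T g * uu T w i j) * un 0 (i * n + j))"
      unfolding bas_def sum_distrib_left by (simp only: mult.assoc)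
    also have "\<dots> = (\<Sum>i<n. \<Sum>j<n. ac X g * uu X x i j * un 0 (i * n + j))"
      by (intro sum.cong refl) (simp add: Kg)
    also have "\<dots> = ac X g * bas X x" unfolding bas_def sum_distrib_left by (simp only: mult.assoc)
    finally show "K * ac T g = ac X g * K" unfolding K_def by (simp only: mult.assoc)
  qed
  ultimately show ?thesis by blast
qed

section \<open>Weight projections and lifting of weight vectors\<close>

lemma proj_weight:
  fixes b x :: "'k lop"
  assumes "b ^ n * x = x" "\<beta> ^ n = 1"
  defines "p \<equiv> inverse (of_nat n) *o (\<Sum>i<n. inverse \<beta> ^ i *o (b ^ i * x))"
  shows "b * p = \<beta> *o p"
proof -
  have b0: "\<beta> \<noteq> 0" using assms(2) n0 by (auto simp: zero_power)
  then have bc: "\<beta> * (inverse \<beta> * t) = t" for t by (simp add: mult.assoc[symmetric])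
  let ?f = "\<lambda>i. inverse \<beta> ^ i *o (b ^ i * x)"
  have "b * (\<Sum>i<n. ?f i) = (\<Sum>i<n. \<beta> *o ?f (Suc i))"
    unfolding sum_distrib_left by (intro sum.cong refl) (simp add: mult.assoc bc)
  also have "\<dots> = \<beta> *o (\<Sum>i<n. ?f (Suc i))" by (simp only: scl_sum)
  also have "(\<Sum>i<n. ?f (Suc i)) = (\<Sum>i<n. ?f i)"
  proof -
    have "(\<Sum>i<Suc n. ?f i) = ?f 0 + (\<Sum>i<n. ?f (Suc i))" by (rule sum.lessThan_Suc_shift)
    moreover have "(\<Sum>i<Suc n. ?f i) = (\<Sum>i<n. ?f i) + ?f n" by simp
    moreover have "?f n = ?f 0" using assms(1,2) by (simp add: power_inverse)
    ultimately show ?thesis by (simp add: add.commute)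
  qed
  finally show ?thesis unfolding p_def by (simp add: mult.commute)
qed

text \<open>\<open>b\<close> and \<open>c\<close> act semisimply because n is invertible in k. Any
  linear preimage of \<open>y\<close> is averaged over \<open>b\<close> and then over
  \<open>c\<close>; the second average keeps the first eigenvalue since \<open>b\<close> and
  \<open>c\<close> commute, and \<open>F\<close> commutes with the averaging, which fixes
  \<open>y\<close>.\<close>

lemma lift_weight:
  assumes m: "is_module n q X" "is_module n q Y" and F: "F \<in> hom X Y" "epi (hdim Y) F"
    and y: "wt Y \<beta> \<gamma> y" "y * un 0 0 = y" and r: "\<beta> ^ n = 1" "\<gamma> ^ n = 1"
  shows "\<exists>x. wt X \<beta> \<gamma> x \<and> x * un 0 0 = x \<and> F * x = y"
proof -
  have b0: "\<beta> \<noteq> 0" "\<gamma> \<noteq> 0" using r n0 by (auto simp: zero_power)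
  obtain S where S: "F * S = E (hdim Y)" using F(2) by (auto simp: epi_def)
  let ?b = "ac X GB" and ?c = "ac X GC"
  define x0 where "x0 = E (hdim X) * (S * y)"
  have x0: "E (hdim X) * x0 = x0" "x0 * un 0 0 = x0" "F * x0 = y"
  proof -
    show "E (hdim X) * x0 = x0" unfolding x0_def using assoc_ext[OF E_idem] .
    show "x0 * un 0 0 = x0" unfolding x0_def by (simp add: mult.assoc y(2))
    show "F * x0 = y" unfolding x0_def assoc_ext[OF homD(2)[OF F(1)]] assoc_ext[OF S] by (rule wtD(1)[OF y(1)])
  qed
  define x1 where "x1 = inverse (of_nat n) *o (\<Sum>i<n. inverse \<beta> ^ i *o (?b ^ i * x0))"
  define x2 where "x2 = inverse (of_nat n) *o (\<Sum>i<n. inverse \<gamma> ^ i *o (?c ^ i * x1))"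
  have Eb: "E (hdim X) * (ac X g ^ i * v) = ac X g ^ i * v" if "E (hdim X) * v = v" for g i v
    using that rels(11)[OF m(1)] by (cases i) (simp_all add: mult.assoc)
  have b1: "?b * x1 = \<beta> *o x1" unfolding x1_def
    using rels(9)[OF m(1), of x0] x0(1) r(1) by (intro proj_weight) simp_all
  have E1: "E (hdim X) * x1 = x1" unfolding x1_def by (simp add: sum_distrib_left Eb x0)
  have c2: "?c * x2 = \<gamma> *o x2" unfolding x2_def
    using rels(10)[OF m(1), of x1] E1 r(2) by (intro proj_weight) simp_all
  have E2: "E (hdim X) * x2 = x2" unfolding x2_def by (simp add: sum_distrib_left Eb E1)
  have bc: "?b * (?c ^ i * x1) = \<beta> *o (?c ^ i * x1)" for i
    by (induction i) (simp_all add: b1 mult.assoc rels(5)[OF m(1)])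
  have b2: "?b * x2 = \<beta> *o x2" unfolding x2_def by (simp add: sum_distrib_left bc scl_sum ac_simps)
  have u: "x2 * un 0 0 = x2" unfolding x2_def x1_def by (simp add: sum_distrib_right mult.assoc x0)
  have hx: "F * (ac X g ^ i * v) = ac Y g ^ i * (F * v)" for g i v
    using hom_pow[OF F(1), of g i] by (simp only: mult.assoc[symmetric])
  have yp: "ac Y GB ^ i * y = \<beta> ^ i *o y" "ac Y GC ^ i * y = \<gamma> ^ i *o y" for i
    by (induction i) (simp_all add: mult.assoc wtD[OF y(1)] mult.commute)
  have s: "inverse (of_nat n) *o (\<Sum>i<n. inverse \<delta> ^ i *o (\<delta> ^ i *o y)) = y" if "\<delta> \<noteq> 0" for \<delta> :: 'k
  proof -
    have "inverse \<delta> ^ i *o (\<delta> ^ i *o y) = 1 *o y" for i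
      using that by (simp add: power_mult_distrib[symmetric])
    then have "(\<Sum>i<n. inverse \<delta> ^ i *o (\<delta> ^ i *o y)) = of_nat n *o y"
      using scl_sum_left[of "\<lambda>_. 1" "{..<n}" y] by (simp only: sum_constant card_lessThan mult_1_right)
    then show ?thesis by simp
  qed
  have "F * x1 = inverse (of_nat n) *o (\<Sum>i<n. inverse \<beta> ^ i *o (\<beta> ^ i *o y))"
    unfolding x1_def scl_mult_right sum_distrib_left hx x0(3) yp ..
  then have Fx1: "F * x1 = y" using s[OF b0(1)] by simp
  have "F * x2 = inverse (of_nat n) *o (\<Sum>i<n. inverse \<gamma> ^ i *o (\<gamma> ^ i *o y))"
    unfolding x2_def scl_mult_right sum_distrib_left hx Fx1 yp ..
  then have "F * x2 = y" using s[OF b0(2)] by simp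
  then show ?thesis using b2 c2 E2 u unfolding wt_def by blast
qed

subsection \<open>Endomorphisms of a module with a free weight vector\<close>

inductive_set polys :: "'k lop \<Rightarrow> 'k lop set" for z where
  polys_1: "1 \<in> polys z"
| polys_mult: "p \<in> polys z \<Longrightarrow> z * p \<in> polys z"
| polys_add: "p \<in> polys z \<Longrightarrow> p' \<in> polys z \<Longrightarrow> p + p' \<in> polys z"
| polys_scl: "p \<in> polys z \<Longrightarrow> c *o p \<in> polys z"

lemma polys_0: "0 \<in> polys z" using polys_scl[OF polys_1, of 0] by simp

lemma polys_sum: "(\<And>i. i \<in> I \<Longrightarrow> f i \<in> polys z) \<Longrightarrow> sum f I \<in> polys z"
  by (induction I rule: infinite_finite_induct) (auto simp: polys_0 polys_add)

lemma polys_z: "z \<in> polys z" using polys_mult[OF polys_1, of z] by simp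

lemma polys_comm_gen: "p \<in> polys z \<Longrightarrow> F * z = z * F \<Longrightarrow> F * p = p * F"
proof (induction rule: polys.induct)
  case (polys_mult p)
  have "F * (z * p) = z * (F * p)" by (simp only: mult.assoc[symmetric] polys_mult.prems)
  then show ?case using polys_mult by (simp add: mult.assoc)
qed (simp_all add: distrib_left distrib_right)

lemma polys_comm: "p \<in> polys z \<Longrightarrow> p' \<in> polys z \<Longrightarrow> p * p' = p' * p"
  using polys_comm_gen[of p' z p] polys_comm_gen[of p z z] by simp

lemma polys_times: "p \<in> polys z \<Longrightarrow> p' \<in> polys z \<Longrightarrow> p * p' \<in> polys z"
  by (induction rule: polys.induct) (auto simp: mult.assoc distrib_right intro: polys.intros)

lemma polys_transfer: "p \<in> polys z \<Longrightarrow> F * z = z' * F \<Longrightarrow> \<exists>p' \<in> polys z'. F * p = p' * F"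
proof (induction rule: polys.induct)
  case polys_1
  then show ?case by (intro bexI[of _ 1]) (auto intro: polys.intros)
next
  case (polys_mult p)
  then obtain p' where p': "p' \<in> polys z'" "F * p = p' * F" by auto
  have "F * (z * p) = z' * (F * p)" by (simp only: mult.assoc[symmetric] polys_mult.prems)
  then have "F * (z * p) = (z' * p') * F" by (simp add: p' mult.assoc)
  then show ?case using p' polys.polys_mult by blast
next
  case (polys_add p r)
  then obtain p' r' where p': "p' \<in> polys z'" "F * p = p' * F" "r' \<in> polys z'" "F * r = r' * F" by auto
  then have "F * (p + r) = (p' + r') * F" by (simp add: distrib_left distrib_right)
  then show ?case using p' polys.polys_add by blast
next
  case (polys_scl p c)
  then obtain p' where p': "p' \<in> polys z'" "F * p = p' * F" by auto
  then have "F * (c *o p) = (c *o p') * F" by simp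
  then show ?case using p' polys.polys_scl by blast
qed

lemma polys_division: "p \<in> polys z \<Longrightarrow> \<exists>c. \<exists>r \<in> polys z. p = c *o 1 + (z - s *o 1) * r"
proof (induction rule: polys.induct)
  case polys_1
  then show ?case by (intro exI[of _ 1] bexI[OF _ polys_0]) simp
next
  case (polys_mult p)
  then obtain c r where r: "r \<in> polys z" "p = c *o 1 + (z - s *o 1) * r" by auto
  have "z * (z - s *o 1) = (z - s *o 1) * z" by (simp add: algebra_simps)
  then have "z * ((z - s *o 1) * r) = (z - s *o 1) * (z * r)" by (metis mult.assoc)
  then have "z * p = (c * s) *o 1 + (z - s *o 1) * (c *o 1 + z * r)"
    unfolding r(2) by (simp add: algebra_simps scl_diff)
  then show ?case using r(1) by (meson polys.intros)
next
  case (polys_add p p')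
  then obtain c r c' r' where r: "r \<in> polys z" "p = c *o 1 + (z - s *o 1) * r"
    "r' \<in> polys z" "p' = c' *o 1 + (z - s *o 1) * r'" by auto
  have "p + p' = (c + c') *o 1 + (z - s *o 1) * (r + r')"
    unfolding r(2,4) by (simp only: distrib_left scl_add_left ac_simps)
  then show ?case using r by (meson polys.intros)
next
  case (polys_scl p e)
  then obtain c r where r: "r \<in> polys z" "p = c *o 1 + (z - s *o 1) * r" by auto
  have "e *o p = (e * c) *o 1 + (z - s *o 1) * (e *o r)"
    unfolding r(2) by (simp add: algebra_simps scl_add scl_diff)
  then show ?case using r by (meson polys.intros)
qed

text \<open>The eigenvalue of a d attached to position x: by \<open>z_uu\<close>, a d - ev x carries
  a^x d^x w to a multiple of the next such vector, so the product of these factors over all x < n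
  annihilates \<open>w\<close>.\<close>

definition ev :: "'k \<Rightarrow> nat \<Rightarrow> 'k" where
  "ev \<kappa> x = qint q x * (1 - \<kappa> / (q * q ^ x))"

lemma z_uu:
  assumes T: "is_module n q T" "wt T \<beta> \<gamma> w"
  shows "(ac T GA * ac T GD - ev (\<beta> * \<gamma>) x *o 1) * uu T w x x = q ^ x *o uu T w (Suc x) (Suc x)"
proof -
  note wx = wt_dx[OF T, of x]
  have s: "cf x (\<beta> / q ^ x * (\<gamma> / q ^ x)) = ev (\<beta> * \<gamma>) x"
    unfolding cf_def ev_def by (simp add: field_simps)
  have "ac T GA * ac T GA ^ (x - 1) = ac T GA ^ x" if "x \<noteq> 0" using that by (cases x) auto
  moreover have "ev (\<beta> * \<gamma>) x = 0" if "x = 0" using that by (simp add: ev_def)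
  ultimately have "ev (\<beta> * \<gamma>) x *o (ac T GA * (ac T GA ^ (x - 1) * u)) = ev (\<beta> * \<gamma>) x *o (ac T GA ^ x * u)" for u
    by (cases "x = 0") (simp_all add: mult.assoc[symmetric])
  moreover have "(ac T GA * ac T GD) * uu T w x x = ac T GA * (ac T GD * (ac T GA ^ x * (ac T GD ^ x * w)))"
    by (simp add: uu_def mult.assoc)
  ultimately have "(ac T GA * ac T GD) * uu T w x x = q ^ x *o uu T w (Suc x) (Suc x) + ev (\<beta> * \<gamma>) x *o uu T w x x"
    unfolding d_ax[OF T(1) wx] s by (simp add: uu_def distrib_left mult.assoc)
  then show ?thesis by (simp add: left_diff_distrib)
qed

text \<open>Relative to \<open>w\<close>, \<open>b\<close> acts on a^x d^y w by the factor q^(x-y).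
  Averaging over \<open>b\<close> thus leaves only the terms with x = y in an expansion of
  \<open>v\<close>, and these are polynomials in a d applied to \<open>w\<close> by induction along
  \<open>z_uu\<close>.\<close>

lemma wt_polys:
  assumes T: "is_module n q T" "wt T \<beta> \<gamma> w" "generates T w"
    and v: "wt T \<beta> \<gamma> v" "v * un 0 0 = v" and b: "\<beta> ^ n = 1"
  shows "\<exists>p \<in> polys (ac T GA * ac T GD). v = p * w"
proof -
  have b0: "\<beta> \<noteq> 0" using b n0 by (auto simp: zero_power)
  let ?z = "ac T GA * ac T GD"
  have diag: "\<exists>p \<in> polys ?z. uu T w x x = p * w" for x
  proof (induction x)
    case 0
    then show ?case by (intro bexI[OF _ polys_1]) (simp add: uu_def)
  next
    case (Suc x)
    then obtain p where p: "p \<in> polys ?z" "uu T w x x = p * w" by blast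
    define s where "s = ev (\<beta> * \<gamma>) x"
    have "q ^ x *o uu T w (Suc x) (Suc x) = (?z * p + (- s) *o p) * w"
      unfolding z_uu[OF T(1,2), symmetric] s_def[symmetric] p(2) by (simp add: algebra_simps)
    then have "inverse (q ^ x) *o q ^ x *o uu T w (Suc x) (Suc x) = inverse (q ^ x) *o ((?z * p + (- s) *o p) * w)"
      by simp
    then have "uu T w (Suc x) (Suc x) = (inverse (q ^ x) *o (?z * p + (- s) *o p)) * w" by simp
    moreover have "inverse (q ^ x) *o (?z * p + (- s) *o p) \<in> polys ?z"
      using p(1) by (intro polys_scl polys_add polys_mult)
    ultimately show ?case by blast
  qed
  have "v \<in> spanu T w"
  proof -
    have "v = (\<Sum>k<hdim T. entry v k 0 *o un k 0)"
    proof -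
      have "v = E (hdim T) * v * E 1"
        using wtD(1)[OF v(1)] v(2) E_sum[of "Suc 0", where 'a='k] by simp
      then have "v = (\<Sum>i<hdim T. \<Sum>j<1. entry v i j *o un i j)" unfolding sandwich_expand .
      then show ?thesis by simp
    qed
    also have "\<dots> \<in> spanu T w"
      using gen_spanu[OF T(1,2)] T(3) by (intro spanu_sum spanu_scl) auto
    finally show ?thesis .
  qed
  then obtain c where c: "v = (\<Sum>x<n. \<Sum>y<n. c x y *o uu T w x y)" by (auto simp: spanu_def)
  let ?pr = "\<lambda>u. inverse (of_nat n) *o (\<Sum>i<n. inverse \<beta> ^ i *o (ac T GB ^ i * u))"
  have prs: "?pr (\<Sum>i\<in>I. f i) = (\<Sum>i\<in>I. ?pr (f i))" for f :: "nat \<Rightarrow> 'k lop" and I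
    by (simp only: sum_distrib_left scl_sum sum.swap[of _ "{..<n}"])
  have prc: "?pr (e *o u) = e *o ?pr u" for e u
    by (simp add: scl_sum ac_simps)
  have pre: "?pr u = (if \<rho> = 1 then u else 0)" if "ac T GB * u = (\<beta> * \<rho>) *o u" "\<rho> ^ n = 1" for u \<rho>
  proof -
    define t where "t = \<beta> * \<rho>"
    have "ac T GB ^ i * u = t ^ i *o u" for i
      by (induction i) (simp_all add: mult.assoc that(1)[folded t_def] mult.commute)
    then have "ac T GB ^ i * u = (\<beta> * \<rho>) ^ i *o u" for i by (simp only: t_def)
    moreover have "inverse \<beta> ^ i * (\<beta> * \<rho>) ^ i = \<rho> ^ i" for i
      using b0 by (simp add: power_mult_distrib power_inverse field_simps)
    ultimately have "inverse \<beta> ^ i *o (ac T GB ^ i * u) = \<rho> ^ i *o u" for i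
      by (simp only: scl_scl)
    then have "?pr u = inverse (of_nat n) *o (\<Sum>i<n. \<rho> ^ i) *o u" by (simp only: scl_sum_left)
    then show ?thesis using root_sum[OF that(2)] by auto
  qed
  have "v = ?pr v" using pre[of v 1] wtD(2)[OF v(1)] by simp
  also have "\<dots> = (\<Sum>x<n. \<Sum>y<n. c x y *o ?pr (uu T w x y))"
    unfolding c prs prc ..
  also have "\<dots> = (\<Sum>x<n. \<Sum>y<n. if y = x then c x y *o uu T w x y else 0)"
  proof (intro sum.cong refl)
    fix x y assume xy: "x \<in> {..<n}" "y \<in> {..<n}"
    have 1: "ac T GB * uu T w x y = (\<beta> * (q ^ x / q ^ y)) *o uu T w x y"
      using uu_act(2)[OF T(1,2)] by simp
    have 2: "(q ^ x / q ^ y) ^ n = 1"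
      unfolding power_divide power_mult[symmetric] using q_pow_eq_1[of "x * n"] q_pow_eq_1[of "y * n"] by simp
    have "q ^ x / q ^ y = 1 \<longleftrightarrow> y = x"
    proof -
      have "q ^ x / q ^ y = q powi (int x - int y)" by (simp add: power_int_diff)
      moreover have "int n dvd int x - int y \<longleftrightarrow> y = x"
        using xy unfolding mod_eq_dvd_iff[symmetric] by (auto simp: zmod_int[symmetric])
      ultimately show ?thesis using q_powi_eq_1 by simp
    qed
    then show "c x y *o ?pr (uu T w x y) = (if y = x then c x y *o uu T w x y else 0)"
      using pre[OF 1 2] by simp
  qed
  also have "\<dots> = (\<Sum>x<n. c x x *o uu T w x x)" by (intro sum.cong refl) simp
  finally have v': "v = (\<Sum>x<n. c x x *o uu T w x x)" .
  have "\<exists>p. \<forall>x. p x \<in> polys ?z \<and> uu T w x x = p x * w"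
    by (rule choice) (use diag in blast)
  then obtain p where p: "\<And>x. p x \<in> polys ?z" "\<And>x. uu T w x x = p x * w" by blast
  have "v = (\<Sum>x<n. c x x *o p x) * w" unfolding v' sum_distrib_right by (simp add: p(2))
  moreover have "(\<Sum>x<n. c x x *o p x) \<in> polys ?z" using p by (intro polys_sum polys_scl) auto
  ultimately show ?thesis by blast
qed

text \<open>\<open>R i\<close> sends \<open>w\<close> to \<open>v i\<close>, and each cover splits
  off \<open>T\<close> through it by an idempotent \<open>e i\<close>. As endomorphisms of
  \<open>T\<close> commute, orthogonality and completeness of these idempotents both reduce to one
  fact (\<open>kill\<close>): an idempotent annihilated by all \<open>R j\<close> is zero.\<close>

theorem free_decomposition:
  fixes P V :: "nat \<Rightarrow> 'k hmodule"
  assumes T: "is_module n q T" "wt T \<beta> \<gamma> w" "w * un 0 0 = w" "generates T w" "hdim T = n * n"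
    and r: "\<beta> ^ n = 1" "\<gamma> ^ n = 1"
    and P: "\<And>i. i < k \<Longrightarrow> cover n q (P i) (V i) (\<pi> i)" "\<And>i. i < k \<Longrightarrow> simp_mod n q (V i)"
    and v: "\<And>i. i < k \<Longrightarrow> wt (V i) \<beta> \<gamma> (v i)" "\<And>i. i < k \<Longrightarrow> v i * un 0 0 = v i" "\<And>i. i < k \<Longrightarrow> v i \<noteq> 0"
      "\<And>i. i < k \<Longrightarrow> ac (V i) GA * ac (V i) GD * v i = \<sigma> i *o v i"
    and inj: "\<And>i j. i < k \<Longrightarrow> j < k \<Longrightarrow> i \<noteq> j \<Longrightarrow> \<sigma> i \<noteq> \<sigma> j"
    and cov: "\<And>x. x < n \<Longrightarrow> \<exists>i<k. ev (\<beta> * \<gamma>) x = \<sigma> i"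
  shows "mod_iso n q T (module_sum (map P [0..<k]))"
proof -
  define z where "z = ac T GA * ac T GD"
  have mP: "is_module n q (P i)" "is_module n q (V i)" "\<pi> i \<in> hom (P i) (V i)" "epi (hdim (V i)) (\<pi> i)" if "i < k" for i
    using P(1)[OF that] by (auto simp: cover_def projm_def)
  have "\<exists>R. \<forall>i. i < k \<longrightarrow> R i \<in> hom T (V i) \<and> R i * w = v i"
  proof (rule choice_iff'[THEN iffD1], intro allI impI)
    fix i assume i: "i < k"
    from free_hom[OF T mP(2)[OF i] v(1,2)[OF i]] show "\<exists>y. y \<in> hom T (V i) \<and> y * w = v i" by blast
  qed
  then obtain R where R: "\<And>i. i < k \<Longrightarrow> R i \<in> hom T (V i)" "\<And>i. i < k \<Longrightarrow> R i * w = v i" by blast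
  have pi0: "\<pi> i \<noteq> 0" if "i < k" for i
  proof
    assume "\<pi> i = 0"
    with mP(4)[OF that] have "E (hdim (V i)) = (0 :: 'k lop)" unfolding epi_def by auto
    then show False using wtD(1)[OF v(1)[OF that]] v(3)[OF that] by simp
  qed
  \<comment> \<open>\<open>Q\<close> is determined by a lift of \<open>v i\<close> to the cover, and
    \<open>p0\<close> lifts \<open>\<pi> i\<close> along \<open>R i\<close>. Composing Q p0 with
    \<open>\<pi> i\<close> gives \<open>\<pi> i\<close> back, so Q p0 is invertible, and correcting
    \<open>p0\<close> by its inverse gives the splitting.\<close>
  have "\<exists>p Q. p \<in> hom (P i) T \<and> Q \<in> hom T (P i) \<and> Q * p = E (hdim (P i)) \<and> \<pi> i * Q = R i \<and> R i * p = \<pi> i"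
    if i: "i < k" for i
  proof -
    obtain x where x: "wt (P i) \<beta> \<gamma> x" "x * un 0 0 = x" "\<pi> i * x = v i"
      using lift_weight[OF mP(1,2,3,4)[OF i] v(1,2)[OF i] r] by blast
    obtain Q where Q: "Q \<in> hom T (P i)" "Q * w = x" using free_hom[OF T mP(1)[OF i] x(1,2)] by blast
    have piQ: "\<pi> i * Q = R i"
      by (rule hom_eqI[OF hom_comp[OF Q(1) mP(3)[OF i]] R(1)[OF i] _ T(4)]) (simp add: mult.assoc Q(2) x(3) R(2)[OF i])
    have "R i \<noteq> 0" using R(2)[OF i] v(3)[OF i] by auto
    then have "epi (hdim (V i)) (R i)" using P(2)[OF i] T(1) R(1)[OF i] unfolding simp_mod_def by blast
    then obtain p0 where p0: "p0 \<in> hom (P i) T" "R i * p0 = \<pi> i"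
      using P(1)[OF i] T(1) mP(2,3)[OF i] R(1)[OF i] unfolding cover_def projm_def by blast
    have u: "\<pi> i * (Q * p0) = \<pi> i" unfolding mult.assoc[symmetric] piQ p0(2) ..
    then obtain s where s: "s \<in> hom (P i) (P i)" "Q * p0 * s = E (hdim (P i))"
      using cover_endo[OF P(1,2)[OF i] hom_comp[OF p0(1) Q(1)]] pi0[OF i] by auto
    have "R i * (p0 * s) = \<pi> i * (Q * p0 * s)" by (simp only: mult.assoc[symmetric] p0(2) piQ)
    also have "\<dots> = \<pi> i" unfolding s(2) by (rule homD(2)[OF mP(3)[OF i]])
    finally have "R i * (p0 * s) = \<pi> i" .
    then show ?thesis using hom_comp[OF s(1) p0(1)] Q(1) s(2) piQ by (metis mult.assoc)
  qed
  then have "\<exists>p. \<forall>i. i < k \<longrightarrow> (\<exists>Q. p i \<in> hom (P i) T \<and> Q \<in> hom T (P i) \<and> Q * p i = E (hdim (P i)) \<and> \<pi> i * Q = R i \<and> R i * p i = \<pi> i)"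
    by (subst choice_iff'[symmetric]) blast
  then obtain p where "\<And>i. i < k \<Longrightarrow> (\<exists>Q. p i \<in> hom (P i) T \<and> Q \<in> hom T (P i) \<and> Q * p i = E (hdim (P i)) \<and> \<pi> i * Q = R i \<and> R i * p i = \<pi> i)"
    by blast
  then have "\<exists>Q. \<forall>i. i < k \<longrightarrow> p i \<in> hom (P i) T \<and> Q i \<in> hom T (P i) \<and> Q i * p i = E (hdim (P i)) \<and> \<pi> i * Q i = R i \<and> R i * p i = \<pi> i"
    by (subst choice_iff'[symmetric]) blast
  then obtain Q where p: "\<And>i. i < k \<Longrightarrow> p i \<in> hom (P i) T" and Q: "\<And>i. i < k \<Longrightarrow> Q i \<in> hom T (P i)"
    and Qp: "\<And>i. i < k \<Longrightarrow> Q i * p i = E (hdim (P i))" and piQ: "\<And>i. i < k \<Longrightarrow> \<pi> i * Q i = R i"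
    and Rp: "\<And>i. i < k \<Longrightarrow> R i * p i = \<pi> i" by blast
  define e where "e i = p i * Q i" for i
  have eh: "e i \<in> hom T T" if "i < k" for i unfolding e_def using hom_comp[OF Q[OF that] p[OF that]] .
  have ee: "e i * e i = e i" if "i < k" for i
  proof -
    have "e i * e i = p i * (Q i * p i) * Q i" unfolding e_def by (simp only: mult.assoc)
    then show ?thesis unfolding Qp[OF that] homD(2)[OF p[OF that]] e_def .
  qed
  have hz: "F * z = ac X GA * ac X GD * F" if "F \<in> hom T X" for F X
  proof -
    have "F * z = F * ac T GA * ac T GD" unfolding z_def by (simp only: mult.assoc)
    also have "\<dots> = ac X GA * F * ac T GD" by (simp only: homD(3)[OF that])
    also have "\<dots> = ac X GA * (F * ac T GD)" by (rule mult.assoc)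
    also have "\<dots> = ac X GA * (ac X GD * F)" by (simp only: homD(3)[OF that])
    finally show ?thesis by (simp only: mult.assoc)
  qed
  have wF: "wt T \<beta> \<gamma> (f * w)" "f * w * un 0 0 = f * w" if "f \<in> hom T T" for f
  proof -
    have "ac T g * (f * w) = f * (ac T g * w)" for g
      by (simp only: mult.assoc[symmetric] homD(3)[OF that])
    then show "wt T \<beta> \<gamma> (f * w)" unfolding wt_def
      by (simp add: wtD[OF T(2)] assoc_ext[OF homD(1)[OF that]])
    show "f * w * un 0 0 = f * w" by (simp only: mult.assoc T(3))
  qed
  have endpoly: "\<exists>C \<in> polys z. f * w = C * w" if "f \<in> hom T T" for f
    unfolding z_def using wt_polys[OF T(1,2,4) wF[OF that] r(1)] .
  have endcomm: "f * C = C * f" if "f \<in> hom T T" "C \<in> polys z" for f C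
    using polys_comm_gen[OF that(2)] hz[OF that(1)] z_def by simp
  \<comment> \<open>An endomorphism is determined by its value on \<open>w\<close>, which is a
    polynomial in \<open>z\<close> applied to \<open>w\<close>, and it commutes with
    \<open>z\<close>.\<close>
  have comm: "f * g = g * f" if f: "f \<in> hom T T" and g: "g \<in> hom T T" for f g
  proof -
    obtain C D where C: "C \<in> polys z" "f * w = C * w" and D: "D \<in> polys z" "g * w = D * w"
      using endpoly f g by blast
    have "f * g * w = f * D * w" by (simp only: mult.assoc D(2))
    then have "f * g * w = D * (C * w)" unfolding endcomm[OF f D(1)] by (simp only: mult.assoc C(2))
    moreover have "g * f * w = g * C * w" by (simp only: mult.assoc C(2))
    then have "g * f * w = C * (D * w)" unfolding endcomm[OF g C(1)] by (simp only: mult.assoc D(2))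
    moreover have "D * (C * w) = C * (D * w)" using polys_comm[OF C(1) D(1)] by (simp only: mult.assoc[symmetric])
    ultimately show ?thesis using hom_eqI[OF hom_comp[OF g f] hom_comp[OF f g] _ T(4)] by simp
  qed
  have Rz: "R j * ((z - \<sigma> j *o 1) * (D * w)) = 0" if j: "j < k" and D: "D \<in> polys z" for j D
  proof -
    obtain D' where D': "D' \<in> polys (ac (V j) GA * ac (V j) GD)" "R j * D = D' * R j"
      using polys_transfer[OF D hz[OF R(1)[OF j]]] by blast
    have "(z - \<sigma> j *o 1) * D = D * (z - \<sigma> j *o 1)"
      using polys_comm[OF polys_z D] by (simp add: left_diff_distrib right_diff_distrib)
    then have "R j * ((z - \<sigma> j *o 1) * D) * w = R j * (D * (z - \<sigma> j *o 1)) * w" by (simp only:)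
    then have "R j * ((z - \<sigma> j *o 1) * (D * w)) = R j * D * (z - \<sigma> j *o 1) * w"
      by (simp only: mult.assoc)
    also have "\<dots> = D' * (R j * z * w - \<sigma> j *o (R j * w))"
      unfolding D'(2) by (simp add: left_diff_distrib right_diff_distrib mult.assoc)
    also have "R j * z * w = \<sigma> j *o v j"
      unfolding hz[OF R(1)[OF j]] by (simp only: mult.assoc R(2)[OF j]) (simp only: v(4)[OF j, unfolded mult.assoc])
    finally show ?thesis by (simp add: R(2)[OF j])
  qed
  \<comment> \<open>Write f w = C w. Since \<open>z\<close> becomes \<sigma> j under
    \<open>R j\<close>, the polynomial \<open>C\<close> is divisible by each z - ev x. The values ev
    x may repeat, so \<open>C\<close> itself need not kill \<open>w\<close>; but each further factor
    \<open>C\<close> advances from a^m d^m w to the next m, so C^n does, and f^n = f.\<close>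
  have kill: "f = 0" if f: "f \<in> hom T T" and ff: "f * f = f" and fR: "\<And>j. j < k \<Longrightarrow> R j * f = 0" for f
  proof -
    obtain C where C: "C \<in> polys z" "f * w = C * w" using endpoly[OF f] by blast
    have div: "\<exists>C' \<in> polys z. C = (z - ev (\<beta> * \<gamma>) x *o 1) * C'" if "x < n" for x
    proof -
      obtain j where j: "j < k" "ev (\<beta> * \<gamma>) x = \<sigma> j" using cov[OF \<open>x < n\<close>] by blast
      obtain c C' where C': "C' \<in> polys z" "C = c *o 1 + (z - \<sigma> j *o 1) * C'" using polys_division[OF C(1)] by blast
      have "0 = R j * (C * w)" using fR[OF j(1)] by (simp add: C(2)[symmetric] mult.assoc[symmetric])
      also have "\<dots> = c *o v j"
        unfolding C'(2) by (simp add: distrib_left distrib_right mult.assoc Rz[OF j(1) C'(1)] R(2)[OF j(1)])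
      finally have "c = 0" using v(3)[OF j(1)] by simp
      then show ?thesis using C' j(2) by auto
    qed
    have "\<exists>D \<in> polys z. C ^ m * w = D * uu T w m m" if "m \<le> n" for m
      using that
    proof (induction m)
      case 0
      then show ?case by (intro bexI[OF _ polys_1]) (simp add: uu_def)
    next
      case (Suc m)
      then obtain D where D: "D \<in> polys z" "C ^ m * w = D * uu T w m m" by auto
      obtain C' where C': "C' \<in> polys z" "C = (z - ev (\<beta> * \<gamma>) m *o 1) * C'" using div[of m] Suc.prems by auto
      have zC: "C = C' * (z - ev (\<beta> * \<gamma>) m *o 1)"
        unfolding C'(2) using polys_comm[OF polys_z C'(1)] by (simp add: left_diff_distrib right_diff_distrib)
      have "C ^ Suc m * w = C * D * uu T w m m" by (simp add: mult.assoc D(2))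
      also have "\<dots> = D * (C' * ((z - ev (\<beta> * \<gamma>) m *o 1) * uu T w m m))"
        unfolding polys_comm[OF C(1) D(1)] by (subst zC) (simp only: mult.assoc)
      also have "\<dots> = (q ^ m *o (D * C')) * uu T w (Suc m) (Suc m)"
        unfolding z_def z_uu[OF T(1,2)] by (simp add: mult.assoc)
      finally show ?case using D(1) C'(1) polys_scl polys_times by blast
    qed
    then obtain D where "C ^ n * w = D * uu T w n n" by blast
    moreover have "uu T w n n = 0" using pow_ge_n(1)[OF T(1), of n] by (simp add: uu_def)
    ultimately have Cn: "C ^ n * w = 0" by simp
    have Cp: "C ^ m \<in> polys z" for m by (induction m) (auto intro: polys_1 polys_times C(1))
    have "f ^ m * w = C ^ m * w" for m
    proof (induction m)
      case (Suc m)
      have "f ^ Suc m * w = f * C ^ m * w" by (simp add: mult.assoc Suc)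
      also have "\<dots> = C ^ m * (f * w)" unfolding endcomm[OF f Cp] by (simp only: mult.assoc)
      also have "\<dots> = C ^ Suc m * w" unfolding C(2) by (simp only: power_Suc2 mult.assoc)
      finally show ?case .
    qed simp
    moreover have "f ^ Suc m = f" for m by (induction m) (simp_all add: ff)
    then have "f ^ n = f" using n0 by (metis Suc_pred)
    ultimately have "f * w = 0 * w" using Cn by (metis mult_zero_left)
    then show ?thesis using hom_eqI[OF f hom_0 _ T(4)] by blast
  qed
  \<comment> \<open>Interpolation: \<open>G\<close> is the endomorphism with G w = (z - \<sigma> j)
    w / (\<sigma> i - \<sigma> j), so R i G = R i and R j G = 0. Its compression to
    \<open>P i\<close> is invertible, hence \<open>R j\<close> vanishes on the image of
    \<open>p i\<close>.\<close>
  have Re: "R j * e i = 0" if i: "i < k" and j: "j < k" and ij: "i \<noteq> j" for i j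
  proof -
    define c where "c = inverse (\<sigma> i - \<sigma> j)"
    have c: "c * (\<sigma> i - \<sigma> j) = 1" using inj[OF i j ij] by (simp add: c_def)
    define y where "y = c *o ((z - \<sigma> j *o 1) * w)"
    have "wt T (\<beta> / q * q) (\<gamma> / q * q) (z * w)"
      unfolding z_def mult.assoc using wt_a[OF T(1) wt_d[OF T(1,2)]] .
    then have zw: "wt T \<beta> \<gamma> (z * w)" by simp
    have "wt T \<beta> \<gamma> y" unfolding y_def using wtD[OF zw] wtD[OF T(2)] unfolding wt_def
      by (simp add: left_diff_distrib right_diff_distrib scl_diff ac_simps)
    moreover have "y * un 0 0 = y" unfolding y_def by (simp add: mult.assoc T(3))
    ultimately obtain G where G: "G \<in> hom T T" "G * w = y" using free_hom[OF T T(1)] by blast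
    have "R j * G * w = 0 * w" using Rz[OF j polys_1] by (simp add: mult.assoc G(2) y_def)
    then have RjG: "R j * G = 0" using hom_eqI[OF hom_comp[OF G(1) R(1)[OF j]] hom_0 _ T(4)] by blast
    have "R i * (z * w) = \<sigma> i *o v i"
      unfolding mult.assoc[symmetric] hz[OF R(1)[OF i]] by (simp only: mult.assoc R(2)[OF i]) (simp only: v(4)[OF i, unfolded mult.assoc])
    then have "R i * G * w = (c * (\<sigma> i - \<sigma> j)) *o v i"
      by (simp add: mult.assoc G(2) y_def left_diff_distrib right_diff_distrib R(2)[OF i] scl_diff scl_diff_left)
    then have "R i * G * w = R i * w" unfolding c R(2)[OF i] by simp
    then have RiG: "R i * G = R i" using hom_eqI[OF hom_comp[OF G(1) R(1)[OF i]] R(1)[OF i] _ T(4)] by blast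
    define u where "u = Q i * (G * p i)"
    have u: "u \<in> hom (P i) (P i)" unfolding u_def using hom_comp[OF hom_comp[OF p[OF i] G(1)] Q[OF i]] .
    have "\<pi> i * u = R i * G * p i" unfolding u_def mult.assoc[symmetric] piQ[OF i] ..
    also have "\<dots> = \<pi> i" unfolding RiG Rp[OF i] ..
    finally obtain s where s: "u * s = E (hdim (P i))" using cover_endo[OF P(1,2)[OF i] u] pi0[OF i] by auto
    have "R j * p i * u = R j * (e i * G) * p i" unfolding u_def e_def by (simp only: mult.assoc)
    also have "\<dots> = (R j * G) * (e i * p i)" unfolding comm[OF eh[OF i] G(1)] by (simp only: mult.assoc)
    finally have "R j * p i * u = 0" unfolding RjG by simp
    then have "R j * p i * (u * s) = 0" by (simp only: mult.assoc[symmetric]) simp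
    then have "R j * p i = 0" unfolding s using homD(2)[OF p[OF i]] by (simp add: mult.assoc)
    then show ?thesis unfolding e_def by (simp add: mult.assoc[symmetric])
  qed
  have Ree: "R i * e i = R i" if "i < k" for i
    unfolding e_def mult.assoc[symmetric] Rp[OF that] piQ[OF that] ..
  have orth: "e i * e j = 0" if i: "i < k" and j: "j < k" and ij: "i \<noteq> j" for i j
  proof (rule kill)
    show "e i * e j \<in> hom T T" using hom_comp eh i j by blast
    have "e i * e j * (e i * e j) = e i * (e j * e i) * e j" by (simp only: mult.assoc)
    also have "\<dots> = (e i * e i) * (e j * e j)" unfolding comm[OF eh[OF j] eh[OF i]] by (simp only: mult.assoc)
    finally show "e i * e j * (e i * e j) = e i * e j" unfolding ee[OF i] ee[OF j] .
    fix m assume m: "m < k"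
    show "R m * (e i * e j) = 0"
    proof (cases "m = i")
      case True
      then have "R m * (e i * e j) = R i * e j * e i" unfolding comm[OF eh[OF i] eh[OF j]] by (simp add: mult.assoc)
      then show ?thesis unfolding Re[OF j i ij[symmetric]] by simp
    next
      case False
      then have "R m * e i = 0" using Re[OF i m] by auto
      then show ?thesis by (simp add: mult.assoc[symmetric])
    qed
  qed
  \<comment> \<open>The complementary idempotent, which is annihilated by all
    \<open>R m\<close>.\<close>
  define f where "f = E (hdim T) - (\<Sum>i<k. e i)"
  have se: "(\<Sum>i<k. e i) \<in> hom T T" using eh by (intro hom_sum) auto
  have fh: "f \<in> hom T T" unfolding f_def using hom_diff[OF hom_id[OF is_module_wf[OF T(1)]] se] .
  have ss: "(\<Sum>i<k. e i) * (\<Sum>i<k. e i) = (\<Sum>i<k. e i)"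
  proof -
    have "(\<Sum>i<k. e i) * (\<Sum>i<k. e i) = (\<Sum>i<k. \<Sum>j<k. e i * e j)" by (rule sum_product)
    also have "\<dots> = (\<Sum>i<k. \<Sum>j<k. if i = j then e i else 0)"
      by (intro sum.cong refl) (auto simp: ee orth)
    finally show ?thesis by simp
  qed
  have "f * f = f" unfolding f_def left_diff_distrib right_diff_distrib ss homD(1,2)[OF se] by simp
  moreover have "R m * f = 0" if "m < k" for m
  proof -
    have "R m * (\<Sum>i<k. e i) = (\<Sum>i<k. if i = m then R m else 0)"
      unfolding sum_distrib_left using that by (intro sum.cong refl) (auto simp: Re Ree)
    then show ?thesis unfolding f_def right_diff_distrib homD(2)[OF R(1)[OF that]] using that by simp
  qed
  ultimately have "f = 0" using kill[OF fh] by blast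
  then have sum1: "(\<Sum>i<k. p i * Q i) = E (hdim T)" unfolding f_def e_def by simp
  have "Q i * p j = 0" if i: "i < k" and j: "j < k" and ij: "i \<noteq> j" for i j
  proof -
    have "Q i * p j = (Q i * p i) * Q i * (p j * (Q j * p j))"
      unfolding Qp[OF i] Qp[OF j] homD(1)[OF Q[OF i]] homD(2)[OF p[OF j]] ..
    also have "\<dots> = Q i * (e i * e j) * p j" unfolding e_def by (simp only: mult.assoc)
    finally show ?thesis unfolding orth[OF i j ij] by simp
  qed
  then have fam: "fam T (map P [0..<k]) p Q"
    unfolding fam_def using p Q Qp sum1 by auto
  have mPs: "is_module n q (module_sum (map P [0..<k]))" using mP(1) by (intro is_module_sum) auto
  obtain p' q' where "fam (module_sum (map P [0..<k])) (map P [0..<k]) p' q'"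
    using fam_module_sum[of "map P [0..<k]"] mP(1) is_module_wf by fastforce
  from fam_iso[OF fam this T(1) mPs, of id] show ?thesis by simp
qed

end

section \<open>Tensor products\<close>

lemma sum_split_add:
  fixes a b :: nat
  shows "(\<Sum>k<a + b. f k) = (\<Sum>k<a. f k) + (\<Sum>j<b. f (a + j) :: 'a :: comm_monoid_add)"
  by (induction b) (simp_all add: add.assoc)

lemma sum_div_mod:
  fixes m p :: nat
  shows "(\<Sum>k<m * p. f k) = (\<Sum>i<m. \<Sum>j<p. f (i * p + j) :: 'a :: comm_monoid_add)"
proof (induction m)
  case (Suc m)
  have "(\<Sum>k<Suc m * p. f k) = (\<Sum>k<m * p + p. f k)" by (simp add: add.commute)
  then show ?case unfolding sum_split_add Suc by simp
qed simp

lemma kronecker_carrier: "A \<in> carrier_mat N M \<Longrightarrow> B \<in> carrier_mat p r \<Longrightarrow> kronecker A B \<in> carrier_mat (N * p) (M * r)"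
  by (auto simp: kronecker_def)

lemma div_mod_less: "i < N * p \<Longrightarrow> i div p < N \<and> i mod p < (p :: nat)"
  by (metis less_mult_imp_div_less mod_less_divisor mult_0_right not_less0 neq0_conv)

lemma kronecker_index:
  "A \<in> carrier_mat N M \<Longrightarrow> B \<in> carrier_mat p r \<Longrightarrow> i < N * p \<Longrightarrow> j < M * r \<Longrightarrow>
   kronecker A B $$ (i, j) = A $$ (i div p, j div r) * B $$ (i mod p, j mod r)"
  by (auto simp: kronecker_def)

lemma kronecker_mult:
  fixes A B C D :: "'k::field mat"
  assumes A: "A \<in> carrier_mat N M" and B: "B \<in> carrier_mat p r"
    and C: "C \<in> carrier_mat M L" and D: "D \<in> carrier_mat r s"
  shows "kronecker A B * kronecker C D = kronecker (A * C) (B * D)"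
proof (rule eq_matI)
  note AB = kronecker_carrier[OF A B] and CD = kronecker_carrier[OF C D]
  note AC = mult_carrier_mat[OF A C] and BD = mult_carrier_mat[OF B D]
  note K = kronecker_carrier[OF AC BD]
  show "dim_row (kronecker A B * kronecker C D) = dim_row (kronecker (A * C) (B * D))"
    "dim_col (kronecker A B * kronecker C D) = dim_col (kronecker (A * C) (B * D))"
    using AB CD K by auto
  fix i j assume "i < dim_row (kronecker (A * C) (B * D))" "j < dim_col (kronecker (A * C) (B * D))"
  then have ij: "i < N * p" "j < L * s" using K by auto
  then have i: "i div p < N" "i mod p < p" and j: "j div s < L" "j mod s < s" using div_mod_less by blast+
  have "(kronecker A B * kronecker C D) $$ (i, j) = (\<Sum>k<M * r. kronecker A B $$ (i, k) * kronecker C D $$ (k, j))"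
    using AB CD ij by (simp add: scalar_prod_def atLeast0LessThan)
  also have "\<dots> = (\<Sum>k1<M. \<Sum>k2<r. (A $$ (i div p, k1) * B $$ (i mod p, k2)) * (C $$ (k1, j div s) * D $$ (k2, j mod s)))"
    unfolding sum_div_mod
  proof (intro sum.cong refl)
    fix k1 k2 assume k: "k1 \<in> {..<M}" "k2 \<in> {..<r}"
    then have "k1 * r + k2 < Suc k1 * r" by simp
    also have "\<dots> \<le> M * r" using k by (intro mult_le_mono1) simp
    finally have "k1 * r + k2 < M * r" .
    then show "kronecker A B $$ (i, k1 * r + k2) * kronecker C D $$ (k1 * r + k2, j) =
      (A $$ (i div p, k1) * B $$ (i mod p, k2)) * (C $$ (k1, j div s) * D $$ (k2, j mod s))"
      using k by (simp add: kronecker_index[OF A B ij(1)] kronecker_index[OF C D _ ij(2)])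
  qed
  also have "\<dots> = (\<Sum>k1<M. \<Sum>k2<r. (A $$ (i div p, k1) * C $$ (k1, j div s)) * (B $$ (i mod p, k2) * D $$ (k2, j mod s)))"
    by (intro sum.cong refl) (simp only: ac_simps)
  also have "\<dots> = (\<Sum>k1<M. A $$ (i div p, k1) * C $$ (k1, j div s)) * (\<Sum>k2<r. B $$ (i mod p, k2) * D $$ (k2, j mod s))"
    by (simp only: sum_product)
  also have "\<dots> = (A * C) $$ (i div p, j div s) * (B * D) $$ (i mod p, j mod s)"
    using A B C D i j by (simp add: scalar_prod_def atLeast0LessThan)
  also have "\<dots> = kronecker (A * C) (B * D) $$ (i, j)"
    using kronecker_index[OF AC BD ij] by simp
  finally show "(kronecker A B * kronecker C D) $$ (i, j) = kronecker (A * C) (B * D) $$ (i, j)" .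
qed

text \<open>An operator carries no size, whereas the lexicographic numbering of a tensor product
  depends on the sizes of the factors; hence the four size arguments.\<close>

definition tn :: "nat \<Rightarrow> nat \<Rightarrow> nat \<Rightarrow> nat \<Rightarrow> 'k::field lop \<Rightarrow> 'k lop \<Rightarrow> 'k lop" where
  "tn N M p r F G = opm (kronecker (mt N M F) (mt p r G))"

lemma mt_mult: "mt N M F * mt M L G = mt N L (F * E M * G)"
proof -
  have "opm (mt N M F * mt M L G) = opm (mt N M F) * opm (mt M L G)" by (intro opm_mult) simp
  also have "\<dots> = E N * (F * E M * G) * E L" by (simp add: mult.assoc assoc_ext[OF E_idem])
  finally have "opm (mt N M F * mt M L G) = opm (mt N L (F * E M * G))" by simp
  then show ?thesis using opm_inj[OF mult_carrier_mat[OF mt_carrier(1) mt_carrier(1)] mt_carrier(1)] by blast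
qed

lemma tn_mult: "tn N M p r F G * tn M L r s F' G' = tn N L p s (F * E M * F') (G * E r * G')"
proof -
  have "tn N M p r F G * tn M L r s F' G' =
      opm (kronecker (mt N M F) (mt p r G) * kronecker (mt M L F') (mt r s G'))"
    unfolding tn_def using kronecker_carrier[OF mt_carrier(1)[of N M F] mt_carrier(1)[of p r G]]
      kronecker_carrier[OF mt_carrier(1)[of M L F'] mt_carrier(1)[of r s G']]
    by (intro opm_mult[symmetric]) auto
  then show ?thesis unfolding kronecker_mult[OF mt_carrier(1) mt_carrier(1) mt_carrier(1) mt_carrier(1)] mt_mult tn_def .
qed

lemma entry_tn: "entry (tn N M p r F G) i j =
  (if i < N * p \<and> j < M * r then entry F (i div p) (j div r) * entry G (i mod p) (j mod r) else 0)"
proof -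
  have K: "kronecker (mt N M F) (mt p r G) \<in> carrier_mat (N * p) (M * r)"
    by (rule kronecker_carrier) simp_all
  then show ?thesis
    using div_mod_less[of i N p] div_mod_less[of j M r]
    by (auto simp: tn_def entry_opm kronecker_index[OF mt_carrier(1) mt_carrier(1)]) (auto simp: mt_def)
qed

lemma tn_E: "E (N * p) * tn N M p r F G = tn N M p r F G" "tn N M p r F G * E (M * r) = tn N M p r F G"
proof -
  have K: "kronecker (mt N M F) (mt p r G) \<in> carrier_mat (N * p) (M * r)"
    by (rule kronecker_carrier) simp_all
  show "E (N * p) * tn N M p r F G = tn N M p r F G" "tn N M p r F G * E (M * r) = tn N M p r F G"
    unfolding tn_def using E_opm[OF K] opm_E[OF K] by simp_all
qed

lemma tn_eqI:
  assumes "E (N * p) * H = H" "H * E (M * r) = H"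
    "\<And>i j. i < N * p \<Longrightarrow> j < M * r \<Longrightarrow> entry F (i div p) (j div r) * entry G (i mod p) (j mod r) = entry H i j"
  shows "tn N M p r F G = H"
  by (rule lop_entryI[of "N * p" _ "M * r"]) (simp_all add: tn_E assms entry_tn)

lemma tn_add_left: "tn N M p r (F + F') G = tn N M p r F G + tn N M p r F' G"
  by (rule tn_eqI) (simp_all add: tn_E distrib_left distrib_right left_diff_distrib right_diff_distrib
      entry_simps entry_tn)

lemma tn_add_right: "tn N M p r F (G + G') = tn N M p r F G + tn N M p r F G'"
  by (rule tn_eqI) (simp_all add: tn_E distrib_left distrib_right left_diff_distrib right_diff_distrib
      entry_simps entry_tn)

lemma tn_diff_left: "tn N M p r (F - F') G = tn N M p r F G - tn N M p r F' G"
  by (rule tn_eqI) (simp_all add: tn_E distrib_left distrib_right left_diff_distrib right_diff_distrib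
      entry_simps entry_tn)

lemma tn_diff_right: "tn N M p r F (G - G') = tn N M p r F G - tn N M p r F G'"
  by (rule tn_eqI) (simp_all add: tn_E distrib_left distrib_right left_diff_distrib right_diff_distrib
      entry_simps entry_tn)

lemma tn_scl_left: "tn N M p r (c *o F) G = c *o tn N M p r F G"
  by (rule tn_eqI) (simp_all add: tn_E distrib_left distrib_right left_diff_distrib right_diff_distrib
      entry_simps entry_tn)

lemma tn_scl_right: "tn N M p r F (c *o G) = c *o tn N M p r F G"
  by (rule tn_eqI) (simp_all add: tn_E distrib_left distrib_right left_diff_distrib right_diff_distrib
      entry_simps entry_tn)

lemma tn_0_left: "tn N M p r 0 G = 0"
  by (rule tn_eqI) (simp_all add: tn_E distrib_left distrib_right left_diff_distrib right_diff_distrib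
      entry_simps entry_tn)

lemma tn_0_right: "tn N M p r F 0 = 0"
  by (rule tn_eqI) (simp_all add: tn_E distrib_left distrib_right left_diff_distrib right_diff_distrib
      entry_simps entry_tn)

lemmas tn_add = tn_add_left tn_add_right
lemmas tn_diff = tn_diff_left tn_diff_right
lemmas tn_scl = tn_scl_left tn_scl_right
lemmas tn_0 = tn_0_left tn_0_right

lemma tn_one: "tn N N p p (E N) (E p) = E (N * p)"
proof (rule tn_eqI)
  fix i j assume ij: "i < N * p" "j < N * p"
  have "i = j \<longleftrightarrow> i div p = j div p \<and> i mod p = j mod p" by (metis div_mult_mod_eq)
  then show "entry (E N) (i div p) (j div p) * entry (E p) (i mod p) (j mod p) = entry (E (N * p)) i j"
    using ij div_mod_less[OF ij(1)] by (auto simp: entry_simps)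
qed simp_all

lemma tn_un:
  assumes "i < N" "j < p"
  shows "tn N 1 p 1 (un i 0) (un j 0) = un (i * p + j) 0"
proof (rule tn_eqI)
  have "i * p + j < Suc i * p" using assms by simp
  also have "\<dots> \<le> N * p" using assms by (intro mult_le_mono1) simp
  finally show "E (N * p) * un (i * p + j) 0 = (un (i * p + j) 0 :: 'a lop)" by simp
  show "un (i * p + j) 0 * E (1 * 1) = (un (i * p + j) 0 :: 'a lop)" by simp
  fix i' j' assume "i' < N * p" "j' < (1::nat) * 1"
  moreover have "i' div p = i \<and> i' mod p = j \<longleftrightarrow> i' = i * p + j"
    using assms by (metis add.commute div_mult_mod_eq div_mult_self1 div_less add_0 mod_mult_self1 mod_less gr_implies_not0 mult.commute)
  ultimately show "entry (un i 0) (i' div p) (j' div 1) * entry (un j 0) (i' mod p) (j' mod 1) = (entry (un (i * p + j) 0) i' j' :: 'a)"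
    by (auto simp: entry_simps)
qed

lemma tn_pow:
  assumes "E N * F = F" "E p * G = G"
  shows "tn N N p p F G ^ Suc k = tn N N p p (F ^ Suc k) (G ^ Suc k)"
proof (induction k)
  case (Suc k)
  have "F * E N * F ^ Suc k = F * F ^ Suc k" "G * E p * G ^ Suc k = G * G ^ Suc k"
    by (simp_all add: mult.assoc assoc_ext[OF assms(1)] assoc_ext[OF assms(2)])
  then show ?case by (simp only: power_Suc[of _ "Suc k"] Suc tn_mult)
qed simp

lemma hdim_tensor [simp]: "hdim (tensor X Y) = hdim X * hdim Y"
  by (simp add: tensor_def)

lemma ac_tensor:
  assumes "wf_act X" "wf_act Y"
  defines "T \<equiv> tn (hdim X) (hdim X) (hdim Y) (hdim Y)"
  shows "ac (tensor X Y) GA = T (ac X GA) (ac Y GB) + T (E (hdim X)) (ac Y GA)"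
    "ac (tensor X Y) GB = T (ac X GB) (ac Y GB)"
    "ac (tensor X Y) GC = T (ac X GC) (ac Y GC)"
    "ac (tensor X Y) GD = T (ac X GD) (ac Y GC) + T (E (hdim X)) (ac Y GD)"
    "wf_act (tensor X Y)"
proof -
  have C: "act X g \<in> carrier_mat (hdim X) (hdim X)" "act Y g \<in> carrier_mat (hdim Y) (hdim Y)" for g
    using assms by (auto simp: wf_act_def)
  have m: "mt (hdim X) (hdim X) (ac X g) = act X g" "mt (hdim Y) (hdim Y) (ac Y g) = act Y g" for g
    unfolding ac_def by (rule mt_opm[OF C(1)], rule mt_opm[OF C(2)])
  have e: "mt (hdim X) (hdim X) (E (hdim X) :: 'a lop) = 1\<^sub>m (hdim X)"
    using mt_opm[OF one_carrier_mat[of "hdim X", where 'a='a]] by simp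
  have K: "kronecker (act X g) (act Y h) \<in> carrier_mat (hdim X * hdim Y) (hdim X * hdim Y)"
    "kronecker (1\<^sub>m (hdim X)) (act Y h) \<in> carrier_mat (hdim X * hdim Y) (hdim X * hdim Y)" for g h
    using C by (auto intro!: kronecker_carrier)
  have a: "act (tensor X Y) GA = kronecker (act X GA) (act Y GB) + kronecker (1\<^sub>m (hdim X)) (act Y GA)"
    "act (tensor X Y) GB = kronecker (act X GB) (act Y GB)"
    "act (tensor X Y) GC = kronecker (act X GC) (act Y GC)"
    "act (tensor X Y) GD = kronecker (act X GD) (act Y GC) + kronecker (1\<^sub>m (hdim X)) (act Y GD)"
    by (simp_all add: tensor_def)
  have add: "opm (kronecker (act X g) (act Y h) + kronecker (1\<^sub>m (hdim X)) (act Y h')) =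
     opm (kronecker (act X g) (act Y h)) + opm (kronecker (1\<^sub>m (hdim X)) (act Y h'))" for g h h'
    using carrier_matD[OF K(1)] carrier_matD[OF K(2)] by (intro opm_add) simp_all
  show "ac (tensor X Y) GA = T (ac X GA) (ac Y GB) + T (E (hdim X)) (ac Y GA)"
    "ac (tensor X Y) GB = T (ac X GB) (ac Y GB)"
    "ac (tensor X Y) GC = T (ac X GC) (ac Y GC)"
    "ac (tensor X Y) GD = T (ac X GD) (ac Y GC) + T (E (hdim X)) (ac Y GD)"
    unfolding T_def tn_def m e ac_def[of "tensor X Y"] a add by (rule refl)+
  show "wf_act (tensor X Y)"
    unfolding wf_act_def all_generator a hdim_tensor using K by (auto intro!: add_carrier_mat)
qed

subsection \<open>Functoriality\<close>

lemma hom_tensor: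
  assumes w: "wf_act X" "wf_act X'" "wf_act Y" "wf_act Y'" and F: "F \<in> hom X X'" and G: "G \<in> hom Y Y'"
  shows "tn (hdim X') (hdim X) (hdim Y') (hdim Y) F G \<in> hom (tensor X Y) (tensor X' Y')"
proof (rule homI)
  let ?t = "tn (hdim X') (hdim X) (hdim Y') (hdim Y) F G"
  show "E (hdim (tensor X' Y')) * ?t = ?t" "?t * E (hdim (tensor X Y)) = ?t"
    unfolding hdim_tensor by (rule tn_E)+
  fix g
  have FE: "F * E (hdim X) = F" "G * E (hdim Y) = G" "E (hdim X') * F = F" "E (hdim Y') * G = G"
    using homD(1,2) F G by blast+
  have a: "F * E (hdim X) * ac X g = ac X' g * E (hdim X') * F"
    "G * E (hdim Y) * ac Y g = ac Y' g * E (hdim Y') * G" for g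
    using homD(3)[OF F, of g] homD(3)[OF G, of g] by (simp_all only: FE ac_E(2)[OF w(2)] ac_E(2)[OF w(4)])
  have e: "F * E (hdim X) * E (hdim X) = E (hdim X') * E (hdim X') * F"
    by (simp only: FE E_idem)
  show "?t * ac (tensor X Y) g = ac (tensor X' Y') g * ?t"
    by (cases g) (simp_all only: ac_tensor[OF w(1,3)] ac_tensor[OF w(2,4)] distrib_left distrib_right tn_mult a e)
qed

lemma tensor_ses_left:
  assumes w: "wf_act A" "wf_act B" "wf_act C" "wf_act Y" and s: "ses A B C"
  shows "ses (tensor A Y) (tensor B Y) (tensor C Y)"
proof -
  let ?p = "hdim Y"
  obtain F G R S where FG: "F \<in> hom A B" "G \<in> hom B C" "R * F = E (hdim A)" "G * S = E (hdim C)"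
     "F * R + S * G = E (hdim B)" "E (hdim A) * R * E (hdim B) = R" "E (hdim B) * S * E (hdim C) = S"
    using s unfolding ses_def by blast
  define F' where "F' = tn (hdim B) (hdim A) ?p ?p F (E ?p)"
  define G' where "G' = tn (hdim C) (hdim B) ?p ?p G (E ?p)"
  define R' where "R' = tn (hdim A) (hdim B) ?p ?p R (E ?p)"
  define S' where "S' = tn (hdim B) (hdim C) ?p ?p S (E ?p)"
  have RE: "R * E (hdim B) = R" "S * E (hdim C) = S"
    using FG(6,7) by (metis mult.assoc E_idem)+
  have "F' \<in> hom (tensor A Y) (tensor B Y)" "G' \<in> hom (tensor B Y) (tensor C Y)"
    unfolding F'_def G'_def using hom_tensor[OF w(1,2,4,4) FG(1) hom_id[OF w(4)]]
      hom_tensor[OF w(2,3,4,4) FG(2) hom_id[OF w(4)]] by simp_all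
  moreover have "R' * F' = E (hdim (tensor A Y))" "G' * S' = E (hdim (tensor C Y))"
    unfolding R'_def F'_def G'_def S'_def tn_mult by (simp_all add: RE homD[OF FG(2)] FG(3,4) tn_one)
  moreover have "F' * R' + S' * G' = E (hdim (tensor B Y))"
    unfolding R'_def F'_def G'_def S'_def tn_mult
    by (simp add: RE homD[OF FG(1)] tn_add(1)[symmetric] FG(5) tn_one)
  moreover have "E (hdim (tensor A Y)) * R' * E (hdim (tensor B Y)) = R'"
    "E (hdim (tensor B Y)) * S' * E (hdim (tensor C Y)) = S'"
    unfolding R'_def S'_def by (simp_all add: tn_E)
  ultimately show ?thesis unfolding ses_def by blast
qed

lemma tensor_ses_right:
  assumes w: "wf_act A" "wf_act B" "wf_act C" "wf_act X" and s: "ses A B C"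
  shows "ses (tensor X A) (tensor X B) (tensor X C)"
proof -
  let ?p = "hdim X"
  obtain F G R S where FG: "F \<in> hom A B" "G \<in> hom B C" "R * F = E (hdim A)" "G * S = E (hdim C)"
     "F * R + S * G = E (hdim B)" "E (hdim A) * R * E (hdim B) = R" "E (hdim B) * S * E (hdim C) = S"
    using s unfolding ses_def by blast
  define F' where "F' = tn ?p ?p (hdim B) (hdim A) (E ?p) F"
  define G' where "G' = tn ?p ?p (hdim C) (hdim B) (E ?p) G"
  define R' where "R' = tn ?p ?p (hdim A) (hdim B) (E ?p) R"
  define S' where "S' = tn ?p ?p (hdim B) (hdim C) (E ?p) S"
  have RE: "R * E (hdim B) = R" "S * E (hdim C) = S"
    using FG(6,7) by (metis mult.assoc E_idem)+
  have "F' \<in> hom (tensor X A) (tensor X B)" "G' \<in> hom (tensor X B) (tensor X C)"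
    unfolding F'_def G'_def using hom_tensor[OF w(4,4,1,2) hom_id[OF w(4)] FG(1)]
      hom_tensor[OF w(4,4,2,3) hom_id[OF w(4)] FG(2)] by simp_all
  moreover have "R' * F' = E (hdim (tensor X A))" "G' * S' = E (hdim (tensor X C))"
    unfolding R'_def F'_def G'_def S'_def tn_mult by (simp_all add: RE homD[OF FG(2)] FG(3,4) tn_one)
  moreover have "F' * R' + S' * G' = E (hdim (tensor X B))"
    unfolding R'_def F'_def G'_def S'_def tn_mult
    by (simp add: RE homD[OF FG(1)] tn_add(2)[symmetric] FG(5) tn_one)
  moreover have "E (hdim (tensor X A)) * R' * E (hdim (tensor X B)) = R'"
    "E (hdim (tensor X B)) * S' * E (hdim (tensor X C)) = S'"
    unfolding R'_def S'_def by (simp_all add: tn_E)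
  ultimately show ?thesis unfolding ses_def by blast
qed

subsection \<open>Gaussian binomials at a root of unity\<close>

context prim_root
begin

text \<open>The q-factorial (k)!, nonzero below n and zero from n on.\<close>

definition qf :: "nat \<Rightarrow> 'k" where "qf k = (\<Prod>i<k. qint q (Suc i))"

lemma qf_simps [simp]: "qf 0 = 1" "qf (Suc k) = qf k * qint q (Suc k)"
  by (simp_all add: qf_def del: qint_simps)

lemma qf_nz: "k < n \<Longrightarrow> qf k \<noteq> 0"
proof -
  assume k: "k < n"
  have "qint q (Suc i) \<noteq> 0" if "i < k" for i
    using that k qint_eq_0[of "Suc i"] by (auto dest: dvd_imp_le)
  then show ?thesis unfolding qf_def by (simp del: qint_simps)
qed

lemma qint_add: "qint q (a + b) = qint q a + q ^ a * qint q b"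
  by (induction b) (simp_all add: algebra_simps power_add)

text \<open>Gaussian binomial coefficients, by the q-Pascal rule: for k = n and i = 0 or i = n the
  quotient of q-factorials would read 0 / 0.\<close>

fun gb :: "nat \<Rightarrow> nat \<Rightarrow> 'k" where
  "gb k 0 = 1"
| "gb 0 (Suc i) = 0"
| "gb (Suc k) (Suc i) = gb k (Suc i) + q ^ (k - i) * gb k i"

lemma gb_gt: "k < i \<Longrightarrow> gb k i = 0"
  by (induction k i rule: gb.induct) auto

lemma gb_qf: "i \<le> k \<Longrightarrow> gb k i * (qf i * qf (k - i)) = qf k"
proof (induction k arbitrary: i)
  case (Suc k)
  show ?case
  proof (cases i)
    case (Suc j)
    then have jk: "j \<le> k" using Suc.prems by simp
    have 1: "gb k j * (qf j * qf (k - j)) = qf k" using Suc.IH[OF jk] .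
    have 2: "gb k (Suc j) * (qf (Suc j) * qf (k - j)) = qf k * qint q (k - j)"
    proof (cases "j = k")
      case False
      then have "k - j = Suc (k - Suc j)" "Suc j \<le> k" using jk by auto
      then show ?thesis using Suc.IH[of "Suc j"] by (simp add: ac_simps del: qint_simps(2))
    qed (simp add: gb_gt)
    have "gb (Suc k) i * (qf i * qf (Suc k - i)) =
        gb k (Suc j) * (qf (Suc j) * qf (k - j)) + q ^ (k - j) * qint q (Suc j) * (gb k j * (qf j * qf (k - j)))"
      unfolding Suc by (simp add: algebra_simps del: qint_simps(2))
    also have "\<dots> = qf k * (qint q (k - j) + q ^ (k - j) * qint q (Suc j))"
      unfolding 1 2 by (simp add: algebra_simps del: qint_simps(2))
    also have "\<dots> = qf k * qint q (Suc k)" unfolding qint_add[symmetric] using jk by (simp del: qint_simps(2))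
    finally show ?thesis by (simp del: qint_simps(2))
  qed simp
qed simp

lemma gb_div: "i \<le> k \<Longrightarrow> k < n \<Longrightarrow> gb k i = qf k / (qf i * qf (k - i))"
  using gb_qf[of i k] qf_nz[of i] qf_nz[of "k - i"] by (simp add: field_simps)

text \<open>(n)! contains the factor (n) = 0, while (i)! and (n - i)! do not vanish. At exponent n
  the q-binomial theorem therefore keeps only the two pure powers.\<close>

lemma gb_n: "0 < i \<Longrightarrow> i < n \<Longrightarrow> gb n i = 0"
proof -
  assume i: "0 < i" "i < n"
  have "qf n = qf (n - 1) * qint q n" using qf_simps(2)[of "n - 1"] n0 by (simp del: qf_simps qint_simps)
  then have "qf n = 0" using qint_eq_0[of n] by simp
  then show ?thesis using gb_qf[of i n] qf_nz[of i] qf_nz[of "n - i"] i by simp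
qed

lemma qcomm_pow: "X * Y = q *o (Y * X) \<Longrightarrow> X * Y ^ k = q ^ k *o (Y ^ k * X)"
proof (induction k)
  case (Suc k)
  have "X * Y ^ Suc k = (X * Y) * Y ^ k" by (simp add: mult.assoc)
  also have "\<dots> = q *o (Y * (X * Y ^ k))" unfolding Suc.prems by (simp add: mult.assoc)
  also have "\<dots> = q ^ Suc k *o (Y ^ Suc k * X)" unfolding Suc.IH[OF Suc.prems] by (simp add: mult.assoc)
  finally show ?case .
qed simp

lemma q_binomial:
  assumes "X * Y = q *o (Y * X)"
  shows "(X + Y) ^ k = (\<Sum>i\<le>k. gb k i *o (Y ^ (k - i) * X ^ i))"
proof (induction k)
  case (Suc k)
  have "(X + Y) ^ Suc k = (\<Sum>i\<le>k. gb k i *o (X * (Y ^ (k - i) * X ^ i))) + (\<Sum>i\<le>k. gb k i *o (Y * (Y ^ (k - i) * X ^ i)))"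
  proof -
    have "(X + Y) ^ Suc k = X * (X + Y) ^ k + Y * (X + Y) ^ k" by (simp add: distrib_right)
    then show ?thesis unfolding Suc by (simp only: sum_distrib_left scl_mult_right)
  qed
  also have "(\<Sum>i\<le>k. gb k i *o (X * (Y ^ (k - i) * X ^ i))) = (\<Sum>i\<le>k. (q ^ (k - i) * gb k i) *o (Y ^ (Suc k - Suc i) * X ^ Suc i))"
  proof (intro sum.cong refl)
    fix i
    have "X * (Y ^ (k - i) * X ^ i) = q ^ (k - i) *o (Y ^ (k - i) * X ^ Suc i)"
      using assoc_ext[OF qcomm_pow[OF assms, of "k - i"], of "X ^ i"] by (simp add: mult.assoc)
    then show "gb k i *o (X * (Y ^ (k - i) * X ^ i)) = (q ^ (k - i) * gb k i) *o (Y ^ (Suc k - Suc i) * X ^ Suc i)"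
      by (simp add: mult.commute)
  qed
  also have "(\<Sum>i\<le>k. gb k i *o (Y * (Y ^ (k - i) * X ^ i))) = (\<Sum>i\<le>Suc k. gb k i *o (Y ^ (Suc k - i) * X ^ i))"
  proof -
    have "(\<Sum>i\<le>k. gb k i *o (Y * (Y ^ (k - i) * X ^ i))) = (\<Sum>i\<le>k. gb k i *o (Y ^ (Suc k - i) * X ^ i))"
      by (intro sum.cong refl) (simp add: mult.assoc[symmetric] Suc_diff_le)
    then show ?thesis by (simp add: gb_gt)
  qed
  also have "\<dots> = gb k 0 *o (Y ^ Suc k * X ^ 0) + (\<Sum>i\<le>k. gb k (Suc i) *o (Y ^ (Suc k - Suc i) * X ^ Suc i))"
    by (subst sum.atMost_Suc_shift) simp
  finally have "(X + Y) ^ Suc k = gb (Suc k) 0 *o (Y ^ Suc k * X ^ 0) +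
      (\<Sum>i\<le>k. gb (Suc k) (Suc i) *o (Y ^ (Suc k - Suc i) * X ^ Suc i))"
    by (simp add: scl_add_left sum.distrib add_ac del: power_Suc)
  also have "\<dots> = (\<Sum>i\<le>Suc k. gb (Suc k) i *o (Y ^ (Suc k - i) * X ^ i))"
    by (subst sum.atMost_Suc_shift) simp
  finally show ?case .
qed simp

lemma q_binomial_n:
  assumes "X * Y = q *o (Y * X)" "X ^ n = 0" "Y ^ n = 0"
  shows "(X + Y) ^ n = 0"
proof -
  have "gb n i *o (Y ^ (n - i) * X ^ i) = 0" if "i \<le> n" for i
    using that gb_n[of i] assms(2,3) by (cases "i = 0"; cases "i = n") auto
  then show ?thesis unfolding q_binomial[OF assms(1)] by (intro sum.neutral) auto
qed

text \<open>Compatibility of the comultiplication with the relations. Nilpotency of \<open>a\<close>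
  and \<open>d\<close> rests on the q-binomial theorem at exponent n, and in d a - q a d the mixed
  terms cancel.\<close>

lemma tensor_module:
  assumes "is_module n q X" "is_module n q Y"
  shows "is_module n q (tensor X Y)"
proof -
  define N where "N = hdim X"
  define p where "p = hdim Y"
  define T :: "'k lop \<Rightarrow> 'k lop \<Rightarrow> 'k lop" where "T = tn N N p p"
  obtain a b c d where x: "ac X GA = a" "ac X GB = b" "ac X GC = c" "ac X GD = d" by blast
  obtain a' b' c' d' where y: "ac Y GA = a'" "ac Y GB = b'" "ac Y GC = c'" "ac Y GD = d'" by blast
  have w: "wf_act X" "wf_act Y" using assms by (auto intro: is_module_wf)
  have r: "ops_module n q N a b c d" "ops_module n q p a' b' c' d'"
    using assms is_module_iff[OF n0] unfolding N_def p_def x[symmetric] y[symmetric] by blast+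
  note rx = r(1)[unfolded ops_module_def] and ry = r(2)[unfolded ops_module_def]
  have EX: "E N * g = g" "g * E N = g" if "g \<in> {a, b, c, d}" for g
    using that ac_E[OF w(1)] unfolding N_def x[symmetric] by auto
  have EY: "E p * g = g" "g * E p = g" if "g \<in> {a', b', c', d'}" for g
    using that ac_E[OF w(2)] unfolding p_def y[symmetric] by auto
  note EXs = EX(1)[of a, simplified] EX(1)[of b, simplified] EX(1)[of c, simplified] EX(1)[of d, simplified]
    EX(2)[of a, simplified] EX(2)[of b, simplified] EX(2)[of c, simplified] EX(2)[of d, simplified]
  note EYs = EY(1)[of a', simplified] EY(1)[of b', simplified] EY(1)[of c', simplified] EY(1)[of d', simplified]
    EY(2)[of a', simplified] EY(2)[of b', simplified] EY(2)[of c', simplified] EY(2)[of d', simplified]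
  have t: "ac (tensor X Y) GA = T a b' + T (E N) a'" "ac (tensor X Y) GB = T b b'"
    "ac (tensor X Y) GC = T c c'" "ac (tensor X Y) GD = T d c' + T (E N) d'"
    unfolding ac_tensor[OF w] x y T_def N_def p_def by (rule refl)+
  have tm: "T F G * T F' G' = T (F * E N * F') (G * E p * G')" for F G F' G' unfolding T_def by (rule tn_mult)
  have sx: "b * a = q *o (a * b)" "d * b = q *o (b * d)" "c * a = q *o (a * c)" "d * c = q *o (c * d)" "c * b = b * c"
    and sy: "b' * a' = q *o (a' * b')" "d' * b' = q *o (b' * d')" "c' * a' = q *o (a' * c')" "d' * c' = q *o (c' * d')" "c' * b' = b' * c'"
    using rx ry by simp_all
  note T = tn_scl tn_add tn_diff
  have ops: "T F G ^ n = T (F ^ n) (G ^ n)" if "E N * F = F" "E p * G = G" for F G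
    unfolding T_def using tn_pow[OF that, of "n - 1"] n0 by (simp del: power_Suc)
  have en: "E N ^ Suc k = (E N :: 'k lop)" for k by (induction k) simp_all
  then have en: "E N ^ n = (E N :: 'k lop)" using n0 gr0_implies_Suc by blast
  have A: "(T a b' + T (E N) a') ^ n = 0"
  proof (rule q_binomial_n)
    show "T a b' * T (E N) a' = q *o (T (E N) a' * T a b')"
      unfolding tm by (simp add: EXs EYs sy) (simp add: T_def T)
    show "T a b' ^ n = 0" "T (E N) a' ^ n = 0"
      using rx ry by (simp_all add: ops EXs EYs) (simp_all add: T_def tn_0)
  qed
  \<comment> \<open>The two summands of \<open>d\<close> are taken in the opposite order to those of
    \<open>a\<close>, because it is 1 \<otimes> d that passes d \<otimes> c with the factor
    \<open>q\<close>.\<close>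
  have D: "(T (E N) d' + T d c') ^ n = 0"
  proof (rule q_binomial_n)
    show "T (E N) d' * T d c' = q *o (T d c' * T (E N) d')"
      unfolding tm by (simp add: EXs EYs sy) (simp add: T_def T)
    show "T d c' ^ n = 0" "T (E N) d' ^ n = 0"
      using rx ry by (simp_all add: ops EXs EYs) (simp_all add: T_def tn_0)
  qed
  have da: "(T d c' + T (E N) d') * (T a b' + T (E N) a') =
      T (d * a) (b' * c') + q *o T d (a' * c') + (q *o T a (b' * d') + T (E N) (d' * a'))"
    unfolding distrib_left distrib_right tm by (simp add: EXs EYs sy) (simp add: T_def tn_scl)
  have ad: "(T a b' + T (E N) a') * (T d c' + T (E N) d') =
      T (a * d) (b' * c') + T d (a' * c') + (T a (b' * d') + T (E N) (a' * d'))"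
    unfolding distrib_left distrib_right tm by (simp add: EXs EYs)
  have "(T d c' + T (E N) d') * (T a b' + T (E N) a') - q *o ((T a b' + T (E N) a') * (T d c' + T (E N) d'))
      = T (d * a - q *o (a * d)) (b' * c') + T (E N) (d' * a' - q *o (a' * d'))"
    unfolding da ad scl_add unfolding T_def tn_diff tn_scl
    by (simp only: add_diff_add diff_self add_0_right add_0_left)
  also have "\<dots> = T (E N) (E p) - T (b * c) (b' * c')"
  proof -
    have "d * a - q *o (a * d) = E N - b * c" "d' * a' - q *o (a' * d') = E p - b' * c'" using rx ry by blast+
    then show ?thesis by (simp add: T_def T)
  qed
  finally have DA: "(T d c' + T (E N) d') * (T a b' + T (E N) a') - q *o ((T a b' + T (E N) a') * (T d c' + T (E N) d'))
      = E (N * p) - T b b' * T c c'"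
    unfolding tm by (simp add: EXs EYs) (simp add: T_def tn_one)
  have "ops_module n q (N * p) (T a b' + T (E N) a') (T b b') (T c c') (T d c' + T (E N) d')"
    unfolding ops_module_def
  proof (intro conjI DA A)
    show "(T d c' + T (E N) d') ^ n = 0" using D by (simp add: add.commute)
    show "T b b' ^ n = E (N * p)" "T c c' ^ n = E (N * p)"
      using rx ry by (simp_all add: ops EXs EYs) (simp_all add: T_def tn_one)
    show "T b b' * (T a b' + T (E N) a') = q *o ((T a b' + T (E N) a') * T b b')"
      "(T d c' + T (E N) d') * T b b' = q *o (T b b' * (T d c' + T (E N) d'))"
      "T c c' * (T a b' + T (E N) a') = q *o ((T a b' + T (E N) a') * T c c')"
      "(T d c' + T (E N) d') * T c c' = q *o (T c c' * (T d c' + T (E N) d'))"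
      "T b b' * T c c' = T c c' * T b b'"
      unfolding distrib_left distrib_right tm scl_add unfolding T_def
      by (simp_all only: EXs EYs E_idem sx sy tn_scl)
  qed
  then show ?thesis unfolding is_module_iff[OF n0] t hdim_tensor N_def[symmetric] p_def[symmetric]
    using ac_tensor(5)[OF w] by blast
qed

lemma tensor_iso:
  assumes "mod_iso n q X X'" "mod_iso n q Y Y'"
  shows "mod_iso n q (tensor X Y) (tensor X' Y')"
proof -
  have m: "is_module n q X" "is_module n q X'" "is_module n q Y" "is_module n q Y'"
    using assms unfolding mod_iso_iff by blast+
  note w = m[THEN is_module_wf]
  obtain F F' where F: "F \<in> hom X X'" "F' \<in> hom X' X" "F' * F = E (hdim X)" "F * F' = E (hdim X')"
    using assms(1) unfolding mod_iso_iff by blast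
  obtain G G' where G: "G \<in> hom Y Y'" "G' \<in> hom Y' Y" "G' * G = E (hdim Y)" "G * G' = E (hdim Y')"
    using assms(2) unfolding mod_iso_iff by blast
  let ?H = "tn (hdim X') (hdim X) (hdim Y') (hdim Y) F G"
  let ?K = "tn (hdim X) (hdim X') (hdim Y) (hdim Y') F' G'"
  have "?H \<in> hom (tensor X Y) (tensor X' Y')" "?K \<in> hom (tensor X' Y') (tensor X Y)"
    using hom_tensor w F G by blast+
  moreover have "?K * ?H = E (hdim (tensor X Y))" "?H * ?K = E (hdim (tensor X' Y'))"
    unfolding tn_mult homD(2)[OF F(1)] homD(2)[OF F(2)] homD(2)[OF G(1)] homD(2)[OF G(2)] F G
    by (simp_all add: tn_one)
  ultimately show ?thesis unfolding mod_iso_iff using tensor_module m by blast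
qed

lemma tensor_sum_left:
  assumes m: "is_module n q A" "is_module n q B" "is_module n q Y"
  shows "mod_iso n q (tensor (module_sum [A, B]) Y) (module_sum [tensor A Y, tensor B Y])"
proof -
  let ?S = "module_sum [A, B]" and ?p = "hdim Y"
  have mS: "is_module n q ?S" using is_module_sum2[OF n0] m by blast
  note w = m[THEN is_module_wf] and wS = is_module_wf[OF mS]
  obtain p1 q1 p2 q2 where "biprod ?S A B p1 q1 p2 q2" using biprod_module_sum2[OF w(1,2)] by blast
  note b = this[unfolded biprod_def]
  have E: "q1 * E (hdim ?S) = q1" "q2 * E (hdim ?S) = q2" "p1 * E (hdim A) = p1" "p2 * E (hdim B) = p2"
    using b homD(2) by blast+
  have "biprod (tensor ?S Y) (tensor A Y) (tensor B Y)
    (tn (hdim ?S) (hdim A) ?p ?p p1 (E ?p)) (tn (hdim A) (hdim ?S) ?p ?p q1 (E ?p))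
    (tn (hdim ?S) (hdim B) ?p ?p p2 (E ?p)) (tn (hdim B) (hdim ?S) ?p ?p q2 (E ?p))"
    unfolding biprod_def tn_mult E
    using hom_tensor[OF _ _ w(3) w(3) _ hom_id[OF w(3)]] b w wS
    by (simp add: tn_one tn_0 tn_add(1)[symmetric])
  then show ?thesis using biprod_sum_iso[OF n0] tensor_module m mS by blast
qed

lemma tensor_sum_right:
  assumes m: "is_module n q A" "is_module n q B" "is_module n q X"
  shows "mod_iso n q (tensor X (module_sum [A, B])) (module_sum [tensor X A, tensor X B])"
proof -
  let ?S = "module_sum [A, B]" and ?p = "hdim X"
  have mS: "is_module n q ?S" using is_module_sum2[OF n0] m by blast
  note w = m[THEN is_module_wf] and wS = is_module_wf[OF mS]
  obtain p1 q1 p2 q2 where "biprod ?S A B p1 q1 p2 q2" using biprod_module_sum2[OF w(1,2)] by blast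
  note b = this[unfolded biprod_def]
  have E: "q1 * E (hdim ?S) = q1" "q2 * E (hdim ?S) = q2" "p1 * E (hdim A) = p1" "p2 * E (hdim B) = p2"
    using b homD(2) by blast+
  have "biprod (tensor X ?S) (tensor X A) (tensor X B)
    (tn ?p ?p (hdim ?S) (hdim A) (E ?p) p1) (tn ?p ?p (hdim A) (hdim ?S) (E ?p) q1)
    (tn ?p ?p (hdim ?S) (hdim B) (E ?p) p2) (tn ?p ?p (hdim B) (hdim ?S) (E ?p) q2)"
    unfolding biprod_def tn_mult E
    using hom_tensor[OF w(3) w(3) _ _ hom_id[OF w(3)]] b w wS
    by (simp add: tn_one tn_0 tn_add(2)[symmetric])
  then show ?thesis using biprod_sum_iso[OF n0] tensor_module m mS by blast
qed

end

section \<open>Simple modules\<close>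

lemma opm_un: "j < dim_col A \<Longrightarrow> opm A * un j k = (\<Sum>i<dim_row A. A $$ (i, j) *o un i k)"
proof -
  assume j: "j < dim_col A"
  have "opm A * un j k = (\<Sum>i<dim_row A. \<Sum>j'<dim_col A. if j' = j then A $$ (i, j') *o un i k else 0)"
    unfolding opm_sum sum_distrib_right by (intro sum.cong refl) simp
  then show ?thesis using j by simp
qed

lemma basis_mat_un:
  assumes "j < N" "\<And>i. i < N \<Longrightarrow> f (Suc j) (Suc i) = (if i = t then c else 0)"
  shows "opm (basis_mat N f) * un j k = (if t < N then c *o un t k else 0)"
proof -
  have "opm (basis_mat N f) * un j k = (\<Sum>i<N. f (Suc j) (Suc i) *o un i k)"
    using assms(1) by (subst opm_un) (auto simp: basis_mat_def)
  also have "\<dots> = (\<Sum>i<N. if i = t then c *o un i k else 0)"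
    using assms(2) by (intro sum.cong refl) auto
  finally show ?thesis by simp
qed

lemma op_eqI:
  assumes "F * E N = F" "G * E N = G" "\<And>j. j < N \<Longrightarrow> F * un j 0 = G * un j 0"
  shows "F = G"
proof -
  have e: "H * E N = (\<Sum>j<N. H * un j 0 * un 0 j)" for H :: "'a lop"
    unfolding E_sum sum_distrib_left by (intro sum.cong refl) (simp add: mult.assoc)
  have "F * E N = G * E N" unfolding e using assms(3) by (intro sum.cong refl) simp
  then show ?thesis using assms by simp
qed

context prim_root
begin

abbreviation "Vm \<equiv> simple_module q"

lemma Vm_dim [simp]: "hdim (Vm l r) = l"
  by (simp add: simple_module_def)

lemma Vm_wf: "wf_act (Vm l r)"
  by (auto simp: wf_act_def simple_module_def basis_mat_def)

lemma alpha_0 [simp]: "alpha q 0 l = 0" by (simp add: alpha_def)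

definition qp :: "int \<Rightarrow> 'k" where "qp x = q powi x"

lemma qp_add: "qp (x + y) = qp x * qp y"
  and qp_nat: "qp (int k) = q ^ k"
  and qp_0 [simp]: "qp 0 = 1"
  and qp_1 [simp]: "qp 1 = q"
  and qp_n [simp]: "qp x ^ n = 1"
  and qp_nz [simp]: "qp x \<noteq> 0"
  and qp_eq_1: "qp x = 1 \<longleftrightarrow> int n dvd x"
  and qp_eq: "qp x = qp y \<longleftrightarrow> int n dvd x - y"
  unfolding qp_def by (simp_all add: power_int_add q_powi_n q_powi_eq_1 q_powi_eq)

lemma qp_diff: "qp (x - y) = qp x / qp y"
  using qp_add[of "x - y" y] by (simp add: field_simps)

lemma qp_Suc: "q * qp x = qp (x + 1)" unfolding qp_add by simp

lemma alpha_qp: "alpha q i l = qint q i * (1 - qp (int i - int l))"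
  by (simp add: alpha_def qp_def)

lemma Vm_act:
  assumes "j < l"
  shows "ac (Vm l r) GA * un j k = (if j + 1 < l then un (j + 1) k else 0)"
    "ac (Vm l r) GB * un j k = qp (r + int j) *o un j k"
    "ac (Vm l r) GC * un j k = qp (int j + 1 - r - int l) *o un j k"
    "ac (Vm l r) GD * un j k = alpha q j l *o un (j - 1) k"
proof -
  have a: "ac (Vm l r) g = opm (basis_mat l (case g of
        GA \<Rightarrow> (\<lambda>j i. if i = j + 1 then 1 else 0)
      | GB \<Rightarrow> (\<lambda>j i. if i = j then qp (r + int j - 1) else 0)
      | GC \<Rightarrow> (\<lambda>j i. if i = j then qp (int j - r - int l) else 0)
      | GD \<Rightarrow> (\<lambda>j i. if 1 < j \<and> i = j - 1 then alpha q (j - 1) l else 0)))" for g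
    unfolding qp_def by (simp add: ac_def simple_module_def)
  show "ac (Vm l r) GA * un j k = (if j + 1 < l then un (j + 1) k else 0)"
    unfolding a by (subst basis_mat_un[where t = "j + 1" and c = 1]) (use assms in auto)
  show "ac (Vm l r) GB * un j k = qp (r + int j) *o un j k"
    unfolding a by (subst basis_mat_un[where t = j and c = "qp (r + int j)"]) (use assms in auto)
  show "ac (Vm l r) GC * un j k = qp (int j + 1 - r - int l) *o un j k"
    unfolding a by (subst basis_mat_un[where t = j and c = "qp (int j + 1 - r - int l)"]) (use assms in \<open>auto simp: algebra_simps\<close>)
  show "ac (Vm l r) GD * un j k = alpha q j l *o un (j - 1) k"
    unfolding a by (subst basis_mat_un[where t = "j - 1" and c = "alpha q j l"]) (use assms in \<open>cases j; auto\<close>)+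
qed

text \<open>This is d a - q a d = 1 - b c, read on basis vector number j counted from 0: q^(2j+1-l)
  is the eigenvalue of b c there.\<close>

lemma alpha_Suc: "alpha q (Suc j) l - q * alpha q j l = 1 - qp (2 * int j + 1 - int l)"
proof -
  define u where "u = qp (int j - int l)"
  have "int (Suc j) - int l = 1 + (int j - int l)" "2 * int j + 1 - int l = (1 + (int j - int l)) + int j" by simp_all
  then have u1: "qp (int (Suc j) - int l) = q * u" and u2: "qp (2 * int j + 1 - int l) = q * u * q ^ j"
    unfolding u_def by (simp_all only: qp_add qp_1 qp_nat)
  have "alpha q (Suc j) l - q * alpha q j l = (1 + q * qint q j) * (1 - q * u) - q * (qint q j * (1 - u))"
    unfolding alpha_qp qint_Suc u_def[symmetric] u1 ..
  also have "\<dots> = 1 - q * u * (1 - qint q j * (1 - q))" by (simp add: algebra_simps)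
  also have "\<dots> = 1 - q * u * q ^ j" unfolding qint_geom by simp
  finally show ?thesis unfolding u2 .
qed

lemma alpha_l [simp]: "alpha q l l = 0" by (simp add: alpha_def)

lemma alpha_nz: "0 < i \<Longrightarrow> i < l \<Longrightarrow> l \<le> n \<Longrightarrow> alpha q i l \<noteq> 0"
proof -
  assume i: "0 < i" "i < l" "l \<le> n"
  then have "\<not> n dvd i" by (auto dest: dvd_imp_le)
  moreover have "\<not> int n dvd int i - int l"
  proof
    assume "int n dvd int i - int l"
    then have "int n dvd int l - int i" by (simp add: dvd_diff_commute)
    then have "int n \<le> int l - int i" using i by (intro zdvd_imp_le) auto
    then show False using i by simp
  qed
  ultimately show ?thesis unfolding alpha_qp using qp_eq_1[of "int i - int l"] qint_eq_0 by auto
qed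

lemma Vm_ax: "j < l \<Longrightarrow> ac (Vm l r) GA ^ x * un j k = (if j + x < l then un (j + x) k else 0)"
proof (induction x)
  case (Suc x)
  then show ?case by (auto simp: mult.assoc Vm_act)
qed simp

text \<open>\<open>c\<close> is a product of values \<open>alpha\<close>, which for l \<le> n stay
  nonzero until the lowest vector is passed. From then on \<open>j - x\<close> is truncated to 0 and
  c = 0.\<close>

lemma Vm_dx: "j < l \<Longrightarrow> \<exists>c. ac (Vm l r) GD ^ x * un j k = c *o un (j - x) k \<and> (l \<le> n \<longrightarrow> (c = 0 \<longleftrightarrow> j < x))"
proof (induction x)
  case 0
  then show ?case by (intro exI[of _ 1]) simp
next
  case (Suc x)
  then obtain c where c: "ac (Vm l r) GD ^ x * un j k = c *o un (j - x) k" "l \<le> n \<longrightarrow> (c = 0 \<longleftrightarrow> j < x)" by blast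
  have "ac (Vm l r) GD ^ Suc x * un j k = (c * alpha q (j - x) l) *o un (j - Suc x) k"
  proof -
    have "ac (Vm l r) GD ^ Suc x * un j k = ac (Vm l r) GD * (c *o un (j - x) k)"
      by (simp only: power_Suc mult.assoc c(1))
    also have "\<dots> = c *o alpha q (j - x) l *o un (j - x - 1) k"
      using Suc.prems by (simp only: scl_mult_right) (subst Vm_act; simp)
    finally show ?thesis by simp
  qed
  moreover have "c * alpha q (j - x) l = 0 \<longleftrightarrow> j < Suc x" if "l \<le> n"
    using c(2) that alpha_nz[of "j - x" l] Suc.prems by (cases "j - x = 0") auto
  ultimately show ?case by blast
qed

lemma Vm_module:
  assumes "1 \<le> l" "l \<le> n"
  shows "is_module n q (Vm l r)"
proof -
  let ?V = "Vm l r"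
  have EE: "ac ?V g * E l = ac ?V g" for g using ac_E(2)[OF Vm_wf, of l r g] by simp
  have EEx: "x * ac ?V g * E l = x * ac ?V g" for g x by (simp add: mult.assoc EE)
  have EEp: "ac ?V g ^ n * E l = ac ?V g ^ n" for g using E_pow[OF EE n0] .
  have bp: "ac ?V GB ^ x * un j 0 = (qp (r + int j)) ^ x *o un j 0"
    "ac ?V GC ^ x * un j 0 = (qp (int j + 1 - r - int l)) ^ x *o un j 0" if "j < l" for x j
    by (induction x) (simp_all add: mult.assoc Vm_act[OF that] mult.commute)
  have "ops_module n q l (ac ?V GA) (ac ?V GB) (ac ?V GC) (ac ?V GD)"
    unfolding ops_module_def
  proof (intro conjI)
    show "ac ?V GB * ac ?V GA = q *o (ac ?V GA * ac ?V GB)"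
      by (rule op_eqI[of _ l]) (simp_all add: EEx mult.assoc EE Vm_act qp_Suc add_ac)
    show "ac ?V GC * ac ?V GA = q *o (ac ?V GA * ac ?V GC)"
      by (rule op_eqI[of _ l]) (simp_all add: EEx mult.assoc EE Vm_act qp_Suc algebra_simps)
    show "ac ?V GD * ac ?V GB = q *o (ac ?V GB * ac ?V GD)"
    proof (rule op_eqI[of _ l])
      fix j assume j: "j < l"
      show "ac ?V GD * ac ?V GB * un j 0 = q *o (ac ?V GB * ac ?V GD) * un j 0"
      proof (cases j)
        case (Suc i)
        have "qp (r + int (Suc i)) = q * qp (r + int i)" unfolding qp_Suc by (simp add: algebra_simps)
        then show ?thesis using j Suc by (simp only: mult.assoc Vm_act scl_mult_right scl_mult_left scl_scl) (simp add: Vm_act mult.assoc ac_simps)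
      qed (use j in \<open>simp add: mult.assoc Vm_act\<close>)
    qed (simp_all add: mult.assoc EE)
    show "ac ?V GD * ac ?V GC = q *o (ac ?V GC * ac ?V GD)"
    proof (rule op_eqI[of _ l])
      fix j assume j: "j < l"
      show "ac ?V GD * ac ?V GC * un j 0 = q *o (ac ?V GC * ac ?V GD) * un j 0"
      proof (cases j)
        case (Suc i)
        have "qp (int (Suc i) + 1 - r - int l) = q * qp (int i + 1 - r - int l)" unfolding qp_Suc by (simp add: algebra_simps)
        then show ?thesis using j Suc by (simp only: mult.assoc Vm_act scl_mult_right scl_mult_left scl_scl) (simp add: Vm_act mult.assoc ac_simps)
      qed (use j in \<open>simp add: mult.assoc Vm_act\<close>)
    qed (simp_all add: mult.assoc EE)
    show "ac ?V GB * ac ?V GC = ac ?V GC * ac ?V GB"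
      by (rule op_eqI[of _ l]) (simp_all add: mult.assoc EE Vm_act ac_simps)
    show "ac ?V GA ^ n = 0"
      by (rule op_eqI[of _ l]) (use assms in \<open>simp_all add: EEp Vm_ax\<close>)
    show "ac ?V GB ^ n = E l" "ac ?V GC ^ n = E l"
      by (rule op_eqI[of _ l]; simp add: EEp bp qp_n)+
    show "ac ?V GD ^ n = 0"
    proof (rule op_eqI[of _ l])
      fix j assume j: "j < l"
      obtain c where "ac ?V GD ^ n * un j 0 = c *o un (j - n) 0" "c = 0 \<longleftrightarrow> j < n" using Vm_dx[OF j, of r n 0] assms by blast
      then show "ac ?V GD ^ n * un j 0 = 0 * un j 0" using j assms by simp
    qed (simp_all add: EEp)
    show "ac ?V GD * ac ?V GA - q *o (ac ?V GA * ac ?V GD) = E l - ac ?V GB * ac ?V GC"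
    proof (rule op_eqI[of _ l])
      fix j assume j: "j < l"
      have "ac ?V GD * (ac ?V GA * un j 0) = alpha q (Suc j) l *o un j 0"
      proof (cases "Suc j < l")
        case False
        then have "Suc j = l" using j by simp
        then show ?thesis using j alpha_l[of l] by (simp add: Vm_act)
      qed (use j in \<open>simp add: Vm_act\<close>)
      moreover have "ac ?V GA * (ac ?V GD * un j 0) = alpha q j l *o un j 0"
        using j by (cases j) (simp_all add: Vm_act)
      moreover have "ac ?V GB * (ac ?V GC * un j 0) = qp (2 * int j + 1 - int l) *o un j 0"
      proof -
        have "qp (int j + 1 - r - int l) * qp (r + int j) = qp (2 * int j + 1 - int l)"
          by (subst qp_add[symmetric]) (simp add: algebra_simps)
        then show ?thesis using j by (simp add: Vm_act)
      qed
      moreover have "alpha q (Suc j) l *o un j 0 - (q * alpha q j l) *o un j 0 =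
          un j 0 - qp (2 * int j + 1 - int l) *o (un j 0 :: 'k lop)"
        unfolding scl_diff_left[symmetric] alpha_Suc by (simp add: scl_diff_left)
      ultimately show "(ac ?V GD * ac ?V GA - q *o (ac ?V GA * ac ?V GD)) * un j 0 = (E l - ac ?V GB * ac ?V GC) * un j 0"
        using j by (simp add: left_diff_distrib mult.assoc)
    qed (simp_all add: left_diff_distrib mult.assoc EE)
  qed
  then show ?thesis using is_module_iff[OF n0, of q ?V] Vm_wf[of l r] by simp
qed

text \<open>The highest basis vector occurring in a nonzero value \<open>u\<close> of
  \<open>F\<close> is taken down to the lowest one by a power of \<open>d\<close> that kills all
  other terms of \<open>u\<close>; powers of \<open>a\<close> then reach the whole basis. The same
  words applied in \<open>X\<close> give the section.\<close>

lemma Vm_simple: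
  assumes l: "1 \<le> l" "l \<le> n"
  shows "simp_mod n q (Vm l r)"
  unfolding simp_mod_def
proof (intro conjI allI impI Vm_module l)
  let ?V = "Vm l r"
  fix X F assume X: "is_module n q X" and F: "F \<in> hom X ?V" and F0: "F \<noteq> 0"
  have "\<exists>k<hdim X. F * un k 0 \<noteq> 0"
  proof (rule ccontr)
    assume "\<not> (\<exists>k<hdim X. F * un k 0 \<noteq> 0)"
    then have z: "F * un j 0 = 0 * un j 0" if "j < hdim X" for j using that by simp
    have "F = 0" by (rule op_eqI[OF homD(2)[OF F] mult_zero_left]) (rule z)
    with F0 show False ..
  qed
  then obtain k where k: "k < hdim X" "F * un k 0 \<noteq> 0" by blast
  define u where "u = F * un k 0"
  have "u = E l * u * E 1"
  proof -
    have "E l * u = u" unfolding u_def using assoc_ext[OF homD(1)[OF F]] by simp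
    moreover have "u * E 1 = u" unfolding u_def by (simp add: mult.assoc)
    ultimately show ?thesis by simp
  qed
  then have u: "u = (\<Sum>j<l. entry u j 0 *o un j 0)" unfolding sandwich_expand by simp
  define J where "J = {j. j < l \<and> entry u j 0 \<noteq> 0}"
  have "J \<noteq> {}" using u k(2) unfolding J_def u_def[symmetric] by force
  moreover have fJ: "finite J" unfolding J_def by simp
  ultimately have mJ: "Max J \<in> J" by (rule Max_in[rotated])
  define m where "m = Max J"
  have m: "m < l" "entry u m 0 \<noteq> 0" using mJ by (auto simp: J_def m_def)
  have mx: "entry u j 0 = 0" if "j < l" "m < j" for j
  proof (rule ccontr)
    assume "entry u j 0 \<noteq> 0"
    with that have "j \<in> J" unfolding J_def by simp
    from Max_ge[OF fJ this] that show False unfolding m_def by simp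
  qed
  have dz: "ac ?V GD ^ m * un j 0 = (0 :: 'k lop)" if "j < m" for j
  proof -
    have jl: "j < l" using that m by simp
    show ?thesis using Vm_dx[OF jl, of r m 0] l that by auto
  qed
  obtain c where c: "ac ?V GD ^ m * un m 0 = c *o un 0 0" "c \<noteq> 0" using Vm_dx[OF m(1), of r m 0] l by auto
  define e where "e = entry u m 0 * c"
  have e0: "e \<noteq> 0" unfolding e_def using m(2) c(2) by simp
  have "ac ?V GD ^ m * u = (\<Sum>j<l. entry u j 0 *o (ac ?V GD ^ m * un j 0))"
    by (subst u) (simp add: sum_distrib_left)
  also have "\<dots> = (\<Sum>j<l. if j = m then e *o un 0 0 else 0)"
  proof (intro sum.cong refl)
    fix j assume "j \<in> {..<l}"
    then show "entry u j 0 *o (ac ?V GD ^ m * un j 0) = (if j = m then e *o un 0 0 else 0)"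
      using dz[of j] mx[of j] by (cases "j < m"; cases "j = m") (auto simp: c(1) e_def)
  qed
  also have "\<dots> = e *o un 0 0" using m(1) by simp
  finally have du: "ac ?V GD ^ m * u = e *o un 0 0" .
  define S where "S = (\<Sum>i<l. inverse e *o (ac X GA ^ i * (ac X GD ^ m * un k 0)) * un 0 i)"
  have hx: "F * (ac X g ^ i * v) = ac ?V g ^ i * (F * v)" for g i v
    using hom_pow[OF F, of g i] by (simp only: mult.assoc[symmetric])
  have "F * S = (\<Sum>i<l. inverse e *o (ac ?V GA ^ i * (ac ?V GD ^ m * u)) * un 0 i)"
    unfolding S_def sum_distrib_left
  proof (intro sum.cong refl)
    fix i
    have "F * (inverse e *o x * un 0 i) = inverse e *o (F * x * un 0 i)" for x
      by (simp only: scl_mult_left scl_mult_right mult.assoc)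
    then show "F * (inverse e *o (ac X GA ^ i * (ac X GD ^ m * un k 0)) * un 0 i) =
        inverse e *o (ac ?V GA ^ i * (ac ?V GD ^ m * u)) * un 0 i"
      unfolding u_def by (simp only: hx scl_mult_left)
  qed
  also have "\<dots> = (\<Sum>i<l. un i 0 * un 0 i)"
    using l by (intro sum.cong refl) (auto simp: du e0 Vm_ax)
  also have "\<dots> = E l" by (simp add: E_sum)
  finally show "epi (hdim ?V) F" unfolding epi_def by auto
qed

text \<open>\<open>Vm n r\<close> is generated by its lowest vector, which \<open>d\<close> kills. A
  lift of that vector need not be killed by \<open>d\<close>, but d^(n-1) a^(n-1) applied to it is,
  since d^n = 0; on the lowest vector of \<open>Vm n r\<close> this operator is a nonzero scalar
  because the chain has full length n.\<close>

lemma Vm_n_projm: "projm n q (Vm n r)"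
  unfolding projm_def
proof (intro conjI allI impI Vm_module)
  let ?V = "Vm n r"
  show "1 \<le> n" "n \<le> n" using n2 by simp_all
  fix X Y F H assume X: "is_module n q X" and Y: "is_module n q Y" and F: "F \<in> hom X Y" "epi (hdim Y) F" and H: "H \<in> hom ?V Y"
  define \<beta> where "\<beta> = qp r"
  define \<gamma> where "\<gamma> = qp (1 - r - int n)"
  define y where "y = H * un 0 0"
  have hH: "ac Y g * (H * v) = H * (ac ?V g * v)" for g v
    by (simp only: mult.assoc[symmetric] homD(3)[OF H])
  have hHp: "ac Y g ^ i * (H * v) = H * (ac ?V g ^ i * v)" for g i v
    by (simp only: mult.assoc[symmetric] hom_pow[OF H])
  have y: "wt Y \<beta> \<gamma> y" "y * un 0 0 = y"
    unfolding wt_def y_def using assoc_ext[OF homD(1)[OF H]]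
    by (simp_all add: hH Vm_act \<beta>_def \<gamma>_def mult.assoc)
  have r: "\<beta> ^ n = 1" "\<gamma> ^ n = 1" unfolding \<beta>_def \<gamma>_def by (rule qp_n)+
  obtain x where x: "wt X \<beta> \<gamma> x" "x * un 0 0 = x" "F * x = y" using lift_weight[OF X Y F y r] by blast
  obtain c where c: "ac ?V GD ^ (n - 1) * un (n - 1) 0 = c *o un 0 0" "c \<noteq> 0"
    using Vm_dx[of "n - 1" n r "n - 1" 0] n0 by auto
  define x' where "x' = inverse c *o (ac X GD ^ (n - 1) * (ac X GA ^ (n - 1) * x))"
  have "wt X (\<beta> * q ^ (n - 1) / q ^ (n - 1)) (\<gamma> * q ^ (n - 1) / q ^ (n - 1)) (ac X GD ^ (n - 1) * (ac X GA ^ (n - 1) * x))"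
    by (rule wt_dx[OF X wt_ax[OF X x(1)]])
  then have x'w: "wt X \<beta> \<gamma> x'" unfolding x'_def wt_def by (simp add: mult.commute)
  have x'u: "x' * un 0 0 = x'" unfolding x'_def by (simp add: mult.assoc x(2))
  have dx': "ac X GD * x' = 0"
  proof -
    have "ac X GD * ac X GD ^ (n - 1) = ac X GD ^ n" using n0 by (metis power_Suc Suc_pred')
    from assoc_ext[OF this] have "ac X GD * (ac X GD ^ (n - 1) * v) = 0" for v unfolding rels(8)[OF X] .
    then show ?thesis unfolding x'_def by simp
  qed
  have hF: "F * (ac X g ^ i * v) = ac Y g ^ i * (F * v)" for g i v
    by (simp only: mult.assoc[symmetric] hom_pow[OF F(1)])
  have Fx': "F * x' = y"
    unfolding x'_def by (simp add: hF x(3)) (simp add: y_def hHp Vm_ax c(1)[simplified] c(2))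
  define K where "K = (\<Sum>j<n. ac X GA ^ j * x' * un 0 j)"
  have K: "K * un j 0 = ac X GA ^ j * x'" if "j < n" for j
  proof -
    have "K * un j 0 = (\<Sum>i<n. if i = j then ac X GA ^ i * x' else 0)"
      unfolding K_def sum_distrib_right by (intro sum.cong refl) (simp add: mult.assoc x'u)
    then show ?thesis using that by simp
  qed
  have KE: "K * E n = K" unfolding K_def sum_distrib_right by (intro sum.cong refl) (simp add: mult.assoc)
  have EK: "E (hdim X) * K = K"
    unfolding K_def sum_distrib_left by (intro sum.cong refl) (simp only: mult.assoc[symmetric] wtD(1)[OF wt_ax[OF X x'w], unfolded mult.assoc[symmetric]])
  have "K \<in> hom ?V X"
  proof (rule homI)
    fix g
    have VE: "ac ?V g * E n = ac ?V g" using ac_E(2)[OF Vm_wf, of n r g] by simp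
    show "K * ac ?V g = ac X g * K"
    proof (rule op_eqI[of _ n])
      fix j assume j: "j < n"
      note w = wtD[OF wt_ax[OF X x'w, of j]]
      have "K * (ac ?V g * un j 0) = ac X g * (ac X GA ^ j * x')"
      proof (cases g)
        case GA
        have "ac X GA * (ac X GA ^ j * x') = ac X GA ^ (j + 1) * x'" by (simp add: mult.assoc)
        then show ?thesis using j K[of "j + 1"] pow_ge_n(1)[OF X, of "j + 1" x'] unfolding GA by (auto simp: Vm_act)
      next
        case GB
        have "qp (r + int j) = \<beta> * q ^ j" unfolding \<beta>_def by (simp only: qp_add qp_nat)
        then show ?thesis unfolding GB w using j by (simp add: Vm_act K)
      next
        case GC
        have "qp (int j + 1 - r - int n) = qp ((1 - r - int n) + int j)" by (simp add: algebra_simps)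
        also have "\<dots> = \<gamma> * q ^ j" unfolding \<gamma>_def by (simp only: qp_add qp_nat)
        finally show ?thesis unfolding GC w using j by (simp add: Vm_act K)
      next
        case GD
        have "\<beta> * \<gamma> = qp (1 - int n)" unfolding \<beta>_def \<gamma>_def by (subst qp_add[symmetric]) simp
        moreover have "q ^ j / q * qp (1 - int n) = qp (int j - int n)"
        proof -
          have "qp (int j - int n) = qp ((int j - 1) + (1 - int n))" by simp
          also have "\<dots> = qp (int j - 1) * qp (1 - int n)" by (rule qp_add)
          also have "qp (int j - 1) = q ^ j / q" by (simp only: qp_diff qp_nat qp_1)
          finally show ?thesis ..
        qed
        ultimately have "cf j (\<beta> * \<gamma>) = alpha q j n" by (simp add: cf_def alpha_qp)
        then have "ac X GD * (ac X GA ^ j * x') = alpha q j n *o (ac X GA ^ (j - 1) * x')"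
          using d_ax[OF X x'w, of j] by (simp add: dx')
        then show ?thesis unfolding GD using j K[of "j - 1"] by (simp add: Vm_act)
      qed
      then show "K * ac ?V g * un j 0 = ac X g * K * un j 0" using K[OF j] by (simp add: mult.assoc)
    qed (simp_all add: mult.assoc KE VE)
  qed (simp_all add: KE EK)
  moreover have "F * K = H"
  proof (rule op_eqI[of _ n])
    show "H * E n = H" using homD(2)[OF H] by simp
    fix j assume j: "j < n"
    have "F * K * un j 0 = ac Y GA ^ j * y" by (simp add: mult.assoc K[OF j] hF Fx')
    also have "\<dots> = H * un j 0" using j by (simp add: y_def hHp Vm_ax)
    finally show "F * K * un j 0 = H * un j 0" .
  qed (simp add: mult.assoc KE)
  ultimately show "\<exists>K\<in>hom ?V X. F * K = H" by blast
qed

lemma P_cover: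
  assumes "projective_modules n q P" "1 \<le> l" "l \<le> n"
  shows "\<exists>\<pi>. cover n q (P l r) (Vm l r) \<pi>"
proof (cases "l = n")
  case True
  have "cover n q (Vm n r) (Vm n r) (E n)"
    unfolding cover_def
  proof (intro conjI allI impI)
    show "is_module n q (Vm n r)" "projm n q (Vm n r)" using Vm_n_projm Vm_module[of n r] n0 by auto
    show "E n \<in> hom (Vm n r) (Vm n r)" using hom_id[OF Vm_wf, of n r] by simp
    show "epi (hdim (Vm n r)) (E n)" unfolding epi_def by (intro exI[of _ "E n"]) simp
    fix X G assume "is_module n q X" "G \<in> hom X (Vm n r)" "epi (hdim (Vm n r)) (E n * G)"
    then show "epi (hdim (Vm n r)) G" using homD(1)[of G X "Vm n r"] by simp
  qed
  then show ?thesis using assms True by (auto simp: projective_modules_def)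
next
  case False
  then show ?thesis using assms projective_cover_cover[OF _ Vm_module[of l r]] unfolding projective_modules_def by auto
qed

lemma Vm_weight:
  assumes "x < l"
  shows "wt (Vm l r) (qp (r + int x)) (qp (int x + 1 - r - int l)) (un x 0)"
    "ac (Vm l r) GA * ac (Vm l r) GD * un x 0 = alpha q x l *o un x 0"
  using assms by (simp add: wt_def Vm_act) (cases x; use assms in \<open>simp add: mult.assoc Vm_act\<close>)

end

section \<open>Twisting by the divided power \<open>a\<^sup>n / (n)!\<close>\<close>

context prim_root
begin

lemma qcommute_pow:
  assumes "B * P = c *o (P * B)"
  shows "B * P ^ m = c ^ m *o (P ^ m * B)"
proof (induction m)
  case (Suc m)
  have "B * P ^ Suc m = (B * P) * P ^ m" by (simp add: mult.assoc)
  also have "\<dots> = c *o (P * (B * P ^ m))" unfolding assms by (simp add: mult.assoc)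
  also have "\<dots> = c ^ Suc m *o (P ^ Suc m * B)" unfolding Suc by (simp add: mult.assoc)
  finally show ?case .
qed simp

text \<open>One computation for both tensor factors: it is applied with \<open>Z\<close>,
  \<open>Y\<close> and with \<open>U\<close>, \<open>X\<close> in the roles of \<open>Op\<close>,
  \<open>P\<close>.\<close>

lemma qcommutator_pow:
  assumes O: "Op * P = q *o (P * Op) + A - B" and A: "A * P = P * A" and B: "B * P = q ^ 2 *o (P * B)"
  shows "Op * P ^ m = q ^ m *o (P ^ m * Op) + qint q m *o (P ^ (m - 1) * (A - q ^ (m - 1) *o B))"
proof (induction m)
  case (Suc m)
  have "Op * P ^ Suc m = (Op * P) * P ^ m" by (simp add: mult.assoc)
  also have "\<dots> = q *o (P * (Op * P ^ m)) + A * P ^ m - B * P ^ m"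
    unfolding O by (simp add: distrib_right left_diff_distrib mult.assoc)
  also have "A * P ^ m = P ^ m * A" using qcommute_pow[of A P 1 m] A by simp
  also have "B * P ^ m = (q ^ m * q ^ m) *o (P ^ m * B)"
    unfolding qcommute_pow[OF B] by (simp add: power2_eq_square power_mult_distrib)
  also have "q *o (P * (Op * P ^ m)) = q ^ Suc m *o (P ^ Suc m * Op) + (q * qint q m) *o (P ^ m * A)
      - (q ^ m * qint q m) *o (P ^ m * B)"
  proof (cases m)
    case (Suc j)
    then show ?thesis unfolding \<open>Op * P ^ m = _\<close>
      by (simp add: distrib_left right_diff_distrib scl_add scl_diff mult.assoc ac_simps)
  qed simp
  finally have "Op * P ^ Suc m = q ^ Suc m *o (P ^ Suc m * Op) + (1 + q * qint q m) *o (P ^ m * A)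
      - (q ^ m * (qint q m + q ^ m)) *o (P ^ m * B)"
    by (simp add: scl_add_left distrib_left algebra_simps del: qint_simps)
  then show ?case unfolding qint_Suc[symmetric] qint_simps(2)[symmetric]
    by (simp add: right_diff_distrib scl_diff mult.commute del: qint_simps)
qed simp

text \<open>The intended reading is X = a \<otimes> b, Y = 1 \<otimes> a, U = d \<otimes> c, Z = 1
  \<otimes> d, G1 = b c \<otimes> 1, G2 = 1 \<otimes> b c, with \<open>I\<close> the identity of the
  tensor product. So X + Y is the action of a, U + Z that of d and G1 G2 that of b c.\<close>

context
  fixes X Y U Z G1 G2 I :: "'k lop" and k
  assumes XY: "X * Y = q *o (Y * X)" and ZY: "Z * Y = q *o (Y * Z) + I - G2" and ZX: "Z * X = q *o (X * Z)"
    and UX: "U * X = q *o (X * U) + G2 - G1 * G2" and UY: "U * Y = q *o (Y * U)"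
    and G2Y: "G2 * Y = q ^ 2 *o (Y * G2)" and G2X: "G2 * X = X * G2"
    and G1X: "G1 * X = q ^ 2 *o (X * G1)" and G1Y: "G1 * Y = Y * G1"
    and I: "I * X = X" "I * Y = Y * I" and X0: "X ^ n = 0" and Y0: "Y ^ n = 0" and k: "n = Suc k"
begin

lemma mono_mult: "(Y ^ m * X ^ i) * (Y ^ p * X ^ j) = q ^ (i * p) *o (Y ^ (m + p) * X ^ (i + j))"
proof -
  have "X ^ i * Y ^ p = q ^ (i * p) *o (Y ^ p * X ^ i)"
  proof (induction i)
    case (Suc i)
    have "X ^ Suc i * Y ^ p = X * (X ^ i * Y ^ p)" by (simp add: mult.assoc)
    also have "\<dots> = q ^ (i * p) *o ((X * Y ^ p) * X ^ i)" unfolding Suc by (simp add: mult.assoc)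
    also have "\<dots> = q ^ (Suc i * p) *o (Y ^ p * X ^ Suc i)"
      unfolding qcomm_pow[OF XY] by (simp add: mult.assoc power_add ac_simps)
    finally show ?case .
  qed simp
  from assoc_ext[OF this, of "X ^ j"] show ?thesis
    by (simp add: mult.assoc power_add)
qed

lemma pow_0: "n \<le> i \<Longrightarrow> X ^ i = 0" "n \<le> i \<Longrightarrow> Y ^ i = 0"
  using power_add[of X "i - n" n] power_add[of Y "i - n" n] X0 Y0 by simp_all

lemma mono_zero: "2 * n \<le> Suc (m + i + p + j) \<Longrightarrow> (Y ^ m * X ^ i) * (Y ^ p * X ^ j) = 0"
  unfolding mono_mult using pow_0(1)[of "i + j"] pow_0(2)[of "m + p"] by (cases "n \<le> i + j") auto

text \<open>\<open>TN\<close> is \<open>(X + Y)\<^sup>n / (n)!\<close> expanded by the \<open>q\<close>-binomial theorem, without the terms \<open>X\<^sup>n\<close> and \<open>Y\<^sup>n\<close>.\<close>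

definition "TN = (\<Sum>j<k. inverse (qf (Suc j) * qf (k - j)) *o (Y ^ (k - j) * X ^ Suc j))"

text \<open>\<open>Z\<close> lowers the exponent of \<open>Y\<close> and \<open>U\<close> that of
  \<open>X\<close>, each by \<open>qcommutator_pow\<close>.\<close>

lemma comm_mono:
  "(U + Z) * (Y ^ m * X ^ Suc j) = q ^ (m + Suc j) *o (Y ^ m * X ^ Suc j * (U + Z))
    + qint q m *o (Y ^ (m - 1) * X ^ Suc j * (1 - q ^ (m - 1) *o G2))
    + (q ^ m * qint q (Suc j)) *o (Y ^ m * X ^ j * (G2 - q ^ j *o (G1 * G2)))"
proof -
  have IX: "I * X ^ Suc j = X ^ Suc j" using assoc_ext[OF I(1)] by simp
  have G2X': "G2 * X ^ Suc j = X ^ Suc j * G2" using qcommute_pow[of G2 X 1 "Suc j"] G2X by simp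
  have "Z * (Y ^ m * X ^ Suc j) = (Z * Y ^ m) * X ^ Suc j" by (simp only: mult.assoc)
  also have "\<dots> = q ^ m *o (Y ^ m * (Z * X ^ Suc j)) + qint q m *o (Y ^ (m - 1) * (I * X ^ Suc j - q ^ (m - 1) *o (G2 * X ^ Suc j)))"
    unfolding qcommutator_pow[OF ZY I(2) G2Y] by (simp only: distrib_right left_diff_distrib scl_mult_left mult.assoc)
  also have "Z * X ^ Suc j = q ^ Suc j *o (X ^ Suc j * Z)" by (rule qcommute_pow[OF ZX])
  also have "I * X ^ Suc j - q ^ (m - 1) *o (G2 * X ^ Suc j) = X ^ Suc j * (1 - q ^ (m - 1) *o G2)"
    unfolding IX G2X' by (simp only: right_diff_distrib mult_1_right scl_mult_right)
  finally have z: "Z * (Y ^ m * X ^ Suc j) = q ^ (m + Suc j) *o (Y ^ m * X ^ Suc j * Z)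
    + qint q m *o (Y ^ (m - 1) * X ^ Suc j * (1 - q ^ (m - 1) *o G2))"
    by (simp only: scl_mult_right scl_scl power_add mult.assoc)
  have G2X1: "G2 * X = X * G2" by (rule G2X)
  have GG: "G1 * G2 * X = q ^ 2 *o (X * (G1 * G2))"
    by (simp only: mult.assoc G2X) (simp only: mult.assoc[symmetric] G1X scl_mult_left)
  have "U * (Y ^ m * X ^ Suc j) = (U * Y ^ m) * X ^ Suc j" by (simp only: mult.assoc)
  also have "\<dots> = q ^ m *o (Y ^ m * (U * X ^ Suc j))" unfolding qcommute_pow[OF UY] by (simp only: scl_mult_left mult.assoc)
  also have "U * X ^ Suc j = q ^ Suc j *o (X ^ Suc j * U) + qint q (Suc j) *o (X ^ j * (G2 - q ^ j *o (G1 * G2)))"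
    using qcommutator_pow[OF UX G2X1 GG, of "Suc j"] by (simp only: diff_Suc_1)
  finally have u: "U * (Y ^ m * X ^ Suc j) = q ^ (m + Suc j) *o (Y ^ m * X ^ Suc j * U)
    + (q ^ m * qint q (Suc j)) *o (Y ^ m * X ^ j * (G2 - q ^ j *o (G1 * G2)))"
    by (simp only: distrib_left scl_add scl_mult_right scl_scl power_add mult.assoc)
  show ?thesis unfolding distrib_right z u distrib_left scl_add by (simp only: ac_simps)
qed

text \<open>Formally, the commutator of d with a^n / (n)! is a^k (1 - q^k b c) / (k)!, because the
  factor (n) cancels. The terms \<open>Y\<close> and \<open>X\<close> to the power n, absent from
  \<open>TN\<close>, would have contributed the two expressions that are subtracted.\<close>

lemma twist_comm:
  "qf k *o ((U + Z) * TN - TN * (U + Z)) =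
    (X + Y) ^ k * (1 - q ^ k *o (G1 * G2)) - Y ^ k * (1 - q ^ k *o G2) - X ^ k * (G2 - q ^ k *o (G1 * G2))"
proof -
  define e where "e i = inverse (qf i * qf (k - i)) *o (Y ^ (k - i) * X ^ i)" for i
  define f where "f i = e i * (1 - q ^ (k - i) *o G2)" for i
  define s where "s i = q ^ (k - i) *o (e i * (G2 - q ^ i *o (G1 * G2)))" for i
  have fs: "f i + s i = e i * (1 - q ^ k *o (G1 * G2))" if "i \<le> k" for i
  proof -
    have "q ^ (k - i) * q ^ i = q ^ k" using that by (simp add: power_add[symmetric])
    then show ?thesis unfolding f_def s_def by (simp add: right_diff_distrib scl_diff)
  qed
  \<comment> \<open>The exponents add up to n, so q^n = 1 turns \<open>comm_mono\<close> into a true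
    commutator. Its two lower terms are indexed such that those with the same monomial
    \<open>e i\<close> combine by \<open>fs\<close>.\<close>
  have trm: "(U + Z) * (inverse (qf (Suc j) * qf (k - j)) *o (Y ^ (k - j) * X ^ Suc j))
      - (inverse (qf (Suc j) * qf (k - j)) *o (Y ^ (k - j) * X ^ Suc j)) * (U + Z) = f (Suc j) + s j" if j: "j < k" for j
  proof -
    define m where "m = k - Suc j"
    have m: "k - j = Suc m" "k - Suc j = m" "Suc m + Suc j = n" using j k by (simp_all add: m_def)
    have nz: "qint q (Suc m) \<noteq> 0" "qint q (Suc j) \<noteq> 0"
      using qint_eq_0[of "Suc m"] qint_eq_0[of "Suc j"] m(3) by (auto dest: dvd_imp_le)
    have c1: "inverse (qf (Suc j) * qf (Suc m)) * qint q (Suc m) = inverse (qf (Suc j) * qf m)"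
      using nz by (simp add: field_simps del: qint_simps)
    have c2: "inverse (qf (Suc j) * qf (Suc m)) * (q ^ Suc m * qint q (Suc j)) = q ^ Suc m * inverse (qf j * qf (Suc m))"
      using nz by (simp add: field_simps del: qint_simps)
    show ?thesis
      unfolding f_def s_def e_def m scl_mult_right scl_mult_left
        comm_mono[of "Suc m" j] qn mult_1_right scl_add scl_scl c1 c2 diff_Suc_1
      by (simp only: mult.commute[of "q ^ Suc m"] scl_mult_left scl_scl mult.assoc add.assoc add_diff_cancel_left')
  qed
  have "(U + Z) * TN - TN * (U + Z) = (\<Sum>j<k. f (Suc j) + s j)"
    unfolding TN_def sum_distrib_left sum_distrib_right sum_subtractf[symmetric] by (intro sum.cong refl trm) simp
  also have "\<dots> = (\<Sum>j<k. f (Suc j)) + (\<Sum>j<k. s j)" by (rule sum.distrib)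
  also have "(\<Sum>j<k. f (Suc j)) = (\<Sum>i<Suc k. f i) - f 0" by (subst sum.lessThan_Suc_shift) simp
  also have "(\<Sum>j<k. s j) = (\<Sum>i<Suc k. s i) - s k" by simp
  finally have "(U + Z) * TN - TN * (U + Z) = (\<Sum>i<Suc k. f i + s i) - f 0 - s k"
    by (simp only: sum.distrib) (simp only: algebra_simps)
  also have "(\<Sum>i<Suc k. f i + s i) = (\<Sum>i<Suc k. e i) * (1 - q ^ k *o (G1 * G2))"
    unfolding sum_distrib_right by (intro sum.cong refl fs) simp
  finally have 1: "(U + Z) * TN - TN * (U + Z) = (\<Sum>i<Suc k. e i) * (1 - q ^ k *o (G1 * G2)) - f 0 - s k" .
  have qk: "qf k \<noteq> 0" using qf_nz[of k] k by simp
  have "qf k *o (\<Sum>i<Suc k. e i) = (\<Sum>i\<le>k. gb k i *o (Y ^ (k - i) * X ^ i))"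
    unfolding scl_sum lessThan_Suc_atMost e_def
    using gb_div k by (intro sum.cong refl) (simp add: divide_inverse)
  then have 2: "qf k *o (\<Sum>i<Suc k. e i) = (X + Y) ^ k" unfolding q_binomial[OF XY] .
  have 3: "qf k *o f 0 = Y ^ k * (1 - q ^ k *o G2)" using qk by (simp add: f_def e_def)
  have 4: "qf k *o s k = X ^ k * (G2 - q ^ k *o (G1 * G2))" using qk by (simp add: s_def e_def)
  have "qf k *o ((\<Sum>i<Suc k. e i) * (1 - q ^ k *o (G1 * G2))) = (X + Y) ^ k * (1 - q ^ k *o (G1 * G2))"
    unfolding 2[symmetric] by (simp only: scl_mult_left)
  then show ?thesis unfolding 1 scl_diff 3 4 by (simp only:)
qed

text \<open>Formally, a commutes with its own divided power. The commutators of the single terms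
  telescope, and the two end terms contain X^n or Y^n and vanish.\<close>

lemma TN_add: "(X + Y) * TN = TN * (X + Y)"
proof -
  define g where "g i = inverse (qf i * qf (k - i)) *o (Y ^ (Suc k - i) * X ^ Suc i)" for i
  have trm: "(X + Y) * (inverse (qf (Suc j) * qf (k - j)) *o (Y ^ (k - j) * X ^ Suc j))
      - (inverse (qf (Suc j) * qf (k - j)) *o (Y ^ (k - j) * X ^ Suc j)) * (X + Y) =
      (1 - q) *o g j - (1 - q) *o g (Suc j)" if j: "j < k" for j
  proof -
    define m where "m = k - Suc j"
    have m: "k - j = Suc m" "k - Suc j = m" "Suc m + Suc j = n" "Suc k - j = Suc (Suc m)" "Suc k - Suc j = Suc m"
      using j k by (simp_all add: m_def)
    have nz: "qint q (Suc m) \<noteq> 0" "qint q (Suc j) \<noteq> 0"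
      using qint_eq_0[of "Suc m"] qint_eq_0[of "Suc j"] m(3) by (auto dest: dvd_imp_le)
    have c1: "inverse (qf (Suc j) * qf (Suc m)) * (q ^ Suc m - 1) = - ((1 - q) * inverse (qf (Suc j) * qf m))"
    proof -
      have "q ^ Suc m - 1 = - (qint q (Suc m) * (1 - q))" unfolding qint_geom by simp
      moreover have "c \<noteq> 0 \<Longrightarrow> inverse (x * (y * c)) * - (c * d) = - (d * inverse (x * y))" for c d x y :: 'k
        by simp
      ultimately show ?thesis unfolding qf_simps(2)[of m] using nz(1) by metis
    qed
    have c2: "inverse (qf (Suc j) * qf (Suc m)) * (1 - q ^ Suc j) = (1 - q) * inverse (qf j * qf (Suc m))"
    proof -
      have "c \<noteq> 0 \<Longrightarrow> inverse (x * c * y) * (c * d) = d * inverse (x * y)" for c d x y :: 'k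
        by simp
      then show ?thesis unfolding qint_geom[symmetric] qf_simps(2)[of j] using nz(2) by metis
    qed
    let ?M = "Y ^ Suc m * X ^ Suc j"
    have "X * ?M = q ^ Suc m *o (Y ^ Suc m * X ^ Suc (Suc j))"
      using mono_mult[of 0 1 "Suc m" "Suc j"] by simp
    moreover have "Y * ?M = Y ^ Suc (Suc m) * X ^ Suc j" by (simp add: mult.assoc)
    moreover have "?M * X = Y ^ Suc m * X ^ Suc (Suc j)" by (simp only: power_Suc2 mult.assoc)
    moreover have "?M * Y = q ^ Suc j *o (Y ^ Suc (Suc m) * X ^ Suc j)"
      using mono_mult[of "Suc m" "Suc j" 1 0] by simp
    ultimately have "(X + Y) * ?M - ?M * (X + Y) = (q ^ Suc m - 1) *o (Y ^ Suc m * X ^ Suc (Suc j))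
        + (1 - q ^ Suc j) *o (Y ^ Suc (Suc m) * X ^ Suc j)"
      by (simp only: distrib_left distrib_right scl_diff_left scl_simps(2)) (simp only: algebra_simps)
    then have "(X + Y) * (inverse (qf (Suc j) * qf (Suc m)) *o ?M) - (inverse (qf (Suc j) * qf (Suc m)) *o ?M) * (X + Y) =
      (inverse (qf (Suc j) * qf (Suc m)) * (q ^ Suc m - 1)) *o (Y ^ Suc m * X ^ Suc (Suc j))
        + (inverse (qf (Suc j) * qf (Suc m)) * (1 - q ^ Suc j)) *o (Y ^ Suc (Suc m) * X ^ Suc j)"
      by (simp only: scl_mult_right scl_mult_left scl_diff[symmetric] scl_add scl_scl)
    then show ?thesis unfolding g_def m c1 c2 scl_simps scl_scl by (simp only: ac_simps diff_conv_add_uminus)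
  qed
  have "(X + Y) * TN - TN * (X + Y) = (\<Sum>j<k. (1 - q) *o g j - (1 - q) *o g (Suc j))"
    unfolding TN_def sum_distrib_left sum_distrib_right sum_subtractf[symmetric] by (intro sum.cong refl trm) simp
  also have "\<dots> = (1 - q) *o g 0 - (1 - q) *o g k" by (rule sum_lessThan_telescope')
  also have "\<dots> = 0" using Y0 X0 unfolding g_def k by (simp del: power_Suc)
  finally show ?thesis by simp
qed

text \<open>Every term of \<open>TN\<close> has total degree n in \<open>X\<close> and
  \<open>Y\<close>, so the product has degree at least 2n - 1 and one of the two exponents reaches
  n.\<close>

lemma mono_TN: "n \<le> Suc (m + i) \<Longrightarrow> (Y ^ m * X ^ i) * TN = 0"
  unfolding TN_def sum_distrib_left
proof (rule sum.neutral, rule ballI)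
  fix j assume "n \<le> Suc (m + i)" "j \<in> {..<k}"
  then have "2 * n \<le> Suc (m + i + (k - j) + Suc j)" using k by simp
  from mono_zero[OF this] show "Y ^ m * X ^ i * (inverse (qf (Suc j) * qf (k - j)) *o (Y ^ (k - j) * X ^ Suc j)) = 0"
    by (simp only: scl_mult_right scl_simps)
qed

text \<open>\<open>W\<close> squares to zero, so 1 - W is invertible. The commutator of d with
  \<open>W\<close> is W1 - W2, the difference of the two corrections of d; as W W1 = 0 and W2 W = 0
  by degree, conjugation turns one correction into the other exactly and not only to first
  order.\<close>

lemma twist:
  fixes t :: 'k
  defines "W \<equiv> (t * qf k) *o TN"
  shows "(1 - W) * (X + Y) = (X + Y) * (1 - W)" "W * W = 0"
    "(1 - W) * (U + Z - t *o ((X + Y) ^ k * (1 - q ^ k *o (G1 * G2)))) =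
     (U + Z - t *o (X ^ k * (G2 - q ^ k *o (G1 * G2)) + Y ^ k * (1 - q ^ k *o G2))) * (1 - W)"
    "B * X = q *o (X * B) \<Longrightarrow> B * Y = q *o (Y * B) \<Longrightarrow> B * W = W * B"
    "I * W = W"
proof -
  have "I * (Y ^ m * X ^ Suc j) = Y ^ m * X ^ Suc j" for m j
    using assoc_ext[OF qcommute_pow[of I Y 1 m], of "X ^ Suc j"] assoc_ext[OF I(1), of "X ^ j"] I(2)
    by (simp add: mult.assoc)
  then show "I * W = W" unfolding W_def TN_def by (simp add: sum_distrib_left del: power_Suc)
  show "(1 - W) * (X + Y) = (X + Y) * (1 - W)"
    unfolding W_def left_diff_distrib right_diff_distrib scl_mult_left scl_mult_right TN_add by simp
  have TT: "TN * TN = 0"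
  proof -
    have "TN * TN = (\<Sum>j<k. inverse (qf (Suc j) * qf (k - j)) *o ((Y ^ (k - j) * X ^ Suc j) * TN))"
      by (subst (1) TN_def) (simp only: sum_distrib_right scl_mult_left)
    also have "\<dots> = 0"
    proof (rule sum.neutral, rule ballI)
      fix j assume "j \<in> {..<k}"
      then have "n \<le> Suc (k - j + Suc j)" using k by simp
      from mono_TN[OF this] show "inverse (qf (Suc j) * qf (k - j)) *o ((Y ^ (k - j) * X ^ Suc j) * TN) = 0" by (simp only: scl_simps)
    qed
    finally show ?thesis .
  qed
  then show WW: "W * W = 0" unfolding W_def by simp
  define W1 where "W1 = t *o ((X + Y) ^ k * (1 - q ^ k *o (G1 * G2)))"
  define W2 where "W2 = t *o (X ^ k * (G2 - q ^ k *o (G1 * G2)) + Y ^ k * (1 - q ^ k *o G2))"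
  have AT: "(X + Y) ^ m * TN = TN * (X + Y) ^ m" for m
    using qcommute_pow[of TN "X + Y" 1 m] TN_add by simp
  have "(X + Y) ^ k * TN = 0"
    unfolding q_binomial[OF XY] sum_distrib_right
    using mono_TN k by (intro sum.neutral ballI) simp
  then have "TN * (X + Y) ^ k = 0" unfolding AT .
  then have WW1: "W * W1 = 0" unfolding W_def W1_def by (simp add: mult.assoc[symmetric])
  have gm: "G1 * (Y ^ m * X ^ i) = q ^ (2 * i) *o (Y ^ m * X ^ i * G1)" "G2 * (Y ^ m * X ^ i) = q ^ (2 * m) *o (Y ^ m * X ^ i * G2)" for m i
  proof -
    have "G1 * Y ^ m = Y ^ m * G1" using qcommute_pow[of G1 Y 1 m] G1Y by simp
    from assoc_ext[OF this, of "X ^ i"] show "G1 * (Y ^ m * X ^ i) = q ^ (2 * i) *o (Y ^ m * X ^ i * G1)"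
      unfolding mult.assoc qcommute_pow[OF G1X] by (simp add: power_mult)
    have "G2 * X ^ i = X ^ i * G2" using qcommute_pow[of G2 X 1 i] G2X by simp
    then show "G2 * (Y ^ m * X ^ i) = q ^ (2 * m) *o (Y ^ m * X ^ i * G2)"
      using assoc_ext[OF qcommute_pow[OF G2Y, of m], of "X ^ i"] by (simp add: mult.assoc power_mult)
  qed
  \<comment> \<open>\<open>G2\<close> and G1 G2 pass every monomial up to a scalar, so the degree
    argument still applies with such a factor \<open>V\<close> in between.\<close>
  have XT: "X ^ k * (V * TN) = 0" "Y ^ k * (V * TN) = 0"
    if V: "\<And>m i. \<exists>c V'. V * (Y ^ m * X ^ i) = c *o (Y ^ m * X ^ i * V')" for V
  proof -
    have z: "P * (V * TN) = 0" if P: "\<And>j. j < k \<Longrightarrow> P * (Y ^ (k - j) * X ^ Suc j) = 0" for P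
      unfolding TN_def sum_distrib_left
    proof (rule sum.neutral, rule ballI)
      fix j assume j: "j \<in> {..<k}"
      obtain c V' where "V * (Y ^ (k - j) * X ^ Suc j) = c *o (Y ^ (k - j) * X ^ Suc j * V')" using V by blast
      then have "P * (V * (Y ^ (k - j) * X ^ Suc j)) = c *o (P * (Y ^ (k - j) * X ^ Suc j) * V')"
        by (simp only: scl_mult_right mult.assoc)
      then show "P * (V * (inverse (qf (Suc j) * qf (k - j)) *o (Y ^ (k - j) * X ^ Suc j))) = 0"
        using P[of j] j by (simp only: scl_mult_right lessThan_iff mult_zero_left scl_simps)
    qed
    show "X ^ k * (V * TN) = 0"
    proof (rule z)
      fix j assume "j < k"
      then show "X ^ k * (Y ^ (k - j) * X ^ Suc j) = 0" using mono_zero[of 0 k "k - j" "Suc j"] k by (simp del: power_Suc)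
    qed
    show "Y ^ k * (V * TN) = 0"
    proof (rule z)
      fix j assume "j < k"
      then show "Y ^ k * (Y ^ (k - j) * X ^ Suc j) = 0" using mono_zero[of k 0 "k - j" "Suc j"] k by (simp del: power_Suc)
    qed
  qed
  have G12: "G1 * G2 * (Y ^ m * X ^ i) = (q ^ (2 * m) * q ^ (2 * i)) *o (Y ^ m * X ^ i * (G1 * G2))" for m i
    unfolding mult.assoc[of G1 G2] gm(2) scl_mult_right
    using assoc_ext[OF gm(1)[of m i], of G2] by (simp add: mult.assoc)
  have 1: "X ^ k * (G2 * TN) = 0" by (rule XT(1)) (use gm(2) in blast)
  have 2: "X ^ k * (G1 * G2 * TN) = 0" by (rule XT(1)) (use G12 in blast)
  have 3: "Y ^ k * (G2 * TN) = 0" by (rule XT(2)) (use gm(2) in blast)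
  have 4: "Y ^ k * (1 * TN) = 0" by (rule XT(2)) (metis mult_1_left mult_1_right scl_simps(2))
  have W2W: "W2 * W = 0"
    unfolding W2_def W_def using 1 2 3 4
    by (simp add: distrib_right left_diff_distrib right_diff_distrib mult.assoc)
  have "(U + Z) * W - W * (U + Z) = t *o (qf k *o ((U + Z) * TN - TN * (U + Z)))"
    unfolding W_def by (simp add: scl_diff)
  also have "\<dots> = W1 - W2"
    unfolding twist_comm W1_def W2_def by (simp only: scl_diff scl_add) (simp only: algebra_simps)
  finally have c: "(U + Z) * W = W * (U + Z) + W1 - W2" by (simp add: diff_eq_eq add.commute add_diff_eq)
  have "(1 - W) * (U + Z - W1) = (U + Z) - W1 - W * (U + Z) + W * W1"
    by (simp only: left_diff_distrib right_diff_distrib mult_1_left) (simp only: algebra_simps)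
  moreover have "(U + Z - W2) * (1 - W) = (U + Z) - W2 - (U + Z) * W + W2 * W"
    by (simp only: left_diff_distrib right_diff_distrib mult_1_right) (simp only: algebra_simps)
  ultimately have "(1 - W) * (U + Z - W1) = (U + Z - W2) * (1 - W)"
    unfolding WW1 W2W c by (simp add: algebra_simps)
  then show "(1 - W) * (U + Z - t *o ((X + Y) ^ k * (1 - q ^ k *o (G1 * G2)))) =
     (U + Z - t *o (X ^ k * (G2 - q ^ k *o (G1 * G2)) + Y ^ k * (1 - q ^ k *o G2))) * (1 - W)"
    unfolding W1_def W2_def .
  assume BX: "B * X = q *o (X * B)" and BY: "B * Y = q *o (Y * B)"
  have "B * (Y ^ m * X ^ i) = q ^ (m + i) *o (Y ^ m * X ^ i * B)" for m i
    using assoc_ext[OF qcommute_pow[OF BY, of m], of "X ^ i"] qcommute_pow[OF BX, of i]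
    by (simp add: mult.assoc power_add)
  \<comment> \<open>Every term of \<open>TN\<close> has degree n, so \<open>B\<close> passes it with
    the factor q^n = 1.\<close>
  moreover have "q ^ (k - j + Suc j) = 1" if "j < k" for j
  proof -
    have "k - j + Suc j = n" using that k by simp
    then show ?thesis by (simp only: qn)
  qed
  ultimately have "B * (Y ^ (k - j) * X ^ Suc j) = Y ^ (k - j) * X ^ Suc j * B" if "j < k" for j
    using that by (simp only: scl_simps)
  then have "B * TN = TN * B" unfolding TN_def sum_distrib_left sum_distrib_right
    by (intro sum.cong refl) (simp only: scl_mult_left scl_mult_right lessThan_iff)
  then show "B * W = W * B" unfolding W_def by simp
qed

end

end

section \<open>Tensor products of two band modules\<close>

context prim_root
begin

text \<open>These are the hypotheses of the twist, together with the identification of the action of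
  the generators and the weights of \<open>X\<close> and \<open>Y\<close> under \<open>b\<close> and
  \<open>c\<close>.\<close>

lemma tensor_ops:
  assumes M: "is_module n q M" and M': "is_module n q M'"
  defines "t \<equiv> tn (hdim M) (hdim M) (hdim M') (hdim M')"
  defines "X \<equiv> t (ac M GA) (ac M' GB)" and "Y \<equiv> t (E (hdim M)) (ac M' GA)"
    and "U \<equiv> t (ac M GD) (ac M' GC)" and "Z \<equiv> t (E (hdim M)) (ac M' GD)"
    and "G1 \<equiv> t (ac M GB * ac M GC) (E (hdim M'))" and "G2 \<equiv> t (E (hdim M)) (ac M' GB * ac M' GC)"
    and "I \<equiv> E (hdim M * hdim M')"
  shows "X * Y = q *o (Y * X)" "Z * Y = q *o (Y * Z) + I - G2" "Z * X = q *o (X * Z)"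
    "U * X = q *o (X * U) + G2 - G1 * G2" "U * Y = q *o (Y * U)"
    "G2 * Y = q ^ 2 *o (Y * G2)" "G2 * X = X * G2" "G1 * X = q ^ 2 *o (X * G1)" "G1 * Y = Y * G1"
    "I * X = X" "I * Y = Y * I" "X ^ n = 0" "Y ^ n = 0"
    "ac (tensor M M') GA = X + Y" "ac (tensor M M') GD = U + Z"
    "ac (tensor M M') GB * ac (tensor M M') GC = G1 * G2"
    "ac (tensor M M') GB * X = q *o (X * ac (tensor M M') GB)" "ac (tensor M M') GB * Y = q *o (Y * ac (tensor M M') GB)"
    "ac (tensor M M') GC * X = q *o (X * ac (tensor M M') GC)" "ac (tensor M M') GC * Y = q *o (Y * ac (tensor M M') GC)"
proof -
  have r: "ops_module n q (hdim M) (ac M GA) (ac M GB) (ac M GC) (ac M GD)"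
      "ops_module n q (hdim M') (ac M' GA) (ac M' GB) (ac M' GC) (ac M' GD)"
    and wf: "wf_act M" "wf_act M'"
    using is_module_iff[of n q M] is_module_iff[of n q M'] M M' n0 by blast+
  have rl: "b * a = q *o (a * b)" "d * b = q *o (b * d)" "c * a = q *o (a * c)" "d * c = q *o (c * d)"
      "c * b = b * c" "d * a = q *o (a * d) + E N - b * c" "a ^ n = 0"
      "b * (a * x) = q *o (a * (b * x))" "c * (a * x) = q *o (a * (c * x))" "c * (b * x) = b * (c * x)"
    if "ops_module n q N a b c d" for N a b c d x
  proof -
    note o = that[unfolded ops_module_def]
    show *: "b * a = q *o (a * b)" "d * b = q *o (b * d)" "c * a = q *o (a * c)" "d * c = q *o (c * d)"
      "c * b = b * c" "a ^ n = 0" using o by auto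
    show "d * a = q *o (a * d) + E N - b * c" using o by (simp add: diff_eq_eq add.commute add_diff_eq)
    show "b * (a * x) = q *o (a * (b * x))" "c * (a * x) = q *o (a * (c * x))" "c * (b * x) = b * (c * x)"
      using assoc_ext[OF *(1), of x] assoc_ext[OF *(3), of x] assoc_ext[OF *(5), of x] by (simp_all add: mult.assoc)
  qed
  note R = rl[OF r(1)] rl[OF r(2)]
  note e = ac_E[OF wf(1)] ac_E[OF wf(2)]
  have e': "x * ac M g * E (hdim M) = x * ac M g" "x * ac M' g * E (hdim M') = x * ac M' g"
    "E (hdim M) * (ac M g * x) = ac M g * x" "E (hdim M') * (ac M' g * x) = ac M' g * x" for g x
    using assoc_ext[OF e(1)] assoc_ext[OF e(3)] by (simp_all add: mult.assoc e)
  note D = X_def Y_def U_def Z_def G1_def G2_def t_def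
  note S = tn_mult tn_scl tn_add tn_diff mult.assoc e e' E_idem scl_mult_left scl_mult_right scl_scl
  show "X * Y = q *o (Y * X)" "Z * X = q *o (X * Z)" "U * Y = q *o (Y * U)"
    "G2 * X = X * G2" "G1 * Y = Y * G1"
    unfolding D by (simp_all only: S R)
  show "G2 * Y = q ^ 2 *o (Y * G2)" "G1 * X = q ^ 2 *o (X * G1)"
    unfolding D power2_eq_square by (simp_all only: S R)
  show "Z * Y = q *o (Y * Z) + I - G2" "U * X = q *o (X * U) + G2 - G1 * G2"
    unfolding D I_def by (simp_all only: S R tn_one[symmetric])
  show "I * X = X" "I * Y = Y * I" unfolding D I_def by (simp_all only: tn_E)
  obtain k where k: "n = Suc k" using n0 by (cases n) auto
  have "X ^ Suc k = 0" unfolding X_def t_def by (subst tn_pow) (simp_all only: e R(7)[unfolded k] tn_0)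
  then show "X ^ n = 0" unfolding k .
  have "Y ^ Suc k = 0" unfolding Y_def t_def by (subst tn_pow) (simp_all only: e E_idem R(17)[unfolded k] tn_0)
  then show "Y ^ n = 0" unfolding k .
  note A = ac_tensor[OF wf]
  show "ac (tensor M M') GA = X + Y" "ac (tensor M M') GD = U + Z" unfolding A D by (rule refl)+
  show "ac (tensor M M') GB * ac (tensor M M') GC = G1 * G2"
    "ac (tensor M M') GB * X = q *o (X * ac (tensor M M') GB)" "ac (tensor M M') GB * Y = q *o (Y * ac (tensor M M') GB)"
    "ac (tensor M M') GC * X = q *o (X * ac (tensor M M') GC)" "ac (tensor M M') GC * Y = q *o (Y * ac (tensor M M') GC)"
    unfolding A D by (simp_all only: S R)
qed

text \<open>The order in which \<open>d\<close> runs through a band, counted from 0: from n - c - 1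
  down to 0, around to n - 1 and down to n - c. The cycle is cut between n - c and n - c - 1, where
  \<open>d\<close> is zero, so it has to be entered at n - c - 1.\<close>

lemma chain_all:
  assumes "c < n" and start: "Q (n - c - 1)" and step: "\<And>j. 0 < j \<Longrightarrow> j < n \<Longrightarrow> j \<noteq> n - c \<Longrightarrow> Q j \<Longrightarrow> Q (j - 1)"
    and wrap: "Q 0 \<Longrightarrow> Q (n - 1)" and j: "j < n"
  shows "Q j"
proof -
  have 1: "Q (n - c - 1 - i)" if "i \<le> n - c - 1" for i
    using that
  proof (induction i)
    case (Suc i)
    then have "Q (n - c - 1 - i - 1)" using assms(1) by (intro step) auto
    then show ?case by (simp add: algebra_simps)
  qed (use start in simp)
  from 1[of "n - c - 1"] have "Q (n - 1)" using wrap by simp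
  then have 2: "Q (n - 1 - i)" if "i < c" for i
    using that
  proof (induction i)
    case (Suc i)
    then have "Q (n - 1 - i - 1)" using assms(1) by (intro step) auto
    then show ?case by (simp add: algebra_simps)
  qed simp
  show ?thesis
  proof (cases "j < n - c")
    case True
    then show ?thesis using 1[of "n - c - 1 - j"] by simp
  next
    case False
    then show ?thesis using 2[of "n - 1 - j"] j by simp
  qed
qed

section \<open>Bases of band modules and of their tensor products\<close>

abbreviation "Bd \<equiv> band_module_1 n q"

text \<open>Coefficients of \<open>d\<close> on the basis counted from 0: \<open>dc\<close> for the
  step from the first vector to the last, \<open>de\<close> for the steps down.
  \<open>de l (n - l)\<close> is 0, which is the cut in \<open>chain_all\<close>.\<close>

definition dc :: "nat \<Rightarrow> 'k proj_line \<Rightarrow> 'k" where "dc l \<eta> = (case \<eta> of Infty \<Rightarrow> 1 | Fin x \<Rightarrow> x * q ^ l)"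
definition de :: "nat \<Rightarrow> nat \<Rightarrow> 'k" where "de l j = (if j < n - l then alpha q j (n - l) else alpha q (j - (n - l)) l)"

lemma Bd_dim [simp]: "hdim (Bd l r \<eta>) = n" by (simp add: band_module_1_def)

lemma de_nz: "1 \<le> l \<Longrightarrow> l < n \<Longrightarrow> 0 < j \<Longrightarrow> j < n \<Longrightarrow> j \<noteq> n - l \<Longrightarrow> de l j \<noteq> 0"
  unfolding de_def using alpha_nz[of j "n - l"] alpha_nz[of "j - (n - l)" l] by auto

lemma Bd_act:
  assumes "j < n" "1 \<le> l" "l < n"
  shows "ac (Bd l r \<eta>) GA * un j k = (if j + 1 < n \<and> \<not> (\<eta> = Infty \<and> j + 1 = n - l) then un (j + 1) k else 0)"
    "ac (Bd l r \<eta>) GB * un j k = qp (r + int l + int j) *o un j k"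
    "ac (Bd l r \<eta>) GC * un j k = qp (int j + 1 - r) *o un j k"
    "0 < j \<Longrightarrow> ac (Bd l r \<eta>) GD * un j k = de l j *o un (j - 1) k"
    "j = 0 \<Longrightarrow> ac (Bd l r \<eta>) GD * un j k = dc l \<eta> *o un (n - 1) k"
proof -
  have a: "ac (Bd l r \<eta>) g = opm (basis_mat n (case g of
        GA \<Rightarrow> (\<lambda>j i. if i = j + 1 \<and> \<not> (\<eta> = Infty \<and> j = n - l) then 1 else 0)
      | GB \<Rightarrow> (\<lambda>j i. if i = j then qp (r + int l + int j - 1) else 0)
      | GC \<Rightarrow> (\<lambda>j i. if i = j then qp (int j - r) else 0)
      | GD \<Rightarrow> (\<lambda>j i.
          if j = 1 then (if i = n then dc l \<eta> else 0)
          else if i = j - 1 \<and> j \<le> n - l then alpha q (j - 1) (n - l)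
          else if i = j - 1 \<and> n - l + 1 < j then alpha q (j - (n - l) - 1) l
          else 0)))" for g
    unfolding qp_def dc_def by (simp add: ac_def band_module_1_def)
  show "ac (Bd l r \<eta>) GA * un j k = (if j + 1 < n \<and> \<not> (\<eta> = Infty \<and> j + 1 = n - l) then un (j + 1) k else 0)"
    unfolding a generator.case
    by (subst basis_mat_un[where t = "j + 1" and c = "if \<eta> = Infty \<and> j + 1 = n - l then 0 else 1"]) (use assms in auto)
  show "ac (Bd l r \<eta>) GB * un j k = qp (r + int l + int j) *o un j k"
    unfolding a generator.case by (subst basis_mat_un[where t = j and c = "qp (r + int l + int j)"]) (use assms in \<open>auto simp: algebra_simps\<close>)
  show "ac (Bd l r \<eta>) GC * un j k = qp (int j + 1 - r) *o un j k"
    unfolding a generator.case by (subst basis_mat_un[where t = j and c = "qp (int j + 1 - r)"]) (use assms in \<open>auto simp: algebra_simps\<close>)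
  show "ac (Bd l r \<eta>) GD * un j k = de l j *o un (j - 1) k" if "0 < j"
    unfolding a generator.case
    by (subst basis_mat_un[where t = "j - 1" and c = "de l j"]) (use assms that in \<open>auto simp: de_def\<close>)
  show "ac (Bd l r \<eta>) GD * un j k = dc l \<eta> *o un (n - 1) k" if "j = 0"
    unfolding a generator.case
    by (subst basis_mat_un[where t = "n - 1" and c = "dc l \<eta>"]) (use assms that in auto)
qed

lemma Bd_ax:
  assumes "1 \<le> l" "l < n"
  shows "j < n \<Longrightarrow> ac (Bd l r (Fin y)) GA ^ x * un j k = (if j + x < n then un (j + x) k else 0)"
    "ac (Bd l r Infty) GA ^ x * un 0 k = (if x < n - l then un x k else 0)"
    "j < n \<Longrightarrow> 0 < j \<Longrightarrow> n \<le> Suc x \<Longrightarrow> ac (Bd l r \<eta>) GA ^ x * un j k = 0"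
proof -
  show 1: "ac (Bd l r (Fin y)) GA ^ x * un j k = (if j + x < n then un (j + x) k else 0)" if "j < n"
  proof (induction x)
    case (Suc x)
    then show ?case using assms that by (cases "j + x < n") (simp_all add: mult.assoc Bd_act)
  qed (use that in simp)
  show "ac (Bd l r Infty) GA ^ x * un 0 k = (if x < n - l then un x k else 0)"
  proof (induction x)
    case (Suc x)
    then show ?case using assms by (cases "x < n - l") (auto simp: mult.assoc Bd_act)
  qed (use assms in simp)
  have 2: "\<exists>c. ac (Bd l r \<eta>) GA ^ x * un j k = c *o (if j + x < n then un (j + x) k else 0)" if "j < n" for j x
  proof (induction x)
    case 0
    then show ?case using that by (intro exI[of _ 1]) simp
  next
    case (Suc x)
    then obtain c where c: "ac (Bd l r \<eta>) GA ^ x * un j k = c *o (if j + x < n then un (j + x) k else 0)" by blast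
    show ?case
      by (rule exI[of _ "if \<eta> = Infty \<and> j + x + 1 = n - l then 0 else c"]) (use assms c that in \<open>auto simp: mult.assoc Bd_act\<close>)
  qed
  show "ac (Bd l r \<eta>) GA ^ x * un j k = 0" if "j < n" "0 < j" "n \<le> Suc x"
    using 2[OF that(1), of x] that by auto
qed

text \<open>The tensor product of two vectors of length n, each encoded in column 0.\<close>

definition te :: "'k lop \<Rightarrow> 'k lop \<Rightarrow> 'k lop" where "te u v = tn n 1 n 1 u v"

abbreviation "ee i j \<equiv> te (un i 0) (un j 0)"

lemma te_scl: "te (c *o u) v = c *o te u v" "te u (c *o v) = c *o te u v"
  and te_0: "te 0 v = 0" "te u 0 = 0"
  by (simp_all only: te_def tn_scl tn_0)

lemma ee_un: "i < n \<Longrightarrow> j < n \<Longrightarrow> ee i j = un (i * n + j) 0"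
  unfolding te_def by (rule tn_un)

lemma tn_ee: "i < n \<Longrightarrow> j < n \<Longrightarrow> tn n n n n F G * ee i j = te (F * un i 0) (G * un j 0)"
  unfolding te_def tn_mult by (simp add: mult.assoc)

lemma un_ee: "k < n * n \<Longrightarrow> un k 0 = ee (k div n) (k mod n)"
  using div_mod_less[of k n n] by (subst ee_un) auto

end

context prim_root
begin

lemma tensor_act_ee:
  assumes "wf_act M" "wf_act M'" "hdim M = n" "hdim M' = n" "i < n" "j < n"
  shows "ac (tensor M M') GA * ee i j = te (ac M GA * un i 0) (ac M' GB * un j 0) + te (un i 0) (ac M' GA * un j 0)"
    "ac (tensor M M') GB * ee i j = te (ac M GB * un i 0) (ac M' GB * un j 0)"
    "ac (tensor M M') GC * ee i j = te (ac M GC * un i 0) (ac M' GC * un j 0)"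
    "ac (tensor M M') GD * ee i j = te (ac M GD * un i 0) (ac M' GC * un j 0) + te (un i 0) (ac M' GD * un j 0)"
  using assms by (simp_all add: ac_tensor tn_ee distrib_right)

lemma ee_unit: "i < n \<Longrightarrow> j < n \<Longrightarrow> ee i j * un 0 0 = ee i j" "i < n \<Longrightarrow> j < n \<Longrightarrow> E (n * n) * ee i j = ee i j"
  using pair_less[of i j] by (simp_all add: ee_un)

text \<open>For an infinite first parameter \<open>a\<close> kills v_(n-l), so on the row v_(n-l)
  \<otimes> v_j the generator \<open>a\<close> acts through the second factor only and fills the
  row. Once a row is in the span, the part 1 \<otimes> d can be subtracted, and d \<otimes> c moves
  cyclically through the rows.\<close>

lemma band_gen_Infty:
  assumes l: "1 \<le> l" "l < n" "1 \<le> l'" "l' < n"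
    and M: "is_module n q (Bd l r Infty)" and M': "is_module n q (Bd l' r' (Fin y))"
  defines "T \<equiv> tensor (Bd l r Infty) (Bd l' r' (Fin y))"
  shows "\<exists>w. wt T (qp (r + r' + int l' - 1)) (qp (1 - r - r' - int l)) w \<and> w * un 0 0 = w \<and> generates T w"
proof (intro exI conjI)
  let ?w = "ee (n - l - 1) 0"
  note A = tensor_act_ee[OF is_module_wf[OF M] is_module_wf[OF M'] Bd_dim Bd_dim, folded T_def]
  note B = Bd_act[OF _ l(1,2)] Bd_act[OF _ l(3,4)]
  have m: "n - l - 1 < n" using l by simp
  show "?w * un 0 0 = ?w" using ee_unit m by simp
  have "qp (r + int l + int (n - l - 1)) * qp (r' + int l') = qp (r + r' + int l' - 1)"
    "qp (int (n - l - 1) + 1 - r) * qp (1 - r') = qp (1 - r - r' - int l)"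
    unfolding qp_add[symmetric] qp_eq using l by (simp_all add: of_nat_diff)
  then show "wt T (qp (r + r' + int l' - 1)) (qp (1 - r - r' - int l)) ?w"
    unfolding wt_def T_def[symmetric] using ee_unit(2) m by (simp add: A B te_scl) (simp add: T_def mult.commute)
  define S where "S = gen (range (ac T)) ?w"
  have S: "u \<in> S \<Longrightarrow> ac T g * u \<in> S" "u \<in> S \<Longrightarrow> u' \<in> S \<Longrightarrow> u - u' \<in> S" "u \<in> S \<Longrightarrow> c *o u \<in> S"
    "c \<noteq> 0 \<Longrightarrow> c *o u \<in> S \<Longrightarrow> u \<in> S" for u u' c g
    unfolding S_def using gen_mult gen_diff gen_scl gen_scl_iff by auto
  have a: "ee (n - l - 1) j \<in> S" if "j < n" for j
    using that
  proof (induction j)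
    case 0
    show ?case unfolding S_def by (rule gen_base)
  next
    case (Suc j)
    then have "ac T GA * ee (n - l - 1) j \<in> S" using S(1) by simp
    then show ?case using Suc.prems l by (simp add: A B te_0 te_scl Suc_diff_Suc)
  qed
  have d: "te (ac (Bd l r Infty) GD * un i 0) (un j 0) \<in> S" if i: "i < n" "\<forall>j<n. ee i j \<in> S" and j: "j < n" for i j
  proof -
    have "te (un i 0) (ac (Bd l' r' (Fin y)) GD * un j 0) \<in> S"
    proof (cases "j = 0")
      case True
      then show ?thesis using i j S(3)[of "ee i (n - 1)"] by (simp add: B te_scl)
    next
      case False
      then show ?thesis using i j S(3)[of "ee i (j - 1)"] by (simp add: B te_scl)
    qed
    then have "ac T GD * ee i j - te (un i 0) (ac (Bd l' r' (Fin y)) GD * un j 0) \<in> S"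
      using i j by (intro S(2) S(1)) auto
    then have "qp (int j + 1 - r') *o te (ac (Bd l r Infty) GD * un i 0) (un j 0) \<in> S"
      using i j by (simp add: A B te_scl)
    then show ?thesis by (rule S(4)[rotated]) simp
  qed
  have all: "\<forall>j<n. ee i j \<in> S" if "i < n" for i
  proof (rule chain_all[of l "\<lambda>i. \<forall>j<n. ee i j \<in> S", OF l(2) _ _ _ that])
    show "\<forall>j<n. ee (n - l - 1) j \<in> S" using a by simp
    show "\<forall>j<n. ee (i - 1) j \<in> S" if "0 < i" "i < n" "i \<noteq> n - l" "\<forall>j<n. ee i j \<in> S" for i
      using d[OF that(2,4)] de_nz[OF l(1,2) that(1-3)] that S(4) by (auto simp: B te_scl)
    show "\<forall>j<n. ee (n - 1) j \<in> S" if "\<forall>j<n. ee 0 j \<in> S"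
      using d[OF n0 that] by (simp add: B dc_def)
  qed
  show "generates T ?w"
    unfolding S_def[symmetric]
  proof (intro allI impI)
    fix k assume "k < hdim T"
    then have k: "k < n * n" by (simp add: T_def)
    show "un k 0 \<in> S" unfolding un_ee[OF k] using all div_mod_less[OF k] by blast
  qed
qed

text \<open>The twisted operators \<open>X + Y\<close> and \<open>D0\<close> are used first:
  \<open>D0\<close> fills the row v_1 \<otimes> v_j and \<open>X + Y\<close> leads from each row to
  the next. Then 1 + W carries the result back to the original action, so the generator is 1 + W
  applied to v_1 \<otimes> v_(n-l').\<close>

lemma band_gen_Fin:
  fixes r r' :: int
  assumes l: "1 \<le> l" "l < n" "1 \<le> l'" "l' < n" and x: "\<eta> \<noteq> Fin x"
  defines "N \<equiv> Bd l r (Fin (x * (q powi (1 - int l) * qint q l)))"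
    and "N' \<equiv> Bd l' r' (scale_point (q powi (1 - int l') * qint q l') \<eta>)"
  assumes M: "is_module n q N" and M': "is_module n q N'"
  defines "T \<equiv> tensor N N'"
  shows "\<exists>w. wt T (qp (r + r' + int l - 1)) (qp (1 - r - r' - int l')) w \<and> w * un 0 0 = w \<and> generates T w"
proof -
  have dims: "hdim N = n" "hdim N' = n" "hdim T = n * n" by (simp_all add: N_def N'_def T_def)
  define X Y U Z G1 G2 where "X = tn n n n n (ac N GA) (ac N' GB)" and "Y = tn n n n n (E n) (ac N' GA)"
    and "U = tn n n n n (ac N GD) (ac N' GC)" and "Z = tn n n n n (E n) (ac N' GD)"
    and "G1 = tn n n n n (ac N GB * ac N GC) (E n)" and "G2 = tn n n n n (E n) (ac N' GB * ac N' GC)"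
  note ops = tensor_ops[OF M M', unfolded dims, folded X_def Y_def U_def Z_def G1_def G2_def T_def]
  define k where "k = n - 1"
  have k: "n = Suc k" unfolding k_def by simp
  have kn: "k < n" "n - 1 = k" "n - Suc 0 = k" unfolding k_def by simp_all
  \<comment> \<open>Chosen so that t (1 - q^l) = x q (l), the coefficient with which
    \<open>d\<close> sends the first vector of the first factor to the last. With l' in place of l
    this is the amount subtracted in the second factor.\<close>
  define t where "t = x * q / (1 - q)"
  define W where "W = (t * qf k) *o TN X Y k"
  note tw = twist[OF ops(1-13) k, where t = t, folded W_def]
  have WW: "(1 - W) * (1 + W) = 1" "(1 + W) * (1 - W) = 1"
    using tw(2) by (simp_all add: distrib_left left_diff_distrib right_diff_distrib distrib_right)
  define D0 where "D0 = U + Z - t *o (X ^ k * (G2 - q ^ k *o (G1 * G2)) + Y ^ k * (1 - q ^ k *o G2))"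
  define D1 where "D1 = U + Z - t *o ((X + Y) ^ k * (1 - q ^ k *o (G1 * G2)))"
  have comm: "(1 + W) * D0 = D1 * (1 + W)" "(1 + W) * (X + Y) = (X + Y) * (1 + W)"
  proof -
    have "(1 + W) * D0 = (1 + W) * (D0 * (1 - W)) * (1 + W)" using WW(1) by (simp add: mult.assoc)
    also have "\<dots> = (1 + W) * ((1 - W) * D1) * (1 + W)" unfolding D1_def D0_def tw(3) ..
    also have "\<dots> = D1 * (1 + W)" using WW(2) by (simp add: mult.assoc[symmetric])
    finally show "(1 + W) * D0 = D1 * (1 + W)" .
    show "(1 + W) * (X + Y) = (X + Y) * (1 + W)" using tw(1) by (simp add: algebra_simps)
  qed
  note A = tensor_act_ee[OF is_module_wf[OF M] is_module_wf[OF M'] dims(1,2), folded T_def]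
  note B = Bd_act[OF _ l(1,2), of _ r "Fin (x * (q powi (1 - int l) * qint q l))", folded N_def]
    Bd_act[OF _ l(3,4), of _ r' "scale_point (q powi (1 - int l') * qint q l') \<eta>", folded N'_def]
  note Bx = Bd_ax(1)[OF l(1,2), of _ r "x * (q powi (1 - int l) * qint q l)", folded N_def]
  note wf = ac_E(1)[OF is_module_wf[OF M]] ac_E(1)[OF is_module_wf[OF M']]
  define k' where "k' = k - 1"
  have k': "k = Suc k'" unfolding k'_def k_def using n2 by simp
  have qk: "q ^ k = inverse q" using qn unfolding k by (simp add: field_simps)
  have qpk: "qp v ^ k = inverse (qp v)" for v using qp_n[of v] unfolding k by (simp add: field_simps)
  \<comment> \<open>By the choice of \<open>t\<close> the correction in X^k cancels the contribution
    of \<open>U\<close>, so \<open>D0\<close> does not leave the first row.\<close>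
  have D0e: "D0 * ee 0 j = te (un 0 0) (ac N' GD * un j 0)
      - (t * (1 - qp (int l' + 2 * int j))) *o te (un 0 0) (ac N' GA ^ k * un j 0)" if j: "j < n" for j
  proof -
    have g2: "G2 * ee 0 j = qp (int l' + 2 * int j + 1) *o ee 0 j"
      unfolding G2_def using j by (simp add: tn_ee mult.assoc B te_scl) (simp add: qp_add[symmetric] algebra_simps)
    have g1: "G1 * ee 0 j = qp (int l + 1) *o ee 0 j"
      unfolding G1_def using j by (simp add: tn_ee mult.assoc B te_scl) (simp add: qp_add[symmetric] algebra_simps)
    have u: "U * ee 0 j = (x * q * qint q l * qp (int j + 1 - r')) *o ee (n - 1) j"
    proof -
      have "dc l (Fin (x * (q powi (1 - int l) * qint q l))) = x * q * qint q l"
        using qp_add[of "1 - int l" "int l"] by (simp add: dc_def qp_def)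
      then show ?thesis unfolding U_def using j by (simp add: tn_ee B te_scl ac_simps)
    qed
    have bp: "ac N' GB ^ i * un j 0 = qp (r' + int l' + int j) ^ i *o un j 0" for i
      by (induction i) (simp_all add: mult.assoc B j mult.commute)
    have xk: "X ^ k * ee 0 j = inverse (qp (r' + int l' + int j)) *o ee (n - 1) j"
    proof -
      have "X ^ k = tn n n n n (ac N GA ^ k) (ac N' GB ^ k)"
        unfolding X_def k' by (rule tn_pow) (use wf dims in simp_all)
      then show ?thesis using j kn by (simp add: tn_ee Bx bp qpk te_scl)
    qed
    have yk: "Y ^ k * ee 0 j = te (un 0 0) (ac N' GA ^ k * un j 0)"
    proof -
      have "Y ^ k = tn n n n n (E n ^ k) (ac N' GA ^ k)"
        unfolding Y_def k' by (rule tn_pow) (use wf dims in simp_all)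
      moreover have "E n ^ i * un 0 0 = (un 0 0 :: 'k lop)" for i by (induction i) (simp_all add: mult.assoc)
      ultimately show ?thesis using j by (simp add: tn_ee)
    qed
    have z: "Z * ee 0 j = te (un 0 0) (ac N' GD * un j 0)" unfolding Z_def using j by (simp add: tn_ee)
    have "qp (int l' + 2 * int j + 1) = qp (r' + int l' + int j) * qp (int j + 1 - r')"
      unfolding qp_add[symmetric] by (simp add: algebra_simps)
    then have q1: "inverse (qp (r' + int l' + int j)) * qp (int l' + 2 * int j + 1) = qp (int j + 1 - r')" by simp
    have q2: "q ^ k * qp (int l + 1) = q ^ l" unfolding qk qp_add qp_nat by simp
    have q3: "q ^ k * qp (int l' + 2 * int j + 1) = qp (int l' + 2 * int j)" unfolding qk qp_add[of "int l' + 2 * int j" 1] by simp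
    have q4: "t * (1 - q ^ l) = x * q * qint q l" unfolding t_def qint_geom[symmetric] using q_ne_1 by simp
    have "(G2 - q ^ k *o (G1 * G2)) * ee 0 j = (qp (int l' + 2 * int j + 1) * (1 - q ^ k * qp (int l + 1))) *o ee 0 j"
      by (simp add: left_diff_distrib mult.assoc g1 g2 scl_diff_left[symmetric] algebra_simps)
    then have "t *o (X ^ k * ((G2 - q ^ k *o (G1 * G2)) * ee 0 j)) =
        (t * (1 - q ^ l) * (inverse (qp (r' + int l' + int j)) * qp (int l' + 2 * int j + 1))) *o ee (n - 1) j"
      unfolding q2 by (simp add: xk ac_simps)
    then have 1: "t *o (X ^ k * ((G2 - q ^ k *o (G1 * G2)) * ee 0 j)) = U * ee 0 j"
      unfolding q1 q4 u .
    have "(1 - q ^ k *o G2) * ee 0 j = (1 - qp (int l' + 2 * int j)) *o ee 0 j"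
      using q3 by (simp add: left_diff_distrib g2 scl_diff_left)
    then have 2: "t *o (Y ^ k * ((1 - q ^ k *o G2) * ee 0 j)) = (t * (1 - qp (int l' + 2 * int j))) *o te (un 0 0) (ac N' GA ^ k * un j 0)"
      by (simp add: yk)
    have "D0 * ee 0 j = U * ee 0 j + Z * ee 0 j - (t *o (X ^ k * ((G2 - q ^ k *o (G1 * G2)) * ee 0 j))
        + t *o (Y ^ k * ((1 - q ^ k *o G2) * ee 0 j)))"
      unfolding D0_def by (simp only: left_diff_distrib distrib_right scl_mult_left scl_add mult.assoc)
    then show ?thesis unfolding 1 2 z by simp
  qed
  define w0 where "w0 = ee 0 (n - l' - 1)"
  define S0 where "S0 = gen {X + Y, D0} w0"
  have S0: "u \<in> S0 \<Longrightarrow> (X + Y) * u \<in> S0" "u \<in> S0 \<Longrightarrow> D0 * u \<in> S0" "u \<in> S0 \<Longrightarrow> u' \<in> S0 \<Longrightarrow> u - u' \<in> S0"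
    "c \<noteq> 0 \<Longrightarrow> c *o u \<in> S0 \<Longrightarrow> u \<in> S0" for u u' c
    unfolding S0_def using gen_mult[of _ "{X + Y, D0}"] gen_diff gen_scl_iff by auto
  have m: "n - l' - 1 < n" using l by simp
  have row0: "ee 0 j \<in> S0" if "j < n" for j
  proof (rule chain_all[of l' "\<lambda>j. ee 0 j \<in> S0", OF l(4) _ _ _ that])
    show "ee 0 (n - l' - 1) \<in> S0" unfolding S0_def w0_def by (rule gen_base)
    show "ee 0 (j - 1) \<in> S0" if j: "0 < j" "j < n" "j \<noteq> n - l'" "ee 0 j \<in> S0" for j
    proof -
      have "ac N' GA ^ k * un j 0 = (0 :: 'k lop)"
        unfolding N'_def by (rule Bd_ax(3)[OF l(3,4) j(2,1)]) (simp add: k)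
      then have "de l' j *o ee 0 (j - 1) \<in> S0" using S0(2)[OF j(4)] D0e[OF j(2)] j by (simp add: B te_scl te_0)
      then show ?thesis using S0(4) de_nz[OF l(3,4) j(1-3)] by blast
    qed
    assume e: "ee 0 0 \<in> S0"
    \<comment> \<open>The step that closes the cycle: \<open>c\<close> is 1 for \<eta> =
      \<open>Infty\<close>, where a^(n-1) kills the first vector, and (y - x) q (l') for \<eta> = y,
      nonzero since y differs from x.\<close>
    have "\<exists>c. c \<noteq> 0 \<and> D0 * ee 0 0 = c *o ee 0 (n - 1)"
    proof (cases \<eta>)
      case Infty
      have "ac N' GA ^ k * un 0 0 = (0 :: 'k lop)"
        unfolding N'_def Infty using Bd_ax(2)[OF l(3,4), of r' k 0] l k by simp
      then show ?thesis using Infty D0e[of 0] by (intro exI[of _ 1]) (simp add: B te_0 dc_def)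
    next
      case (Fin y)
      have "ac N' GA ^ k * un 0 0 = (un k 0 :: 'k lop)"
        unfolding N'_def Fin using Bd_ax(1)[OF l(3,4), of 0 r' _ k 0] k by simp
      moreover have "dc l' (Fin (y * (q powi (1 - int l') * qint q l'))) = y * q * qint q l'"
        using qp_add[of "1 - int l'" "int l'"] by (simp add: dc_def qp_def)
      moreover have "t * (1 - qp (int l')) = x * q * qint q l'"
        unfolding qp_nat t_def qint_geom[symmetric] using q_ne_1 by simp
      ultimately have "D0 * ee 0 0 = (y * q * qint q l') *o ee 0 (n - 1) - (x * q * qint q l') *o ee 0 (n - 1)"
        using D0e[of 0] Fin by (simp add: B te_scl kn)
      then have "D0 * ee 0 0 = ((y - x) * q * qint q l') *o ee 0 (n - 1)"
        by (simp only: scl_diff_left[symmetric] left_diff_distrib)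
      moreover have "(y - x) * q * qint q l' \<noteq> 0"
        using x Fin qint_eq_0[of l'] l by (auto dest: dvd_imp_le)
      ultimately show ?thesis by blast
    qed
    then show "ee 0 (n - 1) \<in> S0" using S0(2)[OF e] S0(4) by metis
  qed
  \<comment> \<open>\<open>Y\<close> stays in row i and can be subtracted; what remains is the
    effect of \<open>X\<close>, a nonzero multiple of the vector in row i + 1.\<close>
  have all: "\<forall>j<n. ee i j \<in> S0" if "i < n" for i
    using that
  proof (induction i)
    case 0
    then show ?case using row0 by blast
  next
    case (Suc i)
    show ?case
    proof (intro allI impI)
      fix j assume j: "j < n"
      have i: "i < n" and eij: "ee i j \<in> S0" if "j < n" for j using Suc that by auto
      have "te (un i 0) (ac N' GA * un j 0) \<in> S0"
        using eij[of "j + 1"] gen_0[of "{X + Y, D0}" w0] j by (auto simp: B te_0 S0_def)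
      then have "(X + Y) * ee i j - te (un i 0) (ac N' GA * un j 0) \<in> S0"
        using eij[OF j] by (intro S0(3) S0(1))
      also have "(X + Y) * ee i j - te (un i 0) (ac N' GA * un j 0) = qp (r' + int l' + int j) *o ee (Suc i) j"
        unfolding ops(14)[symmetric] using A(1)[OF i[OF j] j] Suc.prems j by (simp add: B te_scl)
      finally show "ee (Suc i) j \<in> S0" by (rule S0(4)[rotated]) simp
    qed
  qed
  define w where "w = (1 + W) * w0"
  define S where "S = gen (range (ac T)) w"
  have S: "u \<in> S \<Longrightarrow> ac T g * u \<in> S" "u \<in> S \<Longrightarrow> u' \<in> S \<Longrightarrow> u - u' \<in> S" "u \<in> S \<Longrightarrow> u' \<in> S \<Longrightarrow> u + u' \<in> S" "u \<in> S \<Longrightarrow> c *o u \<in> S" for u u' c g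
    unfolding S_def using gen_mult gen_diff gen_add gen_scl by auto
  \<comment> \<open>1 + W turns words in \<open>X + Y\<close> and \<open>D0\<close> into words in
    \<open>X + Y\<close> and \<open>D1\<close>. The latter is d - t a^k (1 - q^k b c), so it maps
    the submodule generated by \<open>w\<close> to itself.\<close>
  have tr: "(1 + W) * u \<in> S" if "u \<in> S0" for u
    using that unfolding S0_def
  proof induction
    case gen_base
    then show ?case unfolding S_def w_def by (rule gen.gen_base)
  next
    case (gen_mult g u)
    have Ap: "ac T GA ^ i * v \<in> S" if "v \<in> S" for i v
      using that S(1) by (induction i) (simp_all add: mult.assoc)
    have "D1 * v \<in> S" if "v \<in> S" for v
    proof -
      have "D1 * v = ac T GD * v - t *o (ac T GA ^ k * (v - q ^ k *o (ac T GB * (ac T GC * v))))"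
        unfolding D1_def ops(14,15) using ops(16) by (simp add: left_diff_distrib right_diff_distrib mult.assoc)
          (simp add: mult.assoc[symmetric])
      then show ?thesis using that Ap S by simp
    qed
    then have "D1 * ((1 + W) * u) \<in> S" "ac T GA * ((1 + W) * u) \<in> S" using gen_mult(3) S(1) by simp_all
    then show ?case using gen_mult(1) comm[symmetric] ops(14) by (auto simp: mult.assoc[symmetric])
  qed (auto simp: distrib_left S)
  have span: "(1 + W) * v \<in> S" if "E (n * n) * v = v" "v * un 0 0 = v" for v
  proof -
    have "(E 1 :: 'k lop) = un 0 0" unfolding E_sum by simp
    then have "v = E (n * n) * v * E 1" using that by simp
    then have "v = (\<Sum>i<n * n. entry v i 0 *o un i 0)" by (simp add: sandwich_expand)
    from arg_cong[of _ _ "\<lambda>u. (1 + W) * u", OF this]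
    have "(1 + W) * v = (\<Sum>i<n * n. entry v i 0 *o ((1 + W) * un i 0))" by (simp only: scl_mult_right sum_distrib_left)
    moreover have "(1 + W) * un i 0 \<in> S" if "i < n * n" for i
      unfolding un_ee[OF that] using div_mod_less[OF that] all by (intro tr) auto
    ultimately show ?thesis unfolding S_def by (auto intro!: gen_sum gen_scl)
  qed
  show ?thesis
  proof (intro exI conjI)
    have w0: "E (n * n) * w0 = w0" "w0 * un 0 0 = w0" unfolding w0_def using ee_unit m by simp_all
    have EW: "E (n * n) * (W * v) = W * v" for v using assoc_ext[OF tw(5)] .
    show "w * un 0 0 = w" unfolding w_def by (simp add: mult.assoc w0)
    have "qp (r + int l) * qp (r' + int l' + int (n - l' - 1)) = qp (r + r' + int l - 1)"
      "qp (1 - r) * qp (int (n - l' - 1) + 1 - r') = qp (1 - r - r' - int l')"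
      unfolding qp_add[symmetric] qp_eq using l by (simp_all add: of_nat_diff)
    then have bw: "ac T GB * w0 = qp (r + r' + int l - 1) *o w0" "ac T GC * w0 = qp (1 - r - r' - int l') *o w0"
      unfolding w0_def using m by (simp_all add: A B te_scl mult.commute)
    have "ac T GB * W = W * ac T GB" "ac T GC * W = W * ac T GC"
      using tw(4)[OF ops(17,18)] tw(4)[OF ops(19,20)] .
    then have "ac T GB * (W * w0) = W * (ac T GB * w0)" "ac T GC * (W * w0) = W * (ac T GC * w0)"
      by (metis mult.assoc)+
    then show "wt T (qp (r + r' + int l - 1)) (qp (1 - r - r' - int l')) w"
      unfolding wt_def dims w_def by (simp add: distrib_left distrib_right w0 EW bw scl_add)
    show "generates T w"
      unfolding dims S_def[symmetric]
    proof (intro allI impI)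
      fix i assume i: "i < n * n"
      \<comment> \<open>1 + W is invertible, so its values already give all of
        \<open>T\<close>.\<close>
      have "(1 + W) * ((1 - W) * un i 0) \<in> S"
        by (rule span) (simp_all add: left_diff_distrib right_diff_distrib EW i mult.assoc)
      then show "un i 0 \<in> S" using WW(2) by (simp add: mult.assoc[symmetric])
    qed
  qed
qed

end

section \<open>The decomposition\<close>

context prim_root
begin

lemma ev_qp: "ev (qp K) y = qint q y * (1 - qp (K - 1 - int y))"
proof -
  have "qp (K - 1 - int y) = qp K / (q * q ^ y)" by (simp add: qp_diff qp_nat)
  then show ?thesis unfolding ev_def by simp
qed

text \<open>With R = q^(K-1) one has (1 - q) ev u = 1 + R - q^u - R / q^u, which is symmetric under
  u \<mapsto> K - 1 - u. The difference of two values factors accordingly as (q^z - q^y) (1 - R /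
  q^(y+z)).\<close>

lemma ev_eq: "ev (qp K) y = ev (qp K) z \<longleftrightarrow> int n dvd int y - int z \<or> int n dvd K - 1 - int y - int z"
proof -
  define R where "R = qp (K - 1)"
  have e: "(1 - q) * ev (qp K) u = 1 + R - q ^ u - R / q ^ u" for u
  proof -
    have "(1 - q) * ev (qp K) u = qint q u * (1 - q) * (1 - R / q ^ u)"
      unfolding ev_qp R_def by (simp add: qp_diff qp_nat)
    then show ?thesis unfolding qint_geom by (simp add: field_simps)
  qed
  have "ev (qp K) y = ev (qp K) z \<longleftrightarrow> (1 - q) * ev (qp K) y = (1 - q) * ev (qp K) z" using q_ne_1 by simp
  also have "\<dots> \<longleftrightarrow> (q ^ z - q ^ y) * (1 - R / (q ^ y * q ^ z)) = 0"
    unfolding e by (simp add: field_simps)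
  also have "\<dots> \<longleftrightarrow> qp (int y) = qp (int z) \<or> qp (K - 1 - int y - int z) = 1"
    unfolding R_def qp_diff qp_nat by auto
  also have "\<dots> \<longleftrightarrow> int n dvd int y - int z \<or> int n dvd K - 1 - int y - int z"
    unfolding qp_eq qp_eq_1 ..
  finally show ?thesis .
qed

lemma dvd_small_eq: "int n dvd a - b \<Longrightarrow> 0 \<le> a \<Longrightarrow> a < int n \<Longrightarrow> 0 \<le> b \<Longrightarrow> b < int n \<Longrightarrow> a = b"
  using mod_eq_dvd_iff[of a "int n" b] by simp

text \<open>The entry \<open>(u, \<rho>, x)\<close> of the list stands for the vector number \<open>x\<close>, counted from 0, of the simple
  module with parameters \<open>u\<close> and \<open>\<rho>\<close>; the eigenvalue of \<open>a d\<close> determines \<open>x\<close> up to the involution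
  exchanging \<open>x\<close> and \<open>x + n - u\<close>.\<close>

lemma decomposition_list:
  assumes T: "is_module n q T" "wt T (qp b) (qp c) w" "w * un 0 0 = w" "generates T w" "hdim T = n * n"
    and P: "projective_modules n q P"
    and L: "\<And>u \<rho> x. (u, \<rho>, x) \<in> set L \<Longrightarrow>
      0 \<le> x \<and> x < u \<and> u \<le> int n \<and> int n dvd \<rho> + x - b \<and> int n dvd x + 1 - \<rho> - u - c"
    and dist: "distinct L"
    and inj: "\<And>u \<rho> x u' \<rho>' x'. (u, \<rho>, x) \<in> set L \<Longrightarrow> (u', \<rho>', x') \<in> set L \<Longrightarrow>
      x = x' \<or> x = x' + int n - u' \<Longrightarrow> (u, \<rho>, x) = (u', \<rho>', x')"
    and cov: "\<And>y. 0 \<le> y \<Longrightarrow> y < int n \<Longrightarrow> \<exists>u \<rho> x. (u, \<rho>, x) \<in> set L \<and> (y = x \<or> y = x + int n - u)"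
  shows "mod_iso n q T (module_sum (map (\<lambda>(u, \<rho>, x). P (nat u) \<rho>) L))"
proof -
  define K where "K = b + c"
  have K: "qp b * qp c = qp K" unfolding K_def qp_add ..
  define lam rho xx where "lam i = nat (fst (L ! i))" and "rho i = fst (snd (L ! i))" and "xx i = nat (snd (snd (L ! i)))" for i
  have Li: "L ! i = (int (lam i), rho i, int (xx i))" "xx i < lam i" "lam i \<le> n"
    "int n dvd rho i + int (xx i) - b" "int n dvd int (xx i) + 1 - rho i - int (lam i) - c"
    and Lm: "(int (lam i), rho i, int (xx i)) \<in> set L" if "i < length L" for i
  proof -
    obtain u \<rho> x where e: "L ! i = (u, \<rho>, x)" by (metis prod_cases3)
    have m: "(u, \<rho>, x) \<in> set L" using that e nth_mem by metis
    have r: "rho i = \<rho>" unfolding rho_def e by simp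
    have "0 \<le> x" "0 \<le> u" using L[OF m] by auto
    then have lx: "int (lam i) = u" "int (xx i) = x" unfolding lam_def xx_def e by simp_all
    show "L ! i = (int (lam i), rho i, int (xx i))" "(int (lam i), rho i, int (xx i)) \<in> set L"
      unfolding lx r using e m by simp_all
    have "int (xx i) < int (lam i)" "int (lam i) \<le> int n" unfolding lx using L[OF m] by simp_all
    then show "xx i < lam i" "lam i \<le> n" by simp_all
    show "int n dvd rho i + int (xx i) - b" "int n dvd int (xx i) + 1 - rho i - int (lam i) - c"
      unfolding lx r using L[OF m] by simp_all
  qed
  \<comment> \<open>The sum of the two weight congruences. It identifies the symmetry y \<mapsto> K
    - 1 - y of \<open>ev\<close> with the involution x \<mapsto> x + n - u.\<close>
  have dK: "int n dvd (int (xx i) - int (lam i)) - (K - 1 - int (xx i))" if "i < length L" for i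
    using dvd_add[OF Li(4)[OF that] Li(5)[OF that]] unfolding K_def by (simp add: algebra_simps)
  have sig: "alpha q (xx i) (lam i) = ev (qp K) (xx i)" if "i < length L" for i
    unfolding alpha_qp ev_qp using dK[OF that] qp_eq by (metis (no_types))
  define \<pi> where "\<pi> i = (SOME p. cover n q (P (lam i) (rho i)) (Vm (lam i) (rho i)) p)" for i
  have \<pi>: "cover n q (P (lam i) (rho i)) (Vm (lam i) (rho i)) (\<pi> i)" if "i < length L" for i
    unfolding \<pi>_def by (rule someI_ex, rule P_cover[OF P]) (use Li(2,3)[OF that] in auto)
  have "mod_iso n q T (module_sum (map (\<lambda>i. P (lam i) (rho i)) [0..<length L]))"
  proof (rule free_decomposition[OF T qp_n qp_n, where V = "\<lambda>i. Vm (lam i) (rho i)" and v = "\<lambda>i. un (xx i) 0"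
        and \<pi> = \<pi> and \<sigma> = "\<lambda>i. ev (qp K) (xx i)"])
    fix i assume i: "i < length L"
    note w = Vm_weight[OF Li(2)[OF i], of "rho i"]
    show "cover n q (P (lam i) (rho i)) (Vm (lam i) (rho i)) (\<pi> i)" by (rule \<pi>[OF i])
    show "simp_mod n q (Vm (lam i) (rho i))" using Li(2,3)[OF i] by (intro Vm_simple) auto
    have "qp (rho i + int (xx i)) = qp b" unfolding qp_eq by (rule Li(4)[OF i])
    moreover have "qp (int (xx i) + 1 - rho i - int (lam i)) = qp c" unfolding qp_eq by (rule Li(5)[OF i])
    ultimately show "wt (Vm (lam i) (rho i)) (qp b) (qp c) (un (xx i) 0)" using w(1) by simp
    show "un (xx i) 0 * un 0 0 = (un (xx i) 0 :: 'k lop)" by simp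
    show "un (xx i) 0 \<noteq> (0 :: 'k lop)" by (rule un_neq_0)
    show "ac (Vm (lam i) (rho i)) GA * ac (Vm (lam i) (rho i)) GD * un (xx i) 0 = ev (qp K) (xx i) *o un (xx i) 0"
      using w(2) sig[OF i] by simp
  next
    fix i j assume i: "i < length L" and j: "j < length L" and ij: "i \<noteq> j"
    show "ev (qp K) (xx i) \<noteq> ev (qp K) (xx j)"
    proof
      assume "ev (qp K) (xx i) = ev (qp K) (xx j)"
      then have "int n dvd int (xx i) - int (xx j) \<or> int n dvd K - 1 - int (xx i) - int (xx j)" unfolding ev_eq .
      moreover have "int n dvd int (xx i) - (int (xx j) + int n - int (lam j))" if "int n dvd K - 1 - int (xx i) - int (xx j)"
      proof -
        have "int (xx i) - (int (xx j) + int n - int (lam j)) =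
           - (int n + ((int (xx j) - int (lam j)) - (K - 1 - int (xx j))) + (K - 1 - int (xx i) - int (xx j)))" by simp
        then show ?thesis using dK[OF j] that by (metis dvd_add dvd_minus_iff dvd_refl)
      qed
      ultimately have "int (xx i) = int (xx j) \<or> int (xx i) = int (xx j) + int n - int (lam j)"
        using dvd_small_eq[of "int (xx i)" "int (xx j)"] dvd_small_eq[of "int (xx i)" "int (xx j) + int n - int (lam j)"]
          Li(2,3)[OF i] Li(2,3)[OF j] by auto
      from inj[OF Lm[OF i] Lm[OF j] this] have "L ! i = L ! j" unfolding Li(1)[OF i] Li(1)[OF j] .
      then show False using dist i j ij nth_eq_iff_index_eq by metis
    qed
  next
    fix y assume y: "y < n"
    then obtain u \<rho> x where m: "(u, \<rho>, x) \<in> set L" "int y = x \<or> int y = x + int n - u" using cov[of "int y"] by auto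
    then obtain i where i: "i < length L" "L ! i = (u, \<rho>, x)" by (metis in_set_conv_nth)
    have lx: "u = int (lam i)" "x = int (xx i)" using i(2) Li(1)[OF i(1)] by simp_all
    have "int n dvd int y - int (xx i) \<or> int n dvd K - 1 - int y - int (xx i)"
    proof (cases "int y = x")
      case True
      then show ?thesis unfolding lx by simp
    next
      case False
      then have "K - 1 - int y - int (xx i) = - (int n + ((int (xx i) - int (lam i)) - (K - 1 - int (xx i))))"
        using m(2) unfolding lx by simp
      then show ?thesis using dK[OF i(1)] by (metis dvd_add dvd_minus_iff dvd_refl)
    qed
    then show "\<exists>i<length L. ev (qp b * qp c) y = ev (qp K) (xx i)" unfolding K ev_eq using i(1) by blast
  qed
  moreover have "map (\<lambda>i. P (lam i) (rho i)) [0..<length L] = map (\<lambda>(u, \<rho>, x). P (nat u) \<rho>) L"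
    by (rule nth_equalityI) (simp_all add: Li(1))
  ultimately show ?thesis by simp
qed

text \<open>The weight of the generator depends on whether \<alpha> is infinite, with l and l'
  exchanged between the two cases. The list of covers is the same in both; only the position of the
  weight in each simple module changes.\<close>

lemma base_decomposition:
  fixes r r' :: int
  assumes P: "projective_modules n q P" and l: "1 \<le> l" "l \<le> l'" "l' < n" and ne: "\<alpha> \<noteq> \<eta>"
  defines "N \<equiv> Bd l r (scale_point (q powi (1 - int l) * qint q l) \<alpha>)"
    and "N' \<equiv> Bd l' r' (scale_point (q powi (1 - int l') * qint q l') \<eta>)"
  assumes M: "is_module n q N" and M': "is_module n q N'"
  shows "mod_iso n q (tensor N N') (module_sum
    (map (\<lambda>i. P (nat (int l' - int l - 1 + 2 * i)) (r + r' + int l - i)) [1 .. cfun (int n + int l - int l')] @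
     map (\<lambda>i. P (nat (int n + int l + int l' - 1 - 2 * i)) (r + r' + i)) [cfun (int l + int l' - 1) .. int l' - 1]))"
proof -
  define c1 c2 where "c1 = cfun (int n + int l - int l')" and "c2 = cfun (int l + int l' - 1)"
  have c: "2 * c1 \<le> int n + int l - int l' + 1" "int n + int l - int l' \<le> 2 * c1"
    "2 * c2 \<le> int l + int l'" "int l + int l' \<le> 2 * c2 + 1"
    unfolding c1_def c2_def cfun_def by simp_all
  have T: "is_module n q (tensor N N')" "hdim (tensor N N') = n * n"
    using tensor_module[OF M M'] by (simp_all add: N_def N'_def)
  \<comment> \<open>\<open>f\<close> and \<open>g\<close> give the positions of the weight in the
    simple modules of the two families.\<close>
  define L where "L f g = map (\<lambda>i. (int l' - int l - 1 + 2 * i, r + r' + int l - i, f i)) [1..c1] @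
    map (\<lambda>i. (int n + int l + int l' - 1 - 2 * i, r + r' + i, g i)) [c2..int l' - 1]" for f g :: "int \<Rightarrow> int"
  have Lset: "(u, \<rho>, x) \<in> set (L f g) \<longleftrightarrow>
      (\<exists>i. 1 \<le> i \<and> i \<le> c1 \<and> u = int l' - int l - 1 + 2 * i \<and> \<rho> = r + r' + int l - i \<and> x = f i) \<or>
      (\<exists>i. c2 \<le> i \<and> i < int l' \<and> u = int n + int l + int l' - 1 - 2 * i \<and> \<rho> = r + r' + i \<and> x = g i)" for u \<rho> x f g
    unfolding L_def by auto
  have LP: "map (\<lambda>(u, \<rho>, x). P (nat u) \<rho>) (L f g) =
     map (\<lambda>i. P (nat (int l' - int l - 1 + 2 * i)) (r + r' + int l - i)) [1 .. c1] @
     map (\<lambda>i. P (nat (int n + int l + int l' - 1 - 2 * i)) (r + r' + i)) [c2 .. int l' - 1]" for f g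
    unfolding L_def by simp
  show ?thesis
  proof (cases \<alpha>)
    case (Fin x)
    obtain w where w: "wt (tensor N N') (qp (r + r' + int l - 1)) (qp (1 - r - r' - int l')) w" "w * un 0 0 = w" "generates (tensor N N') w"
      using band_gen_Fin[of l l' \<eta> x r r'] l ne M M' unfolding N_def N'_def Fin by auto
    \<comment> \<open>The solutions of \<rho> + x = r + r' + l - 1 modulo n that lie between 0 and u
      - 1.\<close>
    let ?f = "\<lambda>i. i - 1" and ?g = "\<lambda>i. int n + int l - i - 1"
    have "mod_iso n q (tensor N N') (module_sum (map (\<lambda>(u, \<rho>, x). P (nat u) \<rho>) (L ?f ?g)))"
    proof (rule decomposition_list[OF T(1) w T(2) P])
      show "0 \<le> x \<and> x < u \<and> u \<le> int n \<and> int n dvd \<rho> + x - (r + r' + int l - 1) \<and> int n dvd x + 1 - \<rho> - u - (1 - r - r' - int l')"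
        if "(u, \<rho>, x) \<in> set (L ?f ?g)" for u \<rho> x
        using that c l unfolding Lset by auto
      show "distinct (L ?f ?g)"
        unfolding L_def using c l by (auto simp: distinct_map inj_on_def)
      show "(u, \<rho>, x) = (u', \<rho>', x')"
        if "(u, \<rho>, x) \<in> set (L ?f ?g)" "(u', \<rho>', x') \<in> set (L ?f ?g)" "x = x' \<or> x = x' + int n - u'" for u \<rho> x u' \<rho>' x'
        using that c l unfolding Lset by (elim disjE exE conjE) simp_all
      show "\<exists>u \<rho> x. (u, \<rho>, x) \<in> set (L ?f ?g) \<and> (y = x \<or> y = x + int n - u)" if y: "0 \<le> y" "y < int n" for y
      proof -
        have A1: ?thesis if "1 \<le> i" "i \<le> c1" "y = ?f i \<or> y = ?f i + int n - (int l' - int l - 1 + 2 * i)" for i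
          using that unfolding Lset by blast
        have A2: ?thesis if "c2 \<le> i" "i < int l'" "y = ?g i \<or> y = ?g i + int n - (int n + int l + int l' - 1 - 2 * i)" for i
          using that unfolding Lset by blast
        \<comment> \<open>The first two intervals consist of positions \<open>?f\<close> and their
          partners, the last two of positions \<open>?g\<close> and their partners. The rounding in
          \<open>c1\<close> and \<open>c2\<close> decides whether a self-paired position, with u =
          n, ends a family.\<close>
        consider "y < c1" | "c1 \<le> y" "y < int n + int l - int l'"
          | "int n + int l - int l' \<le> y" "y < int n - int l' + c2" | "int n - int l' + c2 \<le> y" by linarith
        then show ?thesis
        proof cases
          case 1 then show ?thesis using A1[of "y + 1"] y by simp
        next
          case 2 then show ?thesis using A1[of "int n + int l - int l' - y"] y c by simp
        next
          case 3 then show ?thesis using A2[of "int n + int l - 1 - y"] y c by simp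
        next
          case 4 then show ?thesis using A2[of "y - int n + int l'"] y c by simp
        qed
      qed
    qed
    then show ?thesis unfolding LP c1_def c2_def .
  next
    case Infty
    then obtain y where y: "\<eta> = Fin y" using ne by (cases \<eta>) auto
    obtain w where w: "wt (tensor N N') (qp (r + r' + int l' - 1)) (qp (1 - r - r' - int l)) w" "w * un 0 0 = w" "generates (tensor N N') w"
      using band_gen_Infty[of l l' r r'] l M M' unfolding N_def N'_def Infty y by auto
    \<comment> \<open>The same congruence with l' in place of l.\<close>
    let ?f = "\<lambda>i. int l' - int l + i - 1" and ?g = "\<lambda>i. int l' - i - 1"
    have "mod_iso n q (tensor N N') (module_sum (map (\<lambda>(u, \<rho>, x). P (nat u) \<rho>) (L ?f ?g)))"
    proof (rule decomposition_list[OF T(1) w T(2) P])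
      show "0 \<le> x \<and> x < u \<and> u \<le> int n \<and> int n dvd \<rho> + x - (r + r' + int l' - 1) \<and> int n dvd x + 1 - \<rho> - u - (1 - r - r' - int l)"
        if "(u, \<rho>, x) \<in> set (L ?f ?g)" for u \<rho> x
        using that c l unfolding Lset by auto
      show "distinct (L ?f ?g)"
        unfolding L_def using c l by (auto simp: distinct_map inj_on_def)
      show "(u, \<rho>, x) = (u', \<rho>', x')"
        if "(u, \<rho>, x) \<in> set (L ?f ?g)" "(u', \<rho>', x') \<in> set (L ?f ?g)" "x = x' \<or> x = x' + int n - u'" for u \<rho> x u' \<rho>' x'
        using that c l unfolding Lset by (elim disjE exE conjE) simp_all
      show "\<exists>u \<rho> x. (u, \<rho>, x) \<in> set (L ?f ?g) \<and> (y = x \<or> y = x + int n - u)" if y: "0 \<le> y" "y < int n" for y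
      proof -
        have A1: ?thesis if "1 \<le> i" "i \<le> c1" "y = ?f i \<or> y = ?f i + int n - (int l' - int l - 1 + 2 * i)" for i
          using that unfolding Lset by blast
        have A2: ?thesis if "c2 \<le> i" "i < int l'" "y = ?g i \<or> y = ?g i + int n - (int n + int l + int l' - 1 - 2 * i)" for i
          using that unfolding Lset by blast
        \<comment> \<open>Here the first two intervals belong to \<open>?g\<close> and the last two
          to \<open>?f\<close>.\<close>
        consider "y < int l' - c2" | "int l' - c2 \<le> y" "y < int l' - int l"
          | "int l' - int l \<le> y" "y < int l' - int l + c1" | "int l' - int l + c1 \<le> y" by linarith
        then show ?thesis
        proof cases
          case 1 then show ?thesis using A2[of "int l' - 1 - y"] y by simp
        next
          case 2 then show ?thesis using A2[of "y + int l"] y c by simp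
        next
          case 3 then show ?thesis using A1[of "y - int l' + int l + 1"] y c by simp
        next
          case 4 then show ?thesis using A1[of "int n - y"] y c by simp
        qed
      qed
    qed
    then show ?thesis unfolding LP c1_def c2_def .
  qed
qed

end

section \<open>Multiplicities along the two tubes\<close>

lemma mset_concat_replicate: "mset (concat (replicate t xs)) = repeat_mset t (mset xs)"
  by (induction t) simp_all

lemma mset_concat_map_replicate: "mset (concat (map (replicate k) xs)) = repeat_mset k (mset xs)"
  by (rule multiset_eqI, induction xs) (simp_all add: algebra_simps)

lemma module_sum_copies: "module_sum (map (\<lambda>i. copies k (f i)) xs) = module_sum (concat (map (replicate k) (map f xs)))"
  unfolding module_sum_concat by (simp add: copies_def comp_def)

context prim_root
begin

lemma tensor_tube_left:
  assumes cov: "\<And>R. R \<in> set Rs \<Longrightarrow> \<exists>V \<pi>. cover n q R V \<pi> \<and> simp_mod n q V"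
    and Y: "is_module n q Y" and m: "\<And>t. is_module n q (M t)" and M0: "hdim (M 0) = 0"
    and ass: "\<And>t. t \<ge> 1 \<Longrightarrow> almost_split_sequence n q (M t) (module_sum [M (t - 1), M (t + 1)]) (M t)"
    and base: "mod_iso n q (tensor (M 1) Y) (module_sum Rs)"
  shows "mod_iso n q (tensor (M t) Y) (module_sum (concat (replicate t Rs)))"
proof (rule tube_ladder[where M = "\<lambda>t. tensor (M t) Y", OF n0 cov])
  show "is_module n q (tensor (M t) Y)" for t by (rule tensor_module[OF m Y])
  show "hdim (tensor (M 0) Y) = 0" using M0 by simp
  fix t :: nat assume "t \<ge> 1"
  note a = almost_split_ses[OF ass[OF this]]
  show "\<exists>B. is_module n q B \<and> ses (tensor (M t) Y) B (tensor (M t) Y) \<and>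
      mod_iso n q B (module_sum [tensor (M (t - 1)) Y, tensor (M (t + 1)) Y])"
    using tensor_module[OF a(2) Y] tensor_sum_left[OF m m Y]
      tensor_ses_left[OF is_module_wf[OF m] is_module_wf[OF a(2)] is_module_wf[OF m] is_module_wf[OF Y] a(4)] by blast
qed (use base in simp_all)

lemma tensor_tube_right:
  assumes cov: "\<And>R. R \<in> set Rs \<Longrightarrow> \<exists>V \<pi>. cover n q R V \<pi> \<and> simp_mod n q V"
    and X: "is_module n q X" and m: "\<And>t. is_module n q (M t)" and M0: "hdim (M 0) = 0"
    and ass: "\<And>t. t \<ge> 1 \<Longrightarrow> almost_split_sequence n q (M t) (module_sum [M (t - 1), M (t + 1)]) (M t)"
    and base: "mod_iso n q (tensor X (M 1)) (module_sum Rs)"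
  shows "mod_iso n q (tensor X (M t)) (module_sum (concat (replicate t Rs)))"
proof (rule tube_ladder[where M = "\<lambda>t. tensor X (M t)", OF n0 cov])
  show "is_module n q (tensor X (M t))" for t by (rule tensor_module[OF X m])
  show "hdim (tensor X (M 0)) = 0" using M0 by simp
  fix t :: nat assume "t \<ge> 1"
  note a = almost_split_ses[OF ass[OF this]]
  show "\<exists>B. is_module n q B \<and> ses (tensor X (M t)) B (tensor X (M t)) \<and>
      mod_iso n q B (module_sum [tensor X (M (t - 1)), tensor X (M (t + 1))])"
    using tensor_module[OF X a(2)] tensor_sum_right[OF m m X]
      tensor_ses_right[OF is_module_wf[OF m] is_module_wf[OF a(2)] is_module_wf[OF m] is_module_wf[OF X] a(4)] by blast
qed (use base in simp_all)

text \<open>The first tube is climbed with the quasi-simple second factor, giving the list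
  \<open>Rs\<close> m times; this m-fold list is the base for the second tube. A permutation then
  collects the m s copies of each cover.\<close>

lemma tensor_band_iso:
  assumes P: "projective_modules n q P" and l: "1 \<le> l" "l \<le> l'" "l' < n" and ne: "\<alpha> \<noteq> \<eta>"
    and X: "is_band_module n q m l r (scale_point (q powi (1 - int l) * qint q l) \<alpha>) X"
    and Y: "is_band_module n q s l' r' (scale_point (q powi (1 - int l') * qint q l') \<eta>) Y"
  defines "Rs \<equiv> map (\<lambda>i. P (nat (int l' - int l - 1 + 2 * i)) (r + r' + int l - i)) [1 .. cfun (int n + int l - int l')] @
     map (\<lambda>i. P (nat (int n + int l + int l' - 1 - 2 * i)) (r + r' + i)) [cfun (int l + int l' - 1) .. int l' - 1]"
  shows "mod_iso n q (tensor X Y) (module_sum (concat (map (replicate (m * s)) Rs)))"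
proof -
  obtain M where M: "hdim (M 0) = 0" "M 1 = Bd l r (scale_point (q powi (1 - int l) * qint q l) \<alpha>)"
    "\<And>t. is_module n q (M t)" "mod_iso n q X (M m)"
    "\<And>t. t \<ge> 1 \<Longrightarrow> almost_split_sequence n q (M t) (module_sum [M (t - 1), M (t + 1)]) (M t)"
    using X unfolding is_band_module_def by blast
  obtain M' where M': "hdim (M' 0) = 0" "M' 1 = Bd l' r' (scale_point (q powi (1 - int l') * qint q l') \<eta>)"
    "\<And>t. is_module n q (M' t)" "mod_iso n q Y (M' s)"
    "\<And>t. t \<ge> 1 \<Longrightarrow> almost_split_sequence n q (M' t) (module_sum [M' (t - 1), M' (t + 1)]) (M' t)"
    using Y unfolding is_band_module_def by blast
  have cov: "\<exists>V \<pi>. cover n q R V \<pi> \<and> simp_mod n q V" if "R \<in> set Rs" for R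
  proof -
    have PV: "\<exists>V \<pi>. cover n q (P (nat u) \<rho>) V \<pi> \<and> simp_mod n q V" if "1 \<le> u" "u \<le> int n" for u \<rho>
    proof -
      have "1 \<le> nat u" "nat u \<le> n" using that by linarith+
      then show ?thesis using P_cover[OF P] Vm_simple by blast
    qed
    from \<open>R \<in> set Rs\<close> consider i where "1 \<le> i" "i \<le> cfun (int n + int l - int l')" "R = P (nat (int l' - int l - 1 + 2 * i)) (r + r' + int l - i)"
      | i where "cfun (int l + int l' - 1) \<le> i" "i \<le> int l' - 1" "R = P (nat (int n + int l + int l' - 1 - 2 * i)) (r + r' + i)"
      unfolding Rs_def by auto
    then show ?thesis
    proof cases
      case 1
      show ?thesis unfolding 1(3) by (rule PV) (use 1(1,2) l in \<open>simp_all add: cfun_def\<close>)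
    next
      case 2
      show ?thesis unfolding 2(3) by (rule PV) (use 2(1,2) l in \<open>simp_all add: cfun_def\<close>)
    qed
  qed
  define Rm where "Rm = concat (replicate m Rs)"
  have covm: "\<exists>V \<pi>. cover n q R V \<pi> \<and> simp_mod n q V" if "R \<in> set Rm" for R
    using that cov unfolding Rm_def by (auto split: if_splits)
  have b: "mod_iso n q (tensor (M 1) (M' 1)) (module_sum Rs)"
    unfolding Rs_def M(2) M'(2) using M(3)[of 1] M'(3)[of 1] unfolding M(2) M'(2)
    by (intro base_decomposition[OF P l ne])
  have bm: "mod_iso n q (tensor (M m) (M' 1)) (module_sum Rm)"
    unfolding Rm_def by (rule tensor_tube_left[where M = M, OF _ M'(3) M(3) M(1) _ b]) (rule cov M(5); assumption)+
  have 1: "mod_iso n q (tensor (M m) (M' s)) (module_sum (concat (replicate s Rm)))"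
    by (rule tensor_tube_right[where M = M', OF _ M(3) M'(3) M'(1) _ bm]) (rule covm M'(5); assumption)+
  have "is_module n q R" if "R \<in> set Rm" for R using covm[OF that] by (auto simp: cover_def projm_def)
  then have mR: "is_module n q R" if "R \<in> set (concat (replicate s Rm))" for R using that by (auto split: if_splits)
  have "mod_iso n q (module_sum (concat (replicate s Rm))) (module_sum (concat (map (replicate (m * s)) Rs)))"
    by (rule module_sum_perm[OF n0 _ mR])
      (simp_all add: mset_concat_replicate mset_concat_map_replicate Rm_def multiset_eq_iff mult_ac)
  with tensor_iso[OF M(4) M'(4)] 1 show ?thesis using mod_iso_trans by blast
qed

end

theorem proposition5p16:
  fixes q :: "'k::alg_closed_field"
    and n l l' m s :: nat
    and r r' :: int
    and \<alpha> \<eta> :: "'k proj_line"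
    and P :: "nat \<Rightarrow> int \<Rightarrow> 'k hmodule"
    and X Y :: "'k hmodule"
  assumes "n > 2"
    and "primitive_root_of_unity n q"
    and "projective_modules n q P"
    and "1 \<le> l" and "l \<le> l'" and "l' < n"
    and "s \<ge> 1" and "m \<ge> 1"
    and "\<alpha> \<noteq> \<eta>"
    and "is_band_module n q m l r (scale_point (q powi (1 - int l) * qint q l) \<alpha>) X"
    and "is_band_module n q s l' r' (scale_point (q powi (1 - int l') * qint q l') \<eta>) Y"
  shows "mod_iso n q (tensor X Y)
    (module_sum
      [module_sum (map (\<lambda>i. copies (m * s)
           (P (nat (int l' - int l - 1 + 2 * i)) (r + r' + int l - i)))
         [1 .. cfun (int n + int l - int l')]),
       module_sum (map (\<lambda>i. copies (m * s)
           (P (nat (int n + int l + int l' - 1 - 2 * i)) (r + r' + i)))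
         [cfun (int l + int l' - 1) .. int l' - 1])])"
proof -
  interpret prim_root n q by unfold_locales (fact assms)+
  show ?thesis
    using tensor_band_iso[OF assms(3-6,9-11)]
    unfolding module_sum_copies module_sum_append[symmetric] map_append concat_append .
qed

end
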